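(* Let $\Bbbk$ be an algebraically closed field, $n\geq1$, and let $S=\Bbbk_{dp}[x_1,\ldots,x_n]\subseteq T=\Bbbk_{dp}[x_0,\ldots,x_n]$. Let $f=F_{d_1}+F_{d_1-1}+\cdots+F_0\in S$, $F_i\in S_i$, be a polynomial of degree $d_1\geq1$ and $r=\dim_{\Bbbk}S^*/\operatorname{Ann}(f)$. For a non-negative integer $d_2$ we have: (i) The cactus rank of $f^{hom,d_2}$ is not greater than $r$. (ii) If $d_2\geq d_1$, then there is no homogeneous ideal $J\subseteq\operatorname{Ann}(f^{hom,d_2})$ such that $T^*/J$ has an $(r-1,n+1)$-standard Hilbert function. Moreover, the same is true for $d_2=d_1-1$ if we assume further that $F_{d_1}$ is not a power of a linear form. In particular, in both cases the border cactus rank of $f^{hom,d_2}$ equals $r$. (iii) Assume that $F_{d_1}$ is not a power of a linear form. If $d_2\geq d_1$ and $J\subseteq\operatorname{Ann}(f^{hom,d_2})$ is a homogeneous ideal such that $T^*/J$ has an $(r,n+1)$-standard Hilbert function, then $J^{sat}=\operatorname{Ann}(f)^{hom}$. Moreover, the same is true for $d_2=d_1-1$ if we assume further that $r>2d_1$.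
   Context: Divided powers: $T^*=\Bbbk[\alpha_0,\ldots,\alpha_n]$ and $S^*=\Bbbk[\alpha_1,\ldots,\alpha_n]$ are polynomial rings; $T=\Bbbk_{dp}[x_0,\ldots,x_n]\supseteq S=\Bbbk_{dp}[x_1,\ldots,x_n]$ are their graded dual (divided power) rings, with $\Bbbk$-basis the divided power monomials $x^{[\mathbf v]}$. $T^*$ acts on $T$ (and $S^*$ on $S$) by contraction: $\alpha^{\mathbf u}\lrcorner x^{[\mathbf v]}=x^{[\mathbf v-\mathbf u]}$ if $v_k\geq u_k$ for all $k$, and $0$ otherwise. For a linear form $L=\sum a_ix_i$, $L^{[d]}=\sum_{|\mathbf u|=d}a^{\mathbf u}x^{[\mathbf u]}$. "Power of a linear form" in degree $d_1$ means an element of the form $L^{[d_1]}$. $\operatorname{Ann}(f)\subseteq S^*$ and $\operatorname{Ann}(f^{hom,d_2})\subseteq T^*$ are the ideals of elements contracting $f$, resp. $f^{hom,d_2}$, to $0$. Homogenization: $f^{hom,d_2}$ is (the line spanned by) $\sum_iF_i\,x_0^{[d_1+d_2-i]}\in T_{d_1+d_2}$. For an ideal $I\subseteq S^*$, $I^{hom}\subseteq T^*$ is its homogenization with respect to $\alpha_0$ (the ideal generated by the homogenizations of all elements of $I$). $J^{sat}$ is the saturation of $J$ with respect to $(\alpha_0,\ldots,\alpha_n)$. Standard Hilbert functions: $h:\mathbb{Z}_{\geq0}\to\mathbb{Z}_{\geq0}$ is $(s,n+1)$-standard if (a) $h(e)\leq h(e+1)$ for all $e$; (b) if $h(e)=h(e+1)$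 then $h(e')=s$ for all $e'\geq e$; (c) $0\leq h(e)\leq\min\{\dim_{\Bbbk}T^*_e,s\}$ for all $e$. Ranks: let $\nu_d:\mathbb{P}T_1\to\mathbb{P}T_d$, $[L]\mapsto[L^{[d]}]$ ($\mathbb{P}$ = lines through $0$). The cactus rank of a nonzero $F\in T_d$ is the least $r\in\mathbb{Z}_{>0}$ such that $[F]\in\langle\nu_d(R)\rangle$ for some zero-dimensional subscheme $R\subseteq\mathbb{P}T_1$ of length $r$ ($\langle\cdot\rangle$ is the projective linear span of a scheme). The cactus variety $\kappa_r(\nu_d(\mathbb{P}T_1))$ is the Zariski closure in $\mathbb{P}T_d$ of the set of $[F]$ of cactus rank at most $r$. The border cactus rank of $F$ is the least $r\in\mathbb{Z}_{>0}$ with $[F]\in\kappa_r(\nu_d(\mathbb{P}T_1))$. *)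

theory Defs
  imports
    "HOL-Library.Poly_Mapping"
    "HOL-Library.Extended_Nat"
    "HOL-Computational_Algebra.Polynomial"
    "HOL-Computational_Algebra.Fraction_Field"
    "HOL-Algebra.Ideal"
begin

section \<open>Polynomials and divided power polynomials\<close>

text \<open>
  A polynomial is a finitely supported map from exponent vectors to coefficients, with the
  convolution product of \<^theory>\<open>HOL-Library.Poly_Mapping\<close>.
  The same type carries the elements of the divided power rings:
  \<open>Poly_Mapping.single v 1\<close> then stands for the divided power monomial $x^{[v]}$, and the ring
  multiplication is \<open>dp_mult\<close> below instead of \<open>(*)\<close>.
  With this, \<open>polys {..n}\<close> is $T^*$ as well as $T$, and \<open>polys {1..n}\<close> is $S^*$ as well as $S$.
\<close>

type_synonym ('i, 'k) mpoly = "('i \<Rightarrow>\<^sub>0 nat) \<Rightarrow>\<^sub>0 'k"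

definition mdeg :: "('i \<Rightarrow>\<^sub>0 nat) \<Rightarrow> nat" where
  "mdeg u = (\<Sum>i\<in>Poly_Mapping.keys u. Poly_Mapping.lookup u i)"

definition exps :: "'i set \<Rightarrow> nat \<Rightarrow> ('i \<Rightarrow>\<^sub>0 nat) set" where
  "exps X d = {u. Poly_Mapping.keys u \<subseteq> X \<and> mdeg u = d}"

definition polys :: "'i set \<Rightarrow> ('i, 'k::zero) mpoly set" where
  "polys X = {p. \<forall>u\<in>Poly_Mapping.keys p. Poly_Mapping.keys u \<subseteq> X}"

text \<open>The graded piece of degree \<open>e\<close> (including 0).\<close>
definition homog :: "'i set \<Rightarrow> nat \<Rightarrow> ('i, 'k::zero) mpoly set" where
  "homog X e = {p. Poly_Mapping.keys p \<subseteq> exps X e}"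

definition homog_comp :: "nat \<Rightarrow> ('i, 'k::comm_monoid_add) mpoly \<Rightarrow> ('i, 'k) mpoly" where
  "homog_comp e p =
     (\<Sum>u\<in>{u\<in>Poly_Mapping.keys p. mdeg u = e}. Poly_Mapping.single u (Poly_Mapping.lookup p u))"

definition tdeg :: "('i, 'k::zero) mpoly \<Rightarrow> nat" where
  "tdeg p = Max (insert 0 (mdeg ` Poly_Mapping.keys p))"

definition pscale :: "'k::semiring_0 \<Rightarrow> ('i, 'k) mpoly \<Rightarrow> ('i, 'k) mpoly" where
  "pscale c p = Poly_Mapping.map ((*) c) p"

definition evalp :: "('i \<Rightarrow> 'k::comm_semiring_1) \<Rightarrow> ('i, 'k) mpoly \<Rightarrow> 'k" where
  "evalp a p = (\<Sum>u\<in>Poly_Mapping.keys p.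
     Poly_Mapping.lookup p u * (\<Prod>i\<in>Poly_Mapping.keys u. a i ^ Poly_Mapping.lookup u i))"

definition poly_ring :: "'i set \<Rightarrow> ('i, 'k::comm_ring_1) mpoly ring" where
  "poly_ring X = \<lparr>carrier = polys X, mult = (*), one = 1, zero = 0, add = (+)\<rparr>"

lemma cring_poly_ring: "cring (poly_ring X :: ('i, 'k::comm_ring_1) mpoly ring)"
proof -
  have add: "p + q \<in> polys X" if "p \<in> polys X" "q \<in> polys X" for p q :: "('i, 'k) mpoly"
    using that Poly_Mapping.keys_add[of p q] by (fastforce simp: polys_def)
  have mult: "p * q \<in> polys X" if "p \<in> polys X" "q \<in> polys X" for p q :: "('i, 'k) mpoly"
  proof -
    have "Poly_Mapping.keys u \<subseteq> X" if u: "u \<in> Poly_Mapping.keys (p * q)" for u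
    proof -
      obtain a b where "a \<in> Poly_Mapping.keys p" "b \<in> Poly_Mapping.keys q" "u = a + b"
        using u Poly_Mapping.keys_mult[of p q] by blast
      then show ?thesis
        using \<open>p \<in> polys X\<close> \<open>q \<in> polys X\<close> Poly_Mapping.keys_add[of a b]
        by (fastforce simp: polys_def)
    qed
    then show ?thesis by (simp add: polys_def)
  qed
  have neg: "\<exists>q\<in>polys X. p + q = 0" if "p \<in> polys X" for p :: "('i, 'k) mpoly"
    using that by (intro bexI[of _ "- p"]) (auto simp: polys_def)
  have const: "(0 :: ('i, 'k) mpoly) \<in> polys X" "(1 :: ('i, 'k) mpoly) \<in> polys X"
    by (auto simp: polys_def)
  show ?thesis
    by (rule cringI, rule abelian_groupI)
       (auto simp: poly_ring_def add mult neg const algebra_simps intro!: comm_monoidI)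
qed

definition dp_mult :: "('i, 'k::comm_semiring_1) mpoly \<Rightarrow> ('i, 'k) mpoly \<Rightarrow> ('i, 'k) mpoly" where
  "dp_mult F G = (\<Sum>u\<in>Poly_Mapping.keys F. \<Sum>v\<in>Poly_Mapping.keys G.
     Poly_Mapping.single (u + v)
       (of_nat (\<Prod>i\<in>Poly_Mapping.keys v.
                  Poly_Mapping.lookup (u + v) i choose Poly_Mapping.lookup v i)
        * (Poly_Mapping.lookup F u * Poly_Mapping.lookup G v)))"

definition contract :: "('i, 'k::comm_semiring_1) mpoly \<Rightarrow> ('i, 'k) mpoly \<Rightarrow> ('i, 'k) mpoly" where
  "contract p F = (\<Sum>u\<in>Poly_Mapping.keys p. \<Sum>v\<in>Poly_Mapping.keys F.
     if \<forall>i. Poly_Mapping.lookup u i \<le> Poly_Mapping.lookup v i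
     then Poly_Mapping.single (v - u) (Poly_Mapping.lookup p u * Poly_Mapping.lookup F v)
     else 0)"

text \<open>Coordinates of a linear form $L = \sum_i a_i x_i$.\<close>
definition lin_coord :: "('i, 'k::zero) mpoly \<Rightarrow> 'i \<Rightarrow> 'k" where
  "lin_coord L i = Poly_Mapping.lookup L (Poly_Mapping.single i 1)"

text \<open>The divided power $L^{[d]}$ of a linear form in the variables \<open>X\<close> (finite).\<close>
definition dp_power :: "'i set \<Rightarrow> ('i, 'k::comm_semiring_1) mpoly \<Rightarrow> nat \<Rightarrow> ('i, 'k) mpoly" where
  "dp_power X L d = (\<Sum>u\<in>exps X d.
     Poly_Mapping.single u (\<Prod>i\<in>Poly_Mapping.keys u. lin_coord L i ^ Poly_Mapping.lookup u i))"

text \<open>The homogenization $f^{hom,d_2} = \sum_i F_i x_0^{[d_1+d_2-i]}$, where $d_1 = \deg f$.\<close>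
definition dp_hom :: "(nat, 'k::comm_semiring_1) mpoly \<Rightarrow> nat \<Rightarrow> (nat, 'k) mpoly" where
  "dp_hom f d2 = (\<Sum>i\<le>tdeg f.
     dp_mult (homog_comp i f)
       (Poly_Mapping.single (Poly_Mapping.single 0 (tdeg f + d2 - i)) 1))"

section \<open>Ideals\<close>

definition Ann :: "'i set \<Rightarrow> ('i, 'k::comm_semiring_1) mpoly \<Rightarrow> ('i, 'k) mpoly set" where
  "Ann X F = {p \<in> polys X. contract p F = 0}"

definition homogeneous_ideal :: "'i set \<Rightarrow> ('i, 'k::comm_ring_1) mpoly set \<Rightarrow> bool" where
  "homogeneous_ideal X J \<longleftrightarrow>
     ideal J (poly_ring X) \<and> (\<forall>p\<in>J. \<forall>e. homog_comp e p \<in> J)"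

definition homogenize :: "(nat, 'k::comm_monoid_add) mpoly \<Rightarrow> (nat, 'k) mpoly" where
  "homogenize g = (\<Sum>u\<in>Poly_Mapping.keys g.
     Poly_Mapping.single (u + Poly_Mapping.single 0 (tdeg g - mdeg u)) (Poly_Mapping.lookup g u))"

definition hom_ideal :: "nat \<Rightarrow> (nat, 'k::comm_ring_1) mpoly set \<Rightarrow> (nat, 'k) mpoly set" where
  "hom_ideal n I = genideal (poly_ring {..n}) (homogenize ` I)"

text \<open>The power $(\alpha_0,\ldots,\alpha_n)^N$.\<close>
definition irrelevant_power :: "nat \<Rightarrow> nat \<Rightarrow> (nat, 'k::comm_ring_1) mpoly set" where
  "irrelevant_power n N =
     genideal (poly_ring {..n}) ((\<lambda>u. Poly_Mapping.single u 1) ` exps {..n} N)"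

definition saturation :: "nat \<Rightarrow> (nat, 'k::comm_ring_1) mpoly set \<Rightarrow> (nat, 'k) mpoly set" where
  "saturation n J = {p \<in> polys {..n}. \<exists>N. \<forall>q\<in>irrelevant_power n N. q * p \<in> J}"

section \<open>Dimensions and Hilbert functions\<close>

text \<open>
  The dimension of $V/W$ for subspaces $W \subseteq V$: the supremum of the cardinalities of
  the finite subsets of \<open>V\<close> that are linearly independent modulo \<open>W\<close>.
\<close>
definition quot_dim ::
    "('k::field \<Rightarrow> 'v::ab_group_add \<Rightarrow> 'v) \<Rightarrow> 'v set \<Rightarrow> 'v set \<Rightarrow> enat" where
  "quot_dim scale V W =
     (SUP B \<in> {B. finite B \<and> B \<subseteq> V \<and>
                  (\<forall>c. (\<Sum>b\<in>B. scale (c b) b) \<in> W \<longrightarrow> (\<forall>b\<in>B. c b = 0))}. enat (card B))"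

text \<open>The Hilbert function of $T^*/J$ for a homogeneous ideal \<open>J\<close>; its values are finite.\<close>
definition hilbert_function :: "nat \<Rightarrow> (nat, 'k::field) mpoly set \<Rightarrow> nat \<Rightarrow> nat" where
  "hilbert_function n J e =
     the_enat (quot_dim pscale (homog {..n} e) (J \<inter> homog {..n} e))"

text \<open>
  \<open>(s, N)\<close>-standard functions, where \<open>N\<close> is the number of variables. The dimension of the graded
  piece depends on the field, which is therefore passed as a type argument.
\<close>
definition standard_function :: "'k::field itself \<Rightarrow> nat \<Rightarrow> nat \<Rightarrow> (nat \<Rightarrow> nat) \<Rightarrow> bool" where
  "standard_function K s N h \<longleftrightarrow>
     (\<forall>e. h e \<le> h (e + 1)) \<and>
     (\<forall>e. h e = h (e + 1) \<longrightarrow> (\<forall>e'\<ge>e. h e' = s)) \<and>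
     (\<forall>e. enat (h e) \<le>
            min (quot_dim pscale (homog {..<N} e :: (nat, 'k) mpoly set) {0}) (enat s))"

section \<open>Subschemes of projective space\<close>

text \<open>A point $[F]$ of a projective space is represented by the line through \<open>F\<close>.\<close>
definition line :: "('i, 'k::field) mpoly \<Rightarrow> ('i, 'k) mpoly set" where
  "line F = {pscale c F | c. True}"

definition proj_space :: "nat \<Rightarrow> nat \<Rightarrow> (nat, 'k::field) mpoly set set" where
  "proj_space n d = {line F | F. F \<in> homog {..n} d \<and> F \<noteq> 0}"

text \<open>
  The homogeneous coordinate ring of $\mathbb{P}T_1$ is $T^*$, where $\alpha_i$ is the coordinate
  dual to $x_i$. Every closed subscheme of $\mathbb{P}T_1$ is $\mathrm{Proj}(T^*/I)$ for some
  homogeneous ideal \<open>I\<close>, and is represented below by any such \<open>I\<close>, saturated or not; everything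
  that follows is phrased through its points and local rings and depends on the subscheme only.
\<close>

definition nonvanishing_at :: "(nat, 'k::field) mpoly \<Rightarrow> (nat, 'k) mpoly set \<Rightarrow> bool" where
  "nonvanishing_at H P \<longleftrightarrow> (\<forall>L\<in>P - {0}. evalp (lin_coord L) H \<noteq> 0)"

text \<open>Closed points of $\mathrm{Proj}(T^*/I)$.\<close>
definition scheme_points :: "nat \<Rightarrow> (nat, 'k::field) mpoly set \<Rightarrow> (nat, 'k) mpoly set set" where
  "scheme_points n I = {P \<in> proj_space n 1. \<forall>G\<in>I. \<forall>L\<in>P - {0}. evalp (lin_coord L) G = 0}"

text \<open>
  The local ring of $\mathbb{P}T_1$ at \<open>P\<close>, consisting of the fractions $G/H$ of forms of the same
  degree with \<open>H\<close> not vanishing at \<open>P\<close>, and the stalk at \<open>P\<close> of the ideal sheaf of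
  $\mathrm{Proj}(T^*/I)$. The local ring of $\mathrm{Proj}(T^*/I)$ is the quotient of the two.
\<close>
definition local_ring :: "nat \<Rightarrow> (nat, 'k::field) mpoly set \<Rightarrow> (nat, 'k) mpoly fract set" where
  "local_ring n P =
     {Fract G H | G H e. G \<in> homog {..n} e \<and> H \<in> homog {..n} e \<and> nonvanishing_at H P}"

definition ideal_stalk ::
    "nat \<Rightarrow> (nat, 'k::field) mpoly set \<Rightarrow> (nat, 'k) mpoly set \<Rightarrow> (nat, 'k) mpoly fract set" where
  "ideal_stalk n I P =
     {Fract G H | G H e. G \<in> I \<inter> homog {..n} e \<and> H \<in> homog {..n} e \<and> nonvanishing_at H P}"

definition fscale :: "'k::field \<Rightarrow> (nat, 'k) mpoly fract \<Rightarrow> (nat, 'k) mpoly fract" where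
  "fscale c x = Fract (Poly_Mapping.single 0 c) 1 * x"

text \<open>
  A closed subscheme of projective space over an algebraically closed field has dimension at most
  zero iff it has finitely many closed points, and its length is then the sum of the dimensions of
  its local rings. The empty subscheme has length 0.
\<close>
definition zero_dim_subscheme :: "nat \<Rightarrow> (nat, 'k::field) mpoly set \<Rightarrow> nat \<Rightarrow> bool" where
  "zero_dim_subscheme n I r \<longleftrightarrow>
     homogeneous_ideal {..n} I \<and> finite (scheme_points n I) \<and>
     (\<Sum>P\<in>scheme_points n I. quot_dim fscale (local_ring n P) (ideal_stalk n I P)) = enat r"

text \<open>
  The section of $\mathcal{O}(d)$ given by \<open>Q\<close> in $T^*_d$ restricts to zero on
  $\mathrm{Proj}(T^*/I)$; at a point, $\mathcal{O}(d)$ is trivialized by any form \<open>H\<close> of degree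
  \<open>d\<close> not vanishing there.
\<close>
definition vanishes_on_scheme ::
    "nat \<Rightarrow> nat \<Rightarrow> (nat, 'k::field) mpoly set \<Rightarrow> (nat, 'k) mpoly \<Rightarrow> bool" where
  "vanishes_on_scheme n d I Q \<longleftrightarrow>
     (\<forall>P\<in>scheme_points n I. \<forall>H\<in>homog {..n} d.
        nonvanishing_at H P \<longrightarrow> Fract Q H \<in> ideal_stalk n I P)"

section \<open>Cactus rank and border cactus rank\<close>

text \<open>
  The homogeneous coordinates on $\mathbb{P}T_d$ are the coefficients of the $x^{[v]}$ with
  \<open>v \<in> exps {..n} d\<close>, so its coordinate ring is \<open>polys (exps {..n} d)\<close>, and \<open>Q\<close> in that ring has
  the value \<open>evalp (Poly_Mapping.lookup F) Q\<close> at \<open>F\<close>.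

  A hyperplane $\{\ell = 0\}$ contains $\nu_d(R)$ iff the pullback of $\ell$ under $\nu_d$, a form
  $Q \in T^*_d$ with $Q(L) = \ell(L^{[d]})$ for all $L$, vanishes on \<open>R\<close>; the linear span is
  the intersection of these hyperplanes. It is given here as a subspace of $T_d$.
\<close>
definition veronese_pullback ::
    "nat \<Rightarrow> nat \<Rightarrow> (nat \<Rightarrow>\<^sub>0 nat, 'k::field) mpoly \<Rightarrow> (nat, 'k) mpoly \<Rightarrow> bool" where
  "veronese_pullback n d l Q \<longleftrightarrow>
     Q \<in> homog {..n} d \<and>
     (\<forall>L\<in>homog {..n} 1. evalp (lin_coord L) Q = evalp (Poly_Mapping.lookup (dp_power {..n} L d)) l)"

definition veronese_span :: "nat \<Rightarrow> nat \<Rightarrow> (nat, 'k::field) mpoly set \<Rightarrow> (nat, 'k) mpoly set" where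
  "veronese_span n d I =
     {F \<in> homog {..n} d. \<forall>l\<in>homog (exps {..n} d) 1. \<forall>Q.
        veronese_pullback n d l Q \<and> vanishes_on_scheme n d I Q \<longrightarrow>
        evalp (Poly_Mapping.lookup F) l = 0}"

definition cactus_rank :: "nat \<Rightarrow> nat \<Rightarrow> (nat, 'k::field) mpoly \<Rightarrow> nat" where
  "cactus_rank n d F =
     (LEAST r. r > 0 \<and> (\<exists>I. zero_dim_subscheme n I r \<and> F \<in> veronese_span n d I))"

definition proj_closure ::
    "nat \<Rightarrow> nat \<Rightarrow> (nat, 'k::field) mpoly set set \<Rightarrow> (nat, 'k) mpoly set set" where
  "proj_closure n d A =
     {P \<in> proj_space n d. \<forall>e. \<forall>Q\<in>homog (exps {..n} d) e.
        (\<forall>P'\<in>A. \<forall>G\<in>P'. evalp (Poly_Mapping.lookup G) Q = 0) \<longrightarrow>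
        (\<forall>G\<in>P. evalp (Poly_Mapping.lookup G) Q = 0)}"

definition cactus_variety :: "nat \<Rightarrow> nat \<Rightarrow> nat \<Rightarrow> (nat, 'k::field) mpoly set set" where
  "cactus_variety n d r =
     proj_closure n d {line F | F. F \<in> homog {..n} d \<and> F \<noteq> 0 \<and> cactus_rank n d F \<le> r}"

definition border_cactus_rank :: "nat \<Rightarrow> nat \<Rightarrow> (nat, 'k::field) mpoly \<Rightarrow> nat" where
  "border_cactus_rank n d F = (LEAST r. r > 0 \<and> line F \<in> cactus_variety n d r)"

end

theory Submission
  imports Defs
begin

text \<open>
  Dehomogenization lets \<open>T\<^sup>*\<close> act on \<open>S\<close>. For a form \<open>p\<close> of degree \<open>e\<close>, contracting \<open>f\<^sup>h\<^sup>o\<^sup>m\<close> by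
  \<open>p\<close> amounts to contracting \<open>f\<close> by the dehomogenized \<open>p\<close> and dropping the terms of degree greater
  than \<open>d\<^sub>1 + d\<^sub>2 - e\<close>. Hence \<open>Ann(f\<^sup>h\<^sup>o\<^sup>m)\<close> and \<open>Ann(f)\<^sup>h\<^sup>o\<^sup>m\<close> agree in degrees at most \<open>d\<^sub>2\<close>,
  and \<open>Ann(f)\<^sup>h\<^sup>o\<^sup>m\<close>, which has codimension \<open>r\<close> in all degrees at least \<open>d\<^sub>1\<close>, defines a scheme of
  length at most \<open>r\<close> supported at \<open>[x\<^sub>0]\<close> whose span contains \<open>f\<^sup>h\<^sup>o\<^sup>m\<close>.

  If \<open>d\<^sub>2 = d\<^sub>1 - 1\<close>, a form of degree \<open>d\<^sub>1\<close> in \<open>Ann(f\<^sup>h\<^sup>o\<^sup>m)\<close> but not in \<open>Ann(f)\<^sup>h\<^sup>o\<^sup>m\<close> takes \<open>f\<close> to a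
  nonzero multiple of the leading form of \<open>f\<close>. As the leading form is not a power of a linear form,
  \<open>Ann(f)\<^sup>h\<^sup>o\<^sup>m\<close> is generated in degree \<open>d\<^sub>1\<close> from there on, so such a form makes the codimension drop
  to \<open>r - 2\<close> in degree \<open>d\<^sub>1 + 1\<close>.

  The lower bound for the border cactus rank needs no limits of ideals. If \<open>G\<close> has cactus rank at
  most \<open>s\<close>, then \<open>Ann(G)\<^sub>e\<close> has codimension at most \<open>s\<close>, and if equality holds, then
  \<open>T\<^sup>*\<^sub>1 Ann(G)\<^sub>e\<close> has codimension at least \<open>s\<close>; both are polynomial conditions on \<open>G\<close>.
\<close>

text \<open>Degree \<open>d1\<close> decides everything: from there on \<open>Ann(f)^hom\<close> has
  codimension \<open>r\<close>, because operators of order above \<open>d1\<close> kill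
  \<open>f\<close>. If \<open>d2 \<ge> d1\<close>, both annihilators agree in that degree, and no
  ideal of smaller codimension fits in. If \<open>d2 = d1 - 1\<close>, the degree lies just outside
  the range of agreement: the annihilator of the form can have codimension \<open>r - 1\<close>
  there, and only the next degree gives a contradiction. Hence the second condition on forms of
  small cactus rank. The obstacle is that annihilators jump with \<open>G\<close>. The cure is to
  fix catalecticant rows that are maximal independent at the given form: elements of their kernel at
  that form extend to polynomial families in the kernels at all \<open>G\<close>. The second
  condition is then tested by a product of two polynomials, one guarding the rows and one the
  independence of the extended products. For codimension \<open>r\<close> the drop is no
  contradiction by itself, since the ideal may be a hyperplane of the annihilator in degree
  \<open>d1\<close>. The bound \<open>r > 2 * d1\<close> is what remains of
  \<open>2r - 1 > r + 1 + 2(d1 - 1)\<close>, the two estimates in degree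
  \<open>2 d1 - 1\<close>.\<close>

abbreviation "lookup \<equiv> Poly_Mapping.lookup"
abbreviation "single \<equiv> Poly_Mapping.single"
abbreviation "keys \<equiv> Poly_Mapping.keys"

subsection \<open>Dimensions modulo a subspace\<close>

text \<open>A separate locale, because additions to the locale of vector spaces would be shadowed by the
  unqualified global interpretation for real vector spaces.\<close>
locale vspace = vector_space scale for scale :: "'k::field \<Rightarrow> 'v::ab_group_add \<Rightarrow> 'v"
begin

definition indep_mod :: "'v set \<Rightarrow> 'v set \<Rightarrow> bool" where
  "indep_mod W B \<longleftrightarrow> (\<forall>c. (\<Sum>b\<in>B. scale (c b) b) \<in> W \<longrightarrow> (\<forall>b\<in>B. c b = 0))"

lemma quot_dim_alt:
  "quot_dim scale V W = (SUP B \<in> {B. finite B \<and> B \<subseteq> V \<and> indep_mod W B}. enat (card B))"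
  by (simp add: quot_dim_def indep_mod_def)

lemma quot_dim_ge:
  assumes "finite B" "B \<subseteq> V" "indep_mod W B"
  shows "enat (card B) \<le> quot_dim scale V W"
  unfolding quot_dim_alt by (rule SUP_upper) (use assms in auto)

lemma quot_dim_leI:
  assumes "\<And>B. finite B \<Longrightarrow> B \<subseteq> V \<Longrightarrow> indep_mod W B \<Longrightarrow> enat (card B) \<le> m"
  shows "quot_dim scale V W \<le> m"
  unfolding quot_dim_alt by (rule SUP_least) (use assms in auto)

definition fin_dim :: "'v set \<Rightarrow> bool" where
  "fin_dim V \<longleftrightarrow> (\<exists>B. finite B \<and> V \<subseteq> span B)"

lemma fin_dim_subset: "fin_dim V \<Longrightarrow> W \<subseteq> V \<Longrightarrow> fin_dim W"
  by (auto simp: fin_dim_def)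

lemma fin_dim_basis:
  assumes "fin_dim V"
  obtains B where "B \<subseteq> V" "independent B" "V \<subseteq> span B" "card B = dim V" "finite B"
proof -
  obtain B where B: "B \<subseteq> V" "independent B" "V \<subseteq> span B" "card B = dim V"
    using basis_exists by blast
  obtain C where "finite C" "V \<subseteq> span C" using assms by (auto simp: fin_dim_def)
  then have "finite B" using independent_span_bound[of C B] B by blast
  with B that show thesis by blast
qed

lemma card_independent_le_dim:
  assumes "fin_dim V" "independent B" "B \<subseteq> V"
  shows "finite B" "card B \<le> dim V"
proof -
  obtain C where "C \<subseteq> V" "V \<subseteq> span C" "card C = dim V" "finite C"
    using fin_dim_basis[OF assms(1)] by metis
  then show "finite B" "card B \<le> dim V"
    using independent_span_bound[of C B] assms by auto
qed

lemma dim_mono_fin: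
  assumes "fin_dim V" "W \<subseteq> V"
  shows "dim W \<le> dim V"
proof -
  obtain B where "B \<subseteq> W" "independent B" "card B = dim W" using basis_exists by metis
  then show ?thesis using card_independent_le_dim[OF assms(1), of B] assms(2) by auto
qed

lemma independent_sum_zero:
  assumes "independent B" "finite B" "(\<Sum>b\<in>B. scale (c b) b) = 0" "b \<in> B"
  shows "c b = 0"
  using assms unfolding dependent_explicit by blast

text \<open>Bridge from the supremum to dimensions. A family independent modulo \<open>W\<close>
  stays independent when a basis of \<open>W\<close> is joined to it; conversely a basis of
  \<open>W\<close> extends to one of \<open>V\<close>, and the added vectors are independent modulo
  \<open>W\<close>.\<close>

lemma quot_dim_dim:
  assumes V: "subspace V" "fin_dim V" and W: "subspace W" "W \<subseteq> V"
  shows "quot_dim scale V W = enat (dim V - dim W)"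
proof (rule antisym)
  obtain C where C: "C \<subseteq> W" "independent C" "W \<subseteq> span C" "card C = dim W" "finite C"
    using fin_dim_basis[OF fin_dim_subset[OF V(2) W(2)]] by metis
  show "quot_dim scale V W \<le> enat (dim V - dim W)"
  proof (rule quot_dim_leI)
    fix D assume D: "finite D" "D \<subseteq> V" "indep_mod W D"
    have disj: "D \<inter> C = {}"
    proof (rule ccontr)
      assume "D \<inter> C \<noteq> {}"
      then obtain d where d: "d \<in> D" "d \<in> C" by blast
      have "(\<Sum>b\<in>D. scale (if b = d then 1 else 0) b) = d"
        using D(1) d(1) by (subst sum.remove[of _ d]) (auto intro: sum.neutral)
      then have "(\<Sum>b\<in>D. scale (if b = d then 1 else 0) b) \<in> W" using d(2) C(1) by auto
      from D(3)[unfolded indep_mod_def, THEN spec, THEN mp, OF this]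
      show False using d(1) by auto
    qed
    have "independent (D \<union> C)"
    proof (rule independent_if_scalars_zero)
      fix c x assume s: "(\<Sum>x\<in>D \<union> C. scale (c x) x) = 0" and x: "x \<in> D \<union> C"
      have eq: "(\<Sum>x\<in>D. scale (c x) x) + (\<Sum>x\<in>C. scale (c x) x) = 0"
        using s D(1) C(5) disj by (simp add: sum.union_disjoint)
      have inW: "(\<Sum>x\<in>C. scale (c x) x) \<in> W"
        using C(1) W(1) by (intro subspace_sum subspace_scale) auto
      have "(\<Sum>x\<in>D. scale (c x) x) = - (\<Sum>x\<in>C. scale (c x) x)"
        using eq by (simp add: eq_neg_iff_add_eq_0)
      then have "(\<Sum>x\<in>D. scale (c x) x) \<in> W"
        using subspace_neg[OF W(1) inW] by simp
      then have cD: "\<forall>b\<in>D. c b = 0" using D(3) by (auto simp: indep_mod_def)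
      then have "(\<Sum>x\<in>C. scale (c x) x) = 0" using eq by simp
      then show "c x = 0" using independent_sum_zero[OF C(2,5)] cD x by blast
    qed (use D(1) C(5) in auto)
    then have "card (D \<union> C) \<le> dim V"
      using card_independent_le_dim(2)[OF V(2)] D(2) C(1) W(2) by blast
    then show "enat (card D) \<le> enat (dim V - dim W)"
      using D(1) C(4,5) disj by (simp add: card_Un_disjoint)
  qed
  obtain B where B: "C \<subseteq> B" "B \<subseteq> V" "independent B" "V \<subseteq> span B"
    using maximal_independent_subset_extend[of C V] C(1,2) W(2) by blast
  have finB: "finite B" and cardB: "card B = dim V"
    using card_independent_le_dim[OF V(2) B(3,2)] basis_card_eq_dim[OF B(2,4,3)] by auto
  have "indep_mod W (B - C)"
    unfolding indep_mod_def
  proof (intro allI impI)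
    fix c assume "(\<Sum>b\<in>B - C. scale (c b) b) \<in> W"
    then obtain g where g: "(\<Sum>b\<in>B - C. scale (c b) b) = (\<Sum>b\<in>C. scale (g b) b)"
      using C(3) span_finite[OF C(5)] by auto
    have "(\<Sum>b\<in>B. scale (if b \<in> C then - g b else c b) b)
        = (\<Sum>b\<in>B - C. scale (c b) b) + (\<Sum>b\<in>C. scale (- g b) b)"
      using finB B(1) by (subst sum.subset_diff[of C]) (auto intro!: arg_cong2[of _ _ _ _ "(+)"] sum.cong)
    also have "\<dots> = 0" using g by (simp add: sum_negf)
    finally have z: "(\<Sum>b\<in>B. scale (if b \<in> C then - g b else c b) b) = 0" .
    show "\<forall>b\<in>B - C. c b = 0"
    proof
      fix b assume "b \<in> B - C"
      then show "c b = 0" using independent_sum_zero[OF B(3) finB z, of b] by simp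
    qed
  qed
  then have "enat (card (B - C)) \<le> quot_dim scale V W"
    using finB B(2) by (intro quot_dim_ge) auto
  then show "enat (dim V - dim W) \<le> quot_dim scale V W"
    using B(1) C(4,5) cardB by (simp add: card_Diff_subset)
qed

lemma fin_dim_span: "finite B \<Longrightarrow> fin_dim (span B)"
  by (auto simp: fin_dim_def)

lemma subspace_eq_if_dim_le:
  assumes "fin_dim V" "subspace W" "W \<subseteq> V" "dim V \<le> dim W"
  shows "W = V"
proof -
  obtain B where B: "B \<subseteq> W" "independent B" "W \<subseteq> span B" "card B = dim W"
    using basis_exists by metis
  have fB: "finite B" using card_independent_le_dim[OF assms(1) B(2)] B(1) assms(3) by blast
  have "V \<subseteq> span B"
  proof
    fix x assume x: "x \<in> V"
    show "x \<in> span B"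
    proof (rule ccontr)
      assume n: "x \<notin> span B"
      then have "independent (insert x B)" "x \<notin> B" using B(2) span_superset by (auto simp: independent_insertI)
      then have "card (insert x B) \<le> dim V"
        using card_independent_le_dim(2)[OF assms(1)] B(1) assms(3) x by blast
      then show False using fB \<open>x \<notin> B\<close> B(4) assms(4) by simp
    qed
  qed
  also have "span B \<subseteq> W" using B(1) assms(2) by (simp add: span_minimal)
  finally show ?thesis using assms(3) by blast
qed

lemma dim_psubset_fin:
  assumes "fin_dim V" "subspace W" "W \<subset> V"
  shows "dim W < dim V"
proof (rule ccontr)
  assume "\<not> ?thesis"
  then have "W = V" using assms(3) by (intro subspace_eq_if_dim_le[OF assms(1,2)]) auto
  then show False using assms(3) by simp
qed

end

text \<open>\<open>\<phi>\<close> induces an injection of quotients. Phrased with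
  \<open>quot_dim\<close> and not \<open>dim\<close> because the target will be a local ring, in
  general of infinite dimension.\<close>

lemma quot_dim_le_of_linear:
  fixes s1 :: "'k::field \<Rightarrow> 'a::ab_group_add \<Rightarrow> 'a" and s2 :: "'k \<Rightarrow> 'b::ab_group_add \<Rightarrow> 'b"
  assumes lin: "Vector_Spaces.linear s1 s2 \<phi>" and V: "module.subspace s1 V"
    and im: "\<And>x. x \<in> V \<Longrightarrow> \<phi> x \<in> V'" and ker: "\<And>x. x \<in> V \<Longrightarrow> \<phi> x \<in> W' \<Longrightarrow> x \<in> W"
    and 0: "0 \<in> W'"
  shows "quot_dim s1 V W \<le> quot_dim s2 V' W'"
proof -
  interpret v1: vspace s1 using lin by (simp add: Vector_Spaces.linear_def vspace_def)
  interpret v2: vspace s2 using lin by (simp add: Vector_Spaces.linear_def vspace_def)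
  interpret l: Vector_Spaces.linear s1 s2 \<phi> by fact
  show ?thesis
  proof (rule v1.quot_dim_leI)
    fix B assume B: "finite B" "B \<subseteq> V" "v1.indep_mod W B"
    have indep: "(\<Sum>b\<in>B. s2 (c b) (\<phi> b)) \<in> W' \<Longrightarrow> \<forall>b\<in>B. c b = 0" for c
    proof -
      assume a: "(\<Sum>b\<in>B. s2 (c b) (\<phi> b)) \<in> W'"
      have "(\<Sum>b\<in>B. s1 (c b) b) \<in> V"
        using B(2) V by (intro v1.subspace_sum v1.subspace_scale) auto
      moreover have "\<phi> (\<Sum>b\<in>B. s1 (c b) b) \<in> W'" using a by (simp add: l.sum l.scale)
      ultimately have "(\<Sum>b\<in>B. s1 (c b) b) \<in> W" by (rule ker)
      from B(3)[unfolded v1.indep_mod_def, THEN spec, THEN mp, OF this] show ?thesis .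
    qed
    have inj: "inj_on \<phi> B"
    proof (rule inj_onI, rule ccontr)
      fix x y assume xy: "x \<in> B" "y \<in> B" "\<phi> x = \<phi> y" "x \<noteq> y"
      define c :: "'a \<Rightarrow> 'k" where "c = (\<lambda>b. if b = x then 1 else if b = y then - 1 else 0)"
      have "(\<Sum>b\<in>B. s2 (c b) (\<phi> b)) = s2 (c x) (\<phi> x) + s2 (c y) (\<phi> y)"
      proof -
        have "(\<Sum>b\<in>B. s2 (c b) (\<phi> b)) = (\<Sum>b\<in>{x, y}. s2 (c b) (\<phi> b))"
          using xy B(1) by (intro sum.mono_neutral_right) (auto simp: c_def)
        then show ?thesis using xy(4) by simp
      qed
      also have "\<dots> = 0" using xy(3,4) by (simp add: c_def)
      finally have "c x = 0" using indep[of c] 0 xy(1) by simp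
      then show False by (simp add: c_def)
    qed
    have "v2.indep_mod W' (\<phi> ` B)"
      unfolding v2.indep_mod_def
    proof (intro allI impI)
      fix c assume "(\<Sum>b\<in>\<phi> ` B. s2 (c b) b) \<in> W'"
      then have "(\<Sum>b\<in>B. s2 (c (\<phi> b)) (\<phi> b)) \<in> W'" by (simp add: sum.reindex[OF inj])
      then show "\<forall>b\<in>\<phi> ` B. c b = 0" using indep[of "c \<circ> \<phi>"] by simp
    qed
    then have "enat (card (\<phi> ` B)) \<le> quot_dim s2 V' W'"
      using B im by (intro v2.quot_dim_ge) auto
    then show "enat (card B) \<le> quot_dim s2 V' W'" by (simp add: card_image[OF inj])
  qed
qed

text \<open>Independence is pulled back along \<open>\<phi>\<close>. Only the given \<open>B\<close>
  has to be reached: finitely many germs lie in the image of a space of forms once a common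
  denominator is fixed, so \<open>\<phi>\<close> will depend on \<open>B\<close>.\<close>

lemma card_le_quot_dim_of_linear:
  fixes s1 :: "'k::field \<Rightarrow> 'a::ab_group_add \<Rightarrow> 'a" and s2 :: "'k \<Rightarrow> 'b::ab_group_add \<Rightarrow> 'b"
  assumes lin: "Vector_Spaces.linear s1 s2 \<phi>"
    and B: "finite B" "B \<subseteq> \<phi> ` V" "\<And>c. (\<Sum>b\<in>B. s2 (c b) b) \<in> W' \<Longrightarrow> (\<forall>b\<in>B. c b = 0)"
    and ker: "\<And>x. x \<in> W \<Longrightarrow> \<phi> x \<in> W'"
  shows "enat (card B) \<le> quot_dim s1 V W"
proof -
  interpret v1: vspace s1 using lin by (simp add: Vector_Spaces.linear_def vspace_def)
  interpret v2: vspace s2 using lin by (simp add: Vector_Spaces.linear_def vspace_def)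
  interpret l: Vector_Spaces.linear s1 s2 \<phi> by fact
  have "\<forall>b\<in>B. \<exists>x. x \<in> V \<and> \<phi> x = b" using B(2) by auto
  then obtain g where g: "\<And>b. b \<in> B \<Longrightarrow> g b \<in> V \<and> \<phi> (g b) = b" by (metis bchoice)
  have inj: "inj_on g B" proof (rule inj_onI)
    fix x y assume xy: "x \<in> B" "y \<in> B" "g x = g y"
    have "x = \<phi> (g x)" using g[OF xy(1)] by simp
    also have "\<dots> = y" using g[OF xy(2)] xy(3) by simp
    finally show "x = y" .
  qed
  have "v1.indep_mod W (g ` B)"
    unfolding v1.indep_mod_def
  proof (intro allI impI)
    fix c assume "(\<Sum>b\<in>g ` B. s1 (c b) b) \<in> W"
    then have "(\<Sum>b\<in>B. s1 (c (g b)) (g b)) \<in> W" by (simp add: sum.reindex[OF inj])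
    then have "\<phi> (\<Sum>b\<in>B. s1 (c (g b)) (g b)) \<in> W'" by (rule ker)
    moreover have "\<phi> (\<Sum>b\<in>B. s1 (c (g b)) (g b)) = (\<Sum>b\<in>B. s2 (c (g b)) b)"
      by (simp add: l.sum l.scale g)
    ultimately have "\<forall>b\<in>B. c (g b) = 0" using B(3)[of "c \<circ> g"] by simp
    then show "\<forall>b\<in>g ` B. c b = 0" by simp
  qed
  then have "enat (card (g ` B)) \<le> quot_dim s1 V W"
    using B(1) g by (intro v1.quot_dim_ge) auto
  then show ?thesis by (simp add: card_image[OF inj])
qed

lemma quot_dim_lift:
  fixes s1 :: "'k::field \<Rightarrow> 'a::ab_group_add \<Rightarrow> 'a" and s2 :: "'k \<Rightarrow> 'b::ab_group_add \<Rightarrow> 'b"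
  assumes lin: "Vector_Spaces.linear s1 s2 \<phi>" and "V' \<subseteq> \<phi> ` V" and ker: "\<And>x. x \<in> W \<Longrightarrow> \<phi> x \<in> W'"
  shows "quot_dim s2 V' W' \<le> quot_dim s1 V W"
proof -
  interpret v1: vspace s1 using lin by (simp add: Vector_Spaces.linear_def vspace_def)
  interpret v2: vspace s2 using lin by (simp add: Vector_Spaces.linear_def vspace_def)
  interpret l: Vector_Spaces.linear s1 s2 \<phi> by fact
  show ?thesis
  proof (rule v2.quot_dim_leI)
    fix B assume B: "finite B" "B \<subseteq> V'" "v2.indep_mod W' B"
    show "enat (card B) \<le> quot_dim s1 V W"
    proof (rule card_le_quot_dim_of_linear[OF lin B(1)])
      show "B \<subseteq> \<phi> ` V" using B(2) assms(2) by (rule subset_trans)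
      show "\<forall>b\<in>B. c b = 0" if "(\<Sum>b\<in>B. s2 (c b) b) \<in> W'" for c
        using B(3)[unfolded v2.indep_mod_def, THEN spec, THEN mp, OF that] .
    qed (rule ker)
  qed
qed

text \<open>Rank and nullity on a subspace: \<open>V\<close> modulo the kernel and the image embed
  into each other.\<close>

lemma dim_kernel_image:
  fixes s1 :: "'k::field \<Rightarrow> 'a::ab_group_add \<Rightarrow> 'a" and s2 :: "'k \<Rightarrow> 'b::ab_group_add \<Rightarrow> 'b"
  assumes lin: "Vector_Spaces.linear s1 s2 \<phi>" and V: "module.subspace s1 V" "vspace.fin_dim s1 V"
  shows "vector_space.dim s1 V = vector_space.dim s2 (\<phi> ` V) + vector_space.dim s1 {x \<in> V. \<phi> x = 0}"
    "vspace.fin_dim s2 (\<phi> ` V)"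
proof -
  interpret v1: vspace s1 using lin by (simp add: Vector_Spaces.linear_def vspace_def)
  interpret v2: vspace s2 using lin by (simp add: Vector_Spaces.linear_def vspace_def)
  interpret l: Vector_Spaces.linear s1 s2 \<phi> by fact
  let ?K = "{x \<in> V. \<phi> x = 0}"
  have K: "v1.subspace ?K"
    using V(1) by (auto simp: v1.subspace_def l.add l.scale)
  obtain B where "finite B" "V \<subseteq> v1.span B" using V(2) by (auto simp: v1.fin_dim_def)
  then have "\<phi> ` V \<subseteq> v2.span (\<phi> ` B)" by (metis image_mono l.span_image)
  with \<open>finite B\<close> show fd: "v2.fin_dim (\<phi> ` V)" unfolding v2.fin_dim_def by blast
  have "quot_dim s1 V ?K \<le> quot_dim s2 (\<phi> ` V) {0}"
    by (rule quot_dim_le_of_linear[OF lin V(1)]) auto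
  moreover have "quot_dim s2 (\<phi> ` V) {0} \<le> quot_dim s1 V ?K"
    by (rule quot_dim_lift[OF lin]) auto
  moreover have "quot_dim s1 V ?K = enat (v1.dim V - v1.dim ?K)"
    by (rule v1.quot_dim_dim[OF V K]) auto
  moreover have "v2.subspace (\<phi> ` V)" using V(1) by (rule l.subspace_image)
  then have "quot_dim s2 (\<phi> ` V) {0} = enat (v2.dim (\<phi> ` V) - v2.dim {0})"
    using fd by (intro v2.quot_dim_dim) (auto simp: v2.subspace_0)
  moreover have "v2.dim {0} = 0"
    using v2.dim_le_card[of "{0}" "{}"] by simp
  moreover have "v1.dim ?K \<le> v1.dim V"
    by (rule v1.dim_mono_fin[OF V(2)]) auto
  ultimately show "v1.dim V = v2.dim (\<phi> ` V) + v1.dim ?K" by simp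
qed

subsection \<open>Exponent vectors\<close>

lemma mdeg_superset:
  assumes "finite A" "keys u \<subseteq> A"
  shows "mdeg u = (\<Sum>i\<in>A. lookup u i)"
  unfolding mdeg_def using assms by (intro sum.mono_neutral_left) (auto simp: in_keys_iff)

lemma mdeg_add [simp]: "mdeg (u + v) = mdeg u + mdeg v"
proof -
  let ?A = "keys u \<union> keys v"
  have "keys (u + v) \<subseteq> ?A" by (rule Poly_Mapping.keys_add)
  then show ?thesis
    using mdeg_superset[of ?A "u + v"] mdeg_superset[of ?A u] mdeg_superset[of ?A v]
    by (simp add: lookup_add sum.distrib)
qed

lemma mdeg_single [simp]: "mdeg (single i k) = k"
  by (simp add: mdeg_def)

lemma mdeg_0 [simp]: "mdeg 0 = 0"
  by (simp add: mdeg_def)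

lemma mdeg_eq_0_iff [simp]: "mdeg u = 0 \<longleftrightarrow> u = 0"
  by (auto simp: mdeg_def in_keys_iff intro!: poly_mapping_eqI)

lemma keys_add_nat:
  "keys (u + v) = keys u \<union> keys (v :: 'i \<Rightarrow>\<^sub>0 nat)"
  by (auto simp: in_keys_iff lookup_add)

lemma exps_add: "u \<in> exps X d \<Longrightarrow> v \<in> exps X e \<Longrightarrow> u + v \<in> exps X (d + e)"
  by (simp add: exps_def keys_add_nat)

lemma single_in_exps: "i \<in> X \<Longrightarrow> single i k \<in> exps X k"
  by (simp add: exps_def)

lemma exps_Suc_cases:
  assumes "u \<in> exps X (Suc d)"
  obtains i v where "i \<in> X" "v \<in> exps X d" "u = single i 1 + v"
proof -
  have "u \<noteq> 0" using assms by (auto simp: exps_def)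
  then obtain i where i: "i \<in> keys u" by (metis all_not_in_conv keys_eq_empty)
  define v where "v = u - single i 1"
  have u: "u = single i 1 + v"
    using i by (auto intro!: poly_mapping_eqI simp: v_def lookup_add lookup_minus lookup_single when_def in_keys_iff)
  have "v \<in> exps X d" using assms unfolding u by (auto simp: exps_def keys_add_nat)
  with u i assms that show thesis by (auto simp: exps_def)
qed

lemma finite_exps [simp]: assumes "finite X" shows "finite (exps X d)"
proof (induction d)
  case 0
  have "exps X 0 \<subseteq> {0}" by (auto simp: exps_def)
  then show ?case by (rule finite_subset) simp
next
  case (Suc d)
  have "exps X (Suc d) \<subseteq> (\<lambda>(i, v). single i 1 + v) ` (X \<times> exps X d)"
    by (auto elim!: exps_Suc_cases)
  moreover have "finite ((\<lambda>(i, v). single i 1 + v) ` (X \<times> exps X d))"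
    using Suc assms by auto
  ultimately show ?case by (rule finite_subset)
qed

definition del :: "(nat \<Rightarrow>\<^sub>0 nat) \<Rightarrow> (nat \<Rightarrow>\<^sub>0 nat)" where
  "del u = u - single 0 (lookup u 0)"

lemma lookup_del: "lookup (del u) i = (if i = 0 then 0 else lookup u i)"
  by (simp add: del_def lookup_minus lookup_single when_def)

lemma del_add [simp]: "del (u + v) = del u + del v"
  by (rule poly_mapping_eqI) (simp add: lookup_del lookup_add)

lemma del_id [simp]: "lookup u 0 = 0 \<Longrightarrow> del u = u"
  by (rule poly_mapping_eqI) (simp add: lookup_del)

lemma del_single_0 [simp]: "del (single 0 k) = 0"
  by (rule poly_mapping_eqI) (simp add: lookup_del lookup_single)

lemma del_split: "u = del u + single 0 (lookup u 0)"
  by (rule poly_mapping_eqI) (simp add: lookup_del lookup_add lookup_single when_def)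

lemma mdeg_split: "mdeg u = mdeg (del u) + lookup u 0"
  by (metis del_split mdeg_add mdeg_single)

lemma keys_del: "keys (del u) = keys u - {0}"
  by (auto simp: in_keys_iff lookup_del split: if_splits)

lemma mdeg_del_le: "mdeg (del u) \<le> mdeg u"
  using mdeg_split[of u] by simp

lemma exps_no_0: "u \<in> exps {1..n::nat} d \<Longrightarrow> lookup u 0 = 0"
proof (rule ccontr)
  assume "u \<in> exps {1..n::nat} d" "lookup u 0 \<noteq> 0"
  then have "0 \<in> {1..n::nat}" unfolding exps_def by (auto simp del: atLeastAtMost_iff simp: in_keys_iff)
  then show False by simp
qed

lemma exps_del_eq:
  assumes "u \<in> exps {..n} d"
  shows "u = del u + single 0 (d - mdeg (del u))"
proof -
  have "d - mdeg (del u) = lookup u 0" using assms mdeg_split[of u] unfolding exps_def by auto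
  then show ?thesis by (metis del_split)
qed

subsection \<open>Polynomials as a vector space\<close>

lemma lookup_pscale [simp]: "lookup (pscale c p) u = c * lookup p u"
  by (simp add: pscale_def map.rep_eq when_def)

lemma pscale_conv_mult: "pscale c p = single 0 c * p"
  by (simp add: pscale_def mult_map_scale_conv_mult)

interpretation mp: vspace "pscale :: 'k::field \<Rightarrow> ('i, 'k) mpoly \<Rightarrow> _"
  by unfold_locales (auto intro!: poly_mapping_eqI simp: lookup_add algebra_simps)

interpretation ks: vspace "(*) :: 'k::field \<Rightarrow> 'k \<Rightarrow> 'k"
  by unfold_locales (auto simp: algebra_simps)

interpretation mpk: vector_space_pair "pscale :: 'k::field \<Rightarrow> ('i, 'k) mpoly \<Rightarrow> _" "(*) :: 'k \<Rightarrow> 'k \<Rightarrow> 'k" ..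

lemma linear_mpI:
  assumes "\<And>p q. \<phi> (p + q) = \<phi> p + \<phi> q" "\<And>c p. \<phi> (pscale c p) = s (c :: 'k::field) (\<phi> p)" "vector_space s"
  shows "Vector_Spaces.linear pscale s \<phi>"
proof -
  interpret v: vector_space s by fact
  show ?thesis by unfold_locales (use assms in auto)
qed

lemma pscale_single [simp]: "pscale c (single u d) = single u (c * d)"
  by (rule poly_mapping_eqI) (simp add: lookup_single when_def)

lemma poly_mapping_sum_single: "(\<Sum>u\<in>keys p. single u (lookup p u)) = p"
  by (rule poly_mapping_eqI) (simp add: lookup_sum lookup_single when_def in_keys_iff)

lemma poly_mapping_sum_single_superset:
  assumes "finite A" "keys p \<subseteq> A"
  shows "(\<Sum>u\<in>A. single u (lookup p u)) = p"
proof -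
  have "(\<Sum>u\<in>A. single u (lookup p u))
      = (\<Sum>u\<in>keys p. single u (lookup p u))"
    using assms by (intro sum.mono_neutral_right) (auto simp: in_keys_iff)
  then show ?thesis by (simp add: poly_mapping_sum_single)
qed

lemma keys_pscale: "keys (pscale c p) \<subseteq> keys p"
  by (auto simp: in_keys_iff)

lemma homog_iff: "p \<in> homog X e \<longleftrightarrow> (\<forall>u. lookup p u \<noteq> 0 \<longrightarrow> u \<in> exps X e)"
  by (auto simp: homog_def in_keys_iff)

lemma homogD: "p \<in> homog X e \<Longrightarrow> lookup p u \<noteq> 0 \<Longrightarrow> u \<in> exps X e"
  by (simp add: homog_iff)

lemma subspace_homog: "mp.subspace (homog X e :: ('i, 'k::field) mpoly set)"
proof (rule mp.subspaceI)
  fix x y :: "('i, 'k) mpoly" and c :: 'k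
  show "x + y \<in> homog X e" if "x \<in> homog X e" "y \<in> homog X e"
    using that Poly_Mapping.keys_add[of x y] by (auto simp: homog_def)
  show "pscale c x \<in> homog X e" if "x \<in> homog X e"
    using that keys_pscale[of c x] by (auto simp: homog_def)
qed (simp add: homog_def)

lemma homog_subset_polys: "homog X e \<subseteq> polys X"
  by (auto simp: homog_def polys_def exps_def)

lemma single_in_homog: "u \<in> exps X e \<Longrightarrow> single u c \<in> homog X e"
  by (auto simp: homog_def)

lemma homog_mono: "X \<subseteq> Y \<Longrightarrow> homog X e \<subseteq> homog Y e"
  unfolding homog_def exps_def by blast

lemma S_subset_T: "homog {1..n::nat} e \<subseteq> homog {..n} e"
  by (rule homog_mono) auto

lemma polys_iff: "p \<in> polys X \<longleftrightarrow> (\<forall>u. lookup p u \<noteq> 0 \<longrightarrow> keys u \<subseteq> X)"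
  by (auto simp: polys_def in_keys_iff)

lemma subspace_polys: "mp.subspace (polys X :: ('i, 'k::field) mpoly set)"
proof (rule mp.subspaceI)
  fix x y :: "('i, 'k) mpoly" and c :: 'k
  show "x + y \<in> polys X" if "x \<in> polys X" "y \<in> polys X"
    using that Poly_Mapping.keys_add[of x y] by (fastforce simp: polys_def)
  show "pscale c x \<in> polys X" if "x \<in> polys X"
    using that keys_pscale[of c x] by (auto simp: polys_def)
qed (simp add: polys_def)

lemma homog_eq_span:
  assumes "finite X"
  shows "(homog X e :: ('i, 'k::field) mpoly set) = mp.span ((\<lambda>u. single u 1) ` exps X e)"
proof
  show "homog X e \<subseteq> mp.span ((\<lambda>u. single u (1::'k)) ` exps X e)"
  proof
    fix p :: "('i, 'k) mpoly" assume "p \<in> homog X e"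
    then have "p = (\<Sum>u\<in>exps X e. single u (lookup p u))"
      using assms by (intro poly_mapping_sum_single_superset[symmetric]) (auto simp: homog_def)
    also have "\<dots> = (\<Sum>u\<in>exps X e. pscale (lookup p u) (single u 1))"
      by simp
    also have "\<dots> \<in> mp.span ((\<lambda>u. single u (1::'k)) ` exps X e)"
      by (intro mp.span_sum mp.span_scale mp.span_base) auto
    finally show "p \<in> mp.span ((\<lambda>u. single u (1::'k)) ` exps X e)" .
  qed
qed (intro mp.span_minimal subspace_homog, auto intro: single_in_homog)

lemma fin_dim_homog: "finite X \<Longrightarrow> mp.fin_dim (homog X e :: ('i, 'k::field) mpoly set)"
  by (metis homog_eq_span mp.fin_dim_span finite_imageI finite_exps)

lemma mult_sum_single:
  "p * q = (\<Sum>u\<in>keys p. \<Sum>v\<in>keys q.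
     single (u + v) (lookup p u * lookup q v))"
proof -
  have "p * q = (\<Sum>u\<in>keys p. single u (lookup p u))
     * (\<Sum>v\<in>keys q. single v (lookup q v))"
    by (simp add: poly_mapping_sum_single)
  then show ?thesis by (simp add: sum_product mult_single)
qed

lemma homog_mult: "p \<in> homog X d \<Longrightarrow> q \<in> homog X e \<Longrightarrow> p * q \<in> homog X (d + e)"
  using Poly_Mapping.keys_mult[of p q] unfolding homog_def
  by (fastforce intro: exps_add)

lemma polys_mult: "p \<in> polys X \<Longrightarrow> q \<in> polys X \<Longrightarrow> p * q \<in> polys X"
  using Poly_Mapping.keys_mult[of p q] unfolding polys_def by (fastforce simp: keys_add_nat)

lemma lookup_single_mult_add:
  fixes p :: "('i, 'k::comm_semiring_1) mpoly"
  shows "lookup (single u c * p) (u + w) = c * lookup p w"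
proof -
  have "single u c * p
      = (\<Sum>v\<in>keys p. single (u + v) (c * lookup p v))"
    by (subst (1) poly_mapping_sum_single[of p, symmetric]) (simp add: sum_distrib_left mult_single)
  then show ?thesis by (simp add: lookup_sum lookup_single when_def in_keys_iff)
qed

lemma lookup_single_mult_0:
  fixes p :: "('i, 'k::comm_semiring_1) mpoly"
  assumes "\<And>w. v \<noteq> u + w"
  shows "lookup (single u c * p) v = 0"
proof -
  have "single u c * p
      = (\<Sum>v\<in>keys p. single (u + v) (c * lookup p v))"
    by (subst (1) poly_mapping_sum_single[of p, symmetric]) (simp add: sum_distrib_left mult_single)
  moreover have "u + w \<noteq> v" for w using assms by metis
  ultimately show ?thesis by (simp add: lookup_sum lookup_single)
qed

subsection \<open>Homogeneous components\<close>

lemma lookup_homog_comp: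
  "lookup (homog_comp e p) u = (if mdeg u = e then lookup p u else 0)"
  by (auto simp: homog_comp_def lookup_sum lookup_single when_def in_keys_iff)

lemma homog_comp_in_homog: "p \<in> polys X \<Longrightarrow> homog_comp e p \<in> homog X e"
  by (auto simp: homog_iff lookup_homog_comp polys_def exps_def in_keys_iff)

lemma sum_homog_comp: "(\<Sum>e\<in>mdeg ` keys p. homog_comp e p) = p"
  by (rule poly_mapping_eqI) (auto simp: lookup_homog_comp lookup_sum in_keys_iff)

lemma tdeg_le_iff: "tdeg p \<le> t \<longleftrightarrow> (\<forall>u. lookup p u \<noteq> 0 \<longrightarrow> mdeg u \<le> t)"
  by (auto simp: tdeg_def in_keys_iff)

lemma mdeg_le_tdeg: "lookup p u \<noteq> 0 \<Longrightarrow> mdeg u \<le> tdeg p"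
  using tdeg_le_iff by blast

lemma tdeg_attained:
  assumes "p \<noteq> 0"
  obtains u where "lookup p u \<noteq> 0" "mdeg u = tdeg p"
proof -
  have "keys p \<noteq> {}" using assms by simp
  then have "tdeg p = Max (mdeg ` keys p)"
    unfolding tdeg_def by (subst Max_insert) auto
  then have "tdeg p \<in> mdeg ` keys p"
    using \<open>keys p \<noteq> {}\<close> by (metis Max_in finite_imageI finite_keys image_is_empty)
  then show thesis using that by (auto simp: in_keys_iff)
qed

subsection \<open>Contraction\<close>

lemma lookup_contract_superset:
  assumes "finite A" "keys p \<subseteq> A"
  shows "lookup (contract p F) w = (\<Sum>u\<in>A. lookup p u * lookup F (w + u))"
proof -
  have *: "lookup (if \<forall>i. lookup u i \<le> lookup v i
      then single (v - u) (lookup p u * lookup F v) else 0) w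
    = (if v = w + u then lookup p u * lookup F v else 0)" for u v
  proof -
    have "(\<forall>i. lookup u i \<le> lookup v i) \<and> v - u = w \<longleftrightarrow> v = w + u"
      unfolding poly_mapping_eq_iff fun_eq_iff lookup_add lookup_minus
      by (metis le_add2 le_add_diff_inverse2 add_diff_cancel_right')
    then show ?thesis by (auto simp: lookup_single when_def)
  qed
  have "lookup (contract p F) w
      = (\<Sum>u\<in>keys p. lookup p u * lookup F (w + u))"
    unfolding contract_def lookup_sum * by (intro sum.cong) (auto simp: in_keys_iff)
  also have "\<dots> = (\<Sum>u\<in>A. lookup p u * lookup F (w + u))"
    using assms by (intro sum.mono_neutral_left) (auto simp: in_keys_iff)
  finally show ?thesis .
qed

lemma lookup_contract:
  "lookup (contract p F) w
    = (\<Sum>u\<in>keys p. lookup p u * lookup F (w + u))"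
  by (rule lookup_contract_superset) auto

lemma lookup_contract_single [simp]:
  "lookup (contract (single u c) F) w = c * lookup F (w + u)"
  by (subst lookup_contract_superset[of "{u}"]) auto

lemma contract_add_left: "contract (p + q) F = contract p F + contract q F"
proof (rule poly_mapping_eqI)
  fix w
  let ?A = "keys p \<union> keys q"
  have "keys (p + q) \<subseteq> ?A" by (rule Poly_Mapping.keys_add)
  then show "lookup (contract (p + q) F) w = lookup (contract p F + contract q F) w"
    using lookup_contract_superset[of ?A "p + q"] lookup_contract_superset[of ?A p] lookup_contract_superset[of ?A q]
    by (simp add: lookup_add sum.distrib distrib_right)
qed

lemma contract_add_right: "contract p (F + G) = contract p F + contract p G"
  by (rule poly_mapping_eqI) (simp add: lookup_add lookup_contract sum.distrib distrib_left)

lemma contract_0_left [simp]: "contract 0 F = 0"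
  by (simp add: contract_def)

lemma contract_0_right [simp]: "contract p 0 = 0"
  by (simp add: contract_def)

lemma contract_sum_left: "contract (\<Sum>i\<in>A. g i) F = (\<Sum>i\<in>A. contract (g i) F)"
  by (induction A rule: infinite_finite_induct) (simp_all add: contract_add_left)

lemma contract_pscale_left: "contract (pscale c p) F = pscale c (contract p F)"
  by (rule poly_mapping_eqI)
    (simp add: lookup_contract_superset[OF finite_keys keys_pscale[of c p]] lookup_contract[of p] sum_distrib_left mult.assoc
      del: lookup_contract_single)

lemma contract_pscale_right: "contract p (pscale c F) = pscale c (contract p F)"
  by (rule poly_mapping_eqI) (simp add: lookup_contract sum_distrib_left mult.left_commute)

lemma contract_mult: "contract (p * q) F = contract p (contract q F)"
proof (rule poly_mapping_eqI)
  fix w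
  have "lookup (contract (p * q) F) w = (\<Sum>u\<in>keys p. \<Sum>v\<in>keys q.
      lookup p u * lookup q v * lookup F (w + (u + v)))"
    by (simp add: mult_sum_single contract_sum_left lookup_sum)
  also have "\<dots> = lookup (contract p (contract q F)) w"
    by (simp add: lookup_contract sum_distrib_left mult.assoc add.assoc)
  finally show "lookup (contract (p * q) F) w = lookup (contract p (contract q F)) w" .
qed

lemma contract_1 [simp]: "contract 1 F = F"
  by (rule poly_mapping_eqI) (simp flip: single_one)

lemma linear_contract: "Vector_Spaces.linear pscale pscale (\<lambda>p. contract p (F :: ('i, 'k::field) mpoly))"
  by (rule linear_mpI) (auto simp: contract_add_left contract_pscale_left mp.vector_space_axioms)

lemma linear_mult: "Vector_Spaces.linear pscale pscale (\<lambda>p. q * (p :: ('i, 'k::field) mpoly))"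
  by (rule linear_mpI) (auto simp: distrib_left pscale_conv_mult mult.left_commute mp.vector_space_axioms)

lemma contract_degree:
  assumes "p \<in> homog X e" "lookup (contract p F) w \<noteq> 0"
  obtains u where "u \<in> exps X e" "lookup p u \<noteq> 0" "lookup F (w + u) \<noteq> 0"
proof -
  obtain u where "u \<in> keys p" "lookup p u * lookup F (w + u) \<noteq> 0"
    using assms(2) unfolding lookup_contract by (meson sum.not_neutral_contains_not_neutral)
  then have "u \<in> exps X e" "lookup p u \<noteq> 0" "lookup F (w + u) \<noteq> 0"
    using assms(1) by (auto simp: homog_def)
  then show thesis by (rule that)
qed

lemma tdeg_contract_le: "tdeg (contract p F) \<le> tdeg F"
  unfolding tdeg_le_iff
proof (intro allI impI)
  fix w assume "lookup (contract p F) w \<noteq> 0"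
  then obtain u where "lookup p u * lookup F (w + u) \<noteq> 0"
    unfolding lookup_contract by (meson sum.not_neutral_contains_not_neutral)
  then have "mdeg (w + u) \<le> tdeg F" by (intro mdeg_le_tdeg) auto
  then show "mdeg w \<le> tdeg F" by simp
qed

text \<open>At an exponent of top degree of \<open>g\<close> only the constant term of
  \<open>p\<close> contributes. So operators with nonzero constant term act injectively; they play
  the part of units of the local ring at \<open>[x_0]\<close>.\<close>

lemma contract_eq_0_const:
  fixes g :: "('i, 'k::field) mpoly"
  assumes "contract p g = 0" "g \<noteq> 0"
  shows "lookup p 0 = 0"
proof -
  obtain w where w: "lookup g w \<noteq> 0" "mdeg w = tdeg g" using tdeg_attained[OF assms(2)] by blast
  have "lookup (contract p g) w
      = (\<Sum>u\<in>insert 0 (keys p). lookup p u * lookup g (w + u))"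
    by (rule lookup_contract_superset) auto
  also have "\<dots> = (\<Sum>u\<in>{0}. lookup p u * lookup g (w + u))"
  proof (rule sum.mono_neutral_right)
    show "\<forall>i\<in>insert 0 (keys p) - {0}. lookup p i * lookup g (w + i) = 0"
    proof
      fix u assume "u \<in> insert 0 (keys p) - {0}"
      then have "mdeg u \<noteq> 0" by simp
      then have "mdeg (w + u) > tdeg g" using w(2) by (simp only: mdeg_add)
      then show "lookup p u * lookup g (w + u) = 0"
        using mdeg_le_tdeg[of g "w + u"] by fastforce
    qed
  qed auto
  finally show ?thesis using assms(1) w(1) by simp
qed

subsection \<open>Homogenization and dehomogenization\<close>

definition deh :: "(nat, 'k::field) mpoly \<Rightarrow> (nat, 'k) mpoly" where
  "deh p = (\<Sum>u\<in>keys p. single (del u) (lookup p u))"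

lemma deh_superset:
  assumes "finite A" "keys p \<subseteq> A"
  shows "deh p = (\<Sum>u\<in>A. single (del u) (lookup p u))"
  unfolding deh_def using assms by (intro sum.mono_neutral_left) (auto simp: in_keys_iff)

lemma deh_add: "deh (p + q) = deh p + deh q"
proof -
  let ?A = "keys p \<union> keys q"
  have "keys (p + q) \<subseteq> ?A" by (rule Poly_Mapping.keys_add)
  then show ?thesis
    using deh_superset[of ?A "p + q"] deh_superset[of ?A p] deh_superset[of ?A q]
    by (simp add: lookup_add single_add sum.distrib)
qed

lemma deh_0 [simp]: "deh 0 = 0"
  by (simp add: deh_def)

lemma deh_single [simp]: "deh (single u c) = single (del u) c"
  by (subst deh_superset[of "{u}"]) auto

lemma deh_sum: "deh (\<Sum>i\<in>A. g i) = (\<Sum>i\<in>A. deh (g i))"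
  by (induction A rule: infinite_finite_induct) (simp_all add: deh_add)

lemma deh_mult: "deh (p * q) = deh p * deh q"
  unfolding mult_sum_single[of p q] deh_sum deh_single
  by (simp add: deh_def sum_product mult_single)

lemma deh_pscale: "deh (pscale c p) = pscale c (deh p)"
  unfolding pscale_conv_mult deh_mult by simp

lemma linear_deh: "Vector_Spaces.linear pscale pscale deh"
  by (rule linear_mpI) (auto simp: deh_add deh_pscale mp.vector_space_axioms)

lemma poly_mapping_single_induct [consumes 1, case_names zero single add]:
  fixes p :: "'a \<Rightarrow>\<^sub>0 'b::comm_monoid_add"
  assumes "keys p \<subseteq> A" "P 0"
    "\<And>u c. u \<in> A \<Longrightarrow> P (single u c)" "\<And>p q. P p \<Longrightarrow> P q \<Longrightarrow> P (p + q)"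
  shows "P p"
proof -
  have "P (\<Sum>u\<in>B. single u (lookup p u))" if "finite B" "B \<subseteq> A" for B
    using that by (induction B rule: finite_induct) (auto intro: assms)
  from this[of "keys p"] show ?thesis
    using assms(1) by (simp add: poly_mapping_sum_single)
qed

lemma no_0_in_S: "p \<in> polys {1..n::nat} \<Longrightarrow> lookup p u \<noteq> 0 \<Longrightarrow> lookup u 0 = 0"
  using exps_no_0[of u n "mdeg u"] by (auto simp: polys_iff exps_def)

lemma deh_id:
  assumes "p \<in> polys {1..n}"
  shows "deh p = p"
proof -
  have "deh p = (\<Sum>u\<in>keys p. single u (lookup p u))"
    unfolding deh_def using no_0_in_S[OF assms] by (intro sum.cong) (auto simp: in_keys_iff)
  then show ?thesis by (simp add: poly_mapping_sum_single)
qed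

lemma lookup_deh_neq_0:
  assumes "lookup (deh p) w \<noteq> 0"
  obtains u where "lookup p u \<noteq> 0" "w = del u"
proof -
  have "\<exists>u\<in>keys p. lookup (single (del u) (lookup p u)) w \<noteq> 0"
    using assms unfolding deh_def lookup_sum by (meson sum.not_neutral_contains_not_neutral)
  then show thesis using that by (auto simp: lookup_single when_def in_keys_iff split: if_splits)
qed

lemma deh_in_polys: "p \<in> polys {..n} \<Longrightarrow> deh p \<in> polys {1..n}"
  unfolding polys_iff by (auto elim!: lookup_deh_neq_0 simp: keys_del subset_iff)

lemma tdeg_deh_le: "p \<in> homog X e \<Longrightarrow> tdeg (deh p) \<le> e"
  unfolding tdeg_le_iff
  using mdeg_del_le by (fastforce elim!: lookup_deh_neq_0 dest: homogD simp: exps_def)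

text \<open>Homogenization into a prescribed degree, meaningful for \<open>tdeg g \<le> t\<close>
  because the subtraction is truncated. It serves operators and divided power polynomials alike, see
  \<open>dp_hom_eq_hz\<close>.\<close>

definition hz :: "nat \<Rightarrow> (nat, 'k::field) mpoly \<Rightarrow> (nat, 'k) mpoly" where
  "hz t g = (\<Sum>u\<in>keys g.
     single (u + single 0 (t - mdeg u)) (lookup g u))"

lemma homogenize_eq_hz: "homogenize g = hz (tdeg g) g"
  by (simp add: homogenize_def hz_def)

lemma hz_superset:
  assumes "finite A" "keys p \<subseteq> A"
  shows "hz t p = (\<Sum>u\<in>A. single (u + single 0 (t - mdeg u)) (lookup p u))"
  unfolding hz_def using assms by (intro sum.mono_neutral_left) (auto simp: in_keys_iff)

lemma hz_add: "hz t (p + q) = hz t p + hz t q"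
proof -
  let ?A = "keys p \<union> keys q"
  have "keys (p + q) \<subseteq> ?A" by (rule Poly_Mapping.keys_add)
  then show ?thesis
    using hz_superset[of ?A "p + q"] hz_superset[of ?A p] hz_superset[of ?A q]
    by (simp add: lookup_add single_add sum.distrib)
qed

lemma hz_0 [simp]: "hz t 0 = 0"
  by (simp add: hz_def)

lemma hz_single [simp]: "hz t (single u c) = single (u + single 0 (t - mdeg u)) c"
  by (subst hz_superset[of "{u}"]) auto

lemma deh_hz:
  assumes "g \<in> polys {1..n}"
  shows "deh (hz t g) = g"
proof -
  have "lookup u 0 = 0" if "lookup g u \<noteq> 0" for u using no_0_in_S[OF assms that] .
  then have *: "keys g \<subseteq> {u. lookup u 0 = 0}" by (auto simp: in_keys_iff)
  show ?thesis
    using * by (induction g rule: poly_mapping_single_induct) (auto simp: deh_add hz_add)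
qed

lemma hz_deh:
  assumes "G \<in> homog {..n} e"
  shows "hz e (deh G) = G"
  using assms unfolding homog_def mem_Collect_eq
proof (induction G rule: poly_mapping_single_induct)
  case (single u c)
  then show ?case using exps_del_eq[of u n e] by simp
qed (auto simp: deh_add hz_add)

lemma hz_in_homog:
  assumes "g \<in> polys {1..n}" "tdeg g \<le> t"
  shows "hz t g \<in> homog {..n} t"
proof -
  have *: "keys g \<subseteq> {u. keys u \<subseteq> {1..n} \<and> mdeg u \<le> t}"
    using assms by (auto simp: polys_iff tdeg_le_iff in_keys_iff subset_iff)
  show ?thesis using *
  proof (induction g rule: poly_mapping_single_induct)
    case (single u c)
    have "keys (u + single 0 (t - mdeg u)) \<subseteq> {..n}"
      using single by (auto simp: keys_add_nat split: if_splits)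
    then show ?case using single by (auto intro!: single_in_homog simp: exps_def)
  qed (use subspace_homog in \<open>auto simp: mp.subspace_def hz_add\<close>)
qed

lemma lookup_hz:
  assumes "g \<in> polys {1..n}" "tdeg g \<le> t"
  shows "lookup (hz t g) v = (if mdeg v = t then lookup g (del v) else 0)"
proof -
  have *: "keys g \<subseteq> {u. lookup u 0 = 0 \<and> mdeg u \<le> t}"
    using no_0_in_S[OF assms(1)] assms(2) by (auto simp: tdeg_le_iff in_keys_iff)
  show ?thesis using *
  proof (induction g rule: poly_mapping_single_induct)
    case (single u c)
    have "u + single 0 (t - mdeg u) = v \<longleftrightarrow> mdeg v = t \<and> u = del v"
    proof
      assume "mdeg v = t \<and> u = del v"
      then show "u + single 0 (t - mdeg u) = v"
        using del_split[of v] mdeg_split[of v] by (metis add_diff_cancel_left')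
    qed (use single in auto)
    then show ?case by (auto simp: lookup_single when_def)
  qed (auto simp: hz_add lookup_add)
qed

lemma hz_mult:
  assumes "g \<in> polys {1..n}" "tdeg g \<le> t"
  shows "hz (k + t) g = single (single 0 k) 1 * hz t g"
proof -
  have *: "keys g \<subseteq> {u. mdeg u \<le> t}"
    using assms(2) by (auto simp: tdeg_le_iff in_keys_iff)
  show ?thesis using *
  proof (induction g rule: poly_mapping_single_induct)
    case (single u c)
    then have "u + single 0 (k + t - mdeg u)
      = single 0 k + (u + single 0 (t - mdeg u))"
      by (auto intro!: poly_mapping_eqI simp: lookup_add lookup_single when_def)
    then show ?case by (simp add: mult_single)
  qed (auto simp: hz_add distrib_left)
qed

text \<open>All binomial coefficients of the divided power product are 1, since the variable 0 does
  not occur in \<open>G\<close>.\<close>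

lemma dp_mult_single_0:
  fixes G :: "(nat, 'k::field) mpoly"
  assumes "G \<in> polys {1..n}"
  shows "dp_mult G (single (single 0 c) 1)
    = (\<Sum>u\<in>keys G. single (u + single 0 c) (lookup G u))"
  unfolding dp_mult_def
proof (intro sum.cong refl)
  fix u assume "u \<in> keys G"
  then have "lookup u 0 = 0" using no_0_in_S[OF assms] by (simp add: in_keys_iff)
  then show "(\<Sum>v\<in>keys (single (single 0 c) (1::'k)).
         single (u + v)
          (of_nat (\<Prod>i\<in>keys v. lookup (u + v) i choose lookup v i) *
           (lookup G u * lookup (single (single 0 c) 1) v))) =
    single (u + single 0 c) (lookup G u)"
    by (cases "c = 0") (simp_all add: lookup_add)
qed

lemma dp_hom_eq_hz:
  fixes f :: "(nat, 'k::field) mpoly"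
  assumes "f \<in> polys {1..n}"
  shows "dp_hom f d2 = hz (tdeg f + d2) f"
proof -
  let ?h = "\<lambda>u. single (u + single 0 (tdeg f + d2 - mdeg u)) (lookup f u)"
  have "dp_mult (homog_comp i f) (single (single 0 (tdeg f + d2 - i)) 1)
     = (\<Sum>u\<in>{u\<in>keys f. mdeg u = i}. ?h u)" for i
  proof -
    have "homog_comp i f \<in> polys {1..n}"
      using homog_comp_in_homog[OF assms, of i] homog_subset_polys by blast
    moreover have "keys (homog_comp i f) = {u\<in>keys f. mdeg u = i}"
      by (auto simp: in_keys_iff lookup_homog_comp split: if_splits)
    ultimately show ?thesis
      by (simp add: dp_mult_single_0) (rule sum.cong, auto simp: lookup_homog_comp)
  qed
  then have "dp_hom f d2 = (\<Sum>i\<in>{..tdeg f}. \<Sum>u\<in>{u\<in>keys f. mdeg u = i}. ?h u)"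
    by (simp add: dp_hom_def)
  also have "\<dots> = (\<Sum>u\<in>keys f. ?h u)"
    by (rule sum.group) (auto simp: in_keys_iff intro: mdeg_le_tdeg)
  finally show ?thesis by (simp add: hz_def)
qed

subsection \<open>The action of \<open>T\<^sup>*\<close> on \<open>S\<close> through dehomogenization\<close>

definition act :: "(nat, 'k::field) mpoly \<Rightarrow> (nat, 'k) mpoly \<Rightarrow> (nat, 'k) mpoly" where
  "act f p = contract (deh p) f"

lemma act_add: "act f (p + q) = act f p + act f q"
  by (simp add: act_def deh_add contract_add_left)

lemma act_pscale: "act f (pscale c p) = pscale c (act f p)"
  by (simp add: act_def deh_pscale contract_pscale_left)

lemma act_mult: "act f (p * q) = contract (deh p) (act f q)"
  by (simp add: act_def deh_mult contract_mult)

lemma linear_act: "Vector_Spaces.linear pscale pscale (act f)"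
  by (rule linear_mpI) (auto simp: act_add act_pscale mp.vector_space_axioms)

lemma lookup_act: "lookup (act f p) w
    = (\<Sum>u\<in>keys p. lookup p u * lookup f (w + del u))"
  by (simp add: act_def deh_def contract_sum_left lookup_sum)

lemma contract_in_polys: "F \<in> polys X \<Longrightarrow> contract p F \<in> polys X"
  unfolding polys_iff
proof (intro allI impI)
  fix w assume F: "\<forall>u. lookup F u \<noteq> 0 \<longrightarrow> keys u \<subseteq> X"
    and "lookup (contract p F) w \<noteq> 0"
  then obtain u where "lookup p u * lookup F (w + u) \<noteq> 0"
    unfolding lookup_contract by (meson sum.not_neutral_contains_not_neutral)
  then have "lookup F (w + u) \<noteq> 0" by auto
  then have "keys (w + u) \<subseteq> X" using F by blast
  then show "keys w \<subseteq> X" by (auto simp: keys_add_nat)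
qed

lemma act_in_polys: "f \<in> polys X \<Longrightarrow> act f p \<in> polys X"
  by (simp add: act_def contract_in_polys)

text \<open>After contraction the degree is \<open>t - e\<close>, and the exponent of the variable 0
  is determined by the others. The truncation is implicit: \<open>del w\<close> runs only over
  exponents of degree at most \<open>t - e\<close>.\<close>

lemma contract_hz:
  assumes f: "f \<in> polys {1..n}" "tdeg f \<le> t" and p: "p \<in> homog X e"
  shows "lookup (contract p (hz t f)) w
    = (if mdeg w + e = t then lookup (act f p) (del w) else 0)"
proof -
  have "lookup p u * lookup (hz t f) (w + u)
      = (if mdeg w + e = t then lookup p u * lookup f (del w + del u) else 0)" for u
    using homogD[OF p, of u] by (cases "lookup p u = 0") (auto simp: lookup_hz[OF f] exps_def)
  then show ?thesis by (simp add: lookup_contract lookup_act)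
qed

text \<open>Nothing is truncated here: \<open>act f p\<close> has degree at most
  \<open>tdeg f\<close>, so each of its exponents can be padded with the variable 0 up to degree
  \<open>t - e\<close>.\<close>

lemma contract_hz_eq_0_iff:
  assumes f: "f \<in> polys {1..n}" and p: "p \<in> homog X e" and t: "tdeg f + e \<le> t"
  shows "contract p (hz t f) = 0 \<longleftrightarrow> act f p = 0"
proof
  have ft: "tdeg f \<le> t" using t by simp
  note K = contract_hz[OF f ft p]
  show "act f p = 0" if 0: "contract p (hz t f) = 0"
  proof (rule poly_mapping_eqI, rule ccontr)
    fix w assume "lookup (act f p) w \<noteq> lookup 0 w"
    then have w: "lookup (act f p) w \<noteq> 0" by simp
    have w0: "lookup w 0 = 0" using no_0_in_S[OF act_in_polys[OF f] w] .
    have "mdeg w \<le> tdeg f"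
      using mdeg_le_tdeg[OF w] tdeg_contract_le[of "deh p" f] by (simp add: act_def)
    then have "mdeg (w + single 0 (t - e - mdeg w)) + e = t" using t by simp
    then show False using K[of "w + single 0 (t - e - mdeg w)"] 0 w w0 by simp
  qed
  show "contract p (hz t f) = 0" if "act f p = 0"
    using that by (intro poly_mapping_eqI) (simp add: K)
qed

subsection \<open>The homogenized annihilator\<close>

lemma ideal_poly_ringD:
  fixes J :: "('i, 'k::comm_ring_1) mpoly set"
  assumes "ideal J (poly_ring X)"
  shows "J \<subseteq> polys X" "0 \<in> J" "p \<in> J \<Longrightarrow> q \<in> J \<Longrightarrow> p + q \<in> J" "q \<in> polys X \<Longrightarrow> p \<in> J \<Longrightarrow> q * p \<in> J"
proof -
  interpret ideal J "poly_ring X" by fact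
  show "J \<subseteq> polys X" using a_subset by (simp add: poly_ring_def)
  show "0 \<in> J" using additive_subgroup.zero_closed[OF additive_subgroup_axioms] by (simp add: poly_ring_def)
  show "p + q \<in> J" if "p \<in> J" "q \<in> J" using additive_subgroup.a_closed[OF additive_subgroup_axioms that] by (simp add: poly_ring_def)
  show "q * p \<in> J" if "q \<in> polys X" "p \<in> J" using I_l_closed[of p q] that by (simp add: poly_ring_def)
qed

lemma single_0_in_polys: "single 0 c \<in> polys X"
  by (auto simp: polys_def)

lemma subspace_ideal:
  fixes J :: "('i, 'k::field) mpoly set"
  assumes "ideal J (poly_ring X)"
  shows "mp.subspace J"
  by (rule mp.subspaceI)
    (auto simp: pscale_conv_mult intro!: ideal_poly_ringD[OF assms] single_0_in_polys)

lemma ideal_poly_ringI: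
  fixes J :: "('i, 'k::comm_ring_1) mpoly set"
  assumes "J \<subseteq> polys X" "0 \<in> J" "\<And>p q. p \<in> J \<Longrightarrow> q \<in> J \<Longrightarrow> p + q \<in> J"
    "\<And>p q. q \<in> polys X \<Longrightarrow> p \<in> J \<Longrightarrow> q * p \<in> J"
  shows "ideal J (poly_ring X)"
proof -
  interpret R: cring "poly_ring X :: ('i, 'k) mpoly ring" by (rule cring_poly_ring)
  have neg: "- p \<in> J" if "p \<in> J" for p
    using assms(4)[OF single_0_in_polys that, of "- 1"] by (simp add: single_uminus)
  have inv: "inv\<^bsub>add_monoid (poly_ring X)\<^esub> p = - p" if "p \<in> J" for p
  proof (rule group.inv_equality[OF R.a_group])
    show "- p \<otimes>\<^bsub>add_monoid (poly_ring X)\<^esub> p = \<one>\<^bsub>add_monoid (poly_ring X)\<^esub>" by (simp add: poly_ring_def)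
    show "p \<in> carrier (add_monoid (poly_ring X))" "- p \<in> carrier (add_monoid (poly_ring X))"
      using that neg[OF that] assms(1) by (auto simp: poly_ring_def)
  qed
  show ?thesis
  proof (rule idealI[OF R.ring_axioms])
    show "subgroup J (add_monoid (poly_ring X))"
      by (rule subgroup.intro) (use assms inv neg in \<open>auto simp: poly_ring_def\<close>)
    show "x \<otimes>\<^bsub>poly_ring X\<^esub> a \<in> J" if "a \<in> J" "x \<in> carrier (poly_ring X)" for a x
      using assms(4)[of x a] that by (simp add: poly_ring_def)
    show "a \<otimes>\<^bsub>poly_ring X\<^esub> x \<in> J" if "a \<in> J" "x \<in> carrier (poly_ring X)" for a x
      using assms(4)[of x a] that by (simp add: poly_ring_def mult.commute)
  qed
qed

text \<open>Since \<open>f\<^sup>h\<^sup>o\<^sup>m\<close> is contracted by a power of the homogenizing variable to the homogenization of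
  lower degree, \<open>Ann(f)\<^sup>h\<^sup>o\<^sup>m\<close> is the ideal annihilating all homogenizations of high degree.\<close>
definition Ann_hom :: "nat \<Rightarrow> (nat, 'k::field) mpoly \<Rightarrow> (nat, 'k) mpoly set" where
  "Ann_hom n f = {p \<in> polys {..n}. \<exists>N. \<forall>D\<ge>N. contract p (hz D f) = 0}"

lemma ideal_Ann_hom:
  fixes f :: "(nat, 'k::field) mpoly"
  shows "ideal (Ann_hom n f) (poly_ring {..n})"
proof (rule ideal_poly_ringI)
  fix p q assume p: "p \<in> Ann_hom n f" and q: "q \<in> Ann_hom n f"
  obtain N M where "\<forall>D\<ge>N. contract p (hz D f) = 0" "\<forall>D\<ge>M. contract q (hz D f) = 0"
    using p q by (auto simp: Ann_hom_def)
  then have "\<forall>D\<ge>max N M. contract (p + q) (hz D f) = 0" by (simp add: contract_add_left)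
  moreover have "p + q \<in> polys {..n}"
    using p q subspace_polys by (auto simp: Ann_hom_def mp.subspace_def)
  ultimately show "p + q \<in> Ann_hom n f" unfolding Ann_hom_def by blast
next
  fix p q :: "(nat, 'k) mpoly" assume q: "q \<in> polys {..n}" and p: "p \<in> Ann_hom n f"
  then obtain N where "p \<in> polys {..n}" "\<forall>D\<ge>N. contract p (hz D f) = 0" by (auto simp: Ann_hom_def)
  then have "q * p \<in> polys {..n}" "\<forall>D\<ge>N. contract (q * p) (hz D f) = 0"
    using q by (auto simp: polys_mult contract_mult)
  then show "q * p \<in> Ann_hom n f" unfolding Ann_hom_def by blast
qed (auto simp: Ann_hom_def polys_def)

lemma Ann_hom_homog_iff:
  assumes f: "f \<in> polys {1..n}" and p: "p \<in> homog {..n} e"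
  shows "p \<in> Ann_hom n f \<longleftrightarrow> act f p = 0"
proof
  assume "p \<in> Ann_hom n f"
  then obtain N where "\<forall>D\<ge>N. contract p (hz D f) = 0" by (auto simp: Ann_hom_def)
  then have "contract p (hz (N + (tdeg f + e)) f) = 0" by simp
  then show "act f p = 0" using contract_hz_eq_0_iff[OF f p] by simp
next
  assume "act f p = 0"
  then have "\<forall>D\<ge>tdeg f + e. contract p (hz D f) = 0" using contract_hz_eq_0_iff[OF f p] by simp
  then show "p \<in> Ann_hom n f" using p homog_subset_polys unfolding Ann_hom_def by blast
qed

lemma Ann_hom_homog_comp:
  assumes f: "f \<in> polys {1..n}" and p: "p \<in> Ann_hom n f"
  shows "homog_comp e p \<in> Ann_hom n f"
proof -
  obtain N where N: "\<forall>D\<ge>N. contract p (hz D f) = 0" and pp: "p \<in> polys {..n}"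
    using p by (auto simp: Ann_hom_def)
  have hp: "homog_comp e p \<in> homog {..n} e" by (rule homog_comp_in_homog[OF pp])
  have "contract (homog_comp e p) (hz D f) = 0" if D: "D \<ge> max N (tdeg f)" for D
  proof (rule poly_mapping_eqI)
    fix w
    have fD: "tdeg f \<le> D" using D by simp
    show "lookup (contract (homog_comp e p) (hz D f)) w = lookup 0 w"
    proof (cases "mdeg w + e = D")
      \<comment> \<open>The form \<open>hz D f\<close> lives in degree \<open>D\<close>, so at this
        \<open>w\<close> only the terms of \<open>p\<close> of degree \<open>e\<close> can
        contribute.\<close>
      case True
      have "lookup (contract (homog_comp e p) (hz D f)) w
        = (\<Sum>u\<in>keys p. lookup (homog_comp e p) u * lookup (hz D f) (w + u))"
        by (rule lookup_contract_superset) (auto simp: in_keys_iff lookup_homog_comp split: if_splits)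
      also have "\<dots> = (\<Sum>u\<in>keys p. lookup p u * lookup (hz D f) (w + u))"
        using True by (intro sum.cong) (auto simp: lookup_homog_comp lookup_hz[OF f fD])
      also have "\<dots> = 0" using N D by (simp flip: lookup_contract)
      finally show ?thesis by simp
    next
      case False
      then show ?thesis using contract_hz[OF f fD hp] by simp
    qed
  qed
  then show ?thesis using hp homog_subset_polys unfolding Ann_hom_def by blast
qed

lemma homogeneous_Ann_hom: "f \<in> polys {1..n} \<Longrightarrow> homogeneous_ideal {..n} (Ann_hom n f)"
  by (simp add: homogeneous_ideal_def ideal_Ann_hom Ann_hom_homog_comp)

lemma contract_power_hz:
  assumes f: "f \<in> polys {1..n}" "tdeg f \<le> t"
  shows "contract (single (single 0 k) 1) (hz (k + t) f) = hz t f"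
proof (rule poly_mapping_eqI)
  fix w
  have "tdeg f \<le> k + t" using f by simp
  from lookup_hz[OF f(1) this] show
    "lookup (contract (single (single 0 k) 1) (hz (k + t) f)) w
     = lookup (hz t f) w"
    by (simp add: lookup_hz[OF f])
qed

text \<open>Powers of the homogenizing variable carry one homogenization of \<open>f\<close> to a
  lower one, so this variable is not a zero divisor modulo \<open>Ann_hom n f\<close>. This makes
  \<open>Ann(f)^hom\<close> saturated.\<close>

lemma Ann_hom_cancel:
  assumes f: "f \<in> polys {1..n}" and p: "p \<in> polys {..n}"
    and ap: "single (single 0 k) 1 * p \<in> Ann_hom n f"
  shows "p \<in> Ann_hom n f"
proof -
  let ?a = "single (single 0 k) 1"
  obtain N where N: "\<forall>D\<ge>N. contract (?a * p) (hz D f) = 0" using ap by (auto simp: Ann_hom_def)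
  have "contract p (hz D f) = 0" if "D \<ge> max N (tdeg f)" for D
  proof -
    have "contract (p * ?a) (hz (k + D) f) = 0" using N that by (simp add: mult.commute)
    then show ?thesis using contract_power_hz[OF f, of D k] that by (simp add: contract_mult)
  qed
  then show ?thesis using p unfolding Ann_hom_def by blast
qed

lemma ideal_sum: "ideal J (poly_ring X) \<Longrightarrow> (\<And>i. i \<in> A \<Longrightarrow> g i \<in> J) \<Longrightarrow> (\<Sum>i\<in>A. g i) \<in> J"
  by (induction A rule: infinite_finite_induct) (auto intro: ideal_poly_ringD)

lemma single_0_power_in_polys: "single (single 0 k) c \<in> polys {..n::nat}"
  by (auto simp: polys_def)

lemma hom_ideal_Ann:
  assumes f: "f \<in> polys {1..n}"
  shows "hom_ideal n (Ann {1..n} f) = Ann_hom n f"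
proof
  interpret R: cring "poly_ring {..n} :: (nat, 'k::field) mpoly ring" by (rule cring_poly_ring)
  let ?G = "homogenize ` Ann {1..n} f"
  have G: "?G \<subseteq> Ann_hom n f"
  proof
    fix h assume "h \<in> ?G"
    then obtain g where g: "g \<in> polys {1..n}" "contract g f = 0" "h = hz (tdeg g) g"
      by (auto simp: Ann_def homogenize_eq_hz)
    have "h \<in> homog {..n} (tdeg g)" unfolding g(3) by (rule hz_in_homog[OF g(1)]) simp
    then show "h \<in> Ann_hom n f"
      using Ann_hom_homog_iff[OF f] g by (simp add: act_def deh_hz)
  qed
  then show "hom_ideal n (Ann {1..n} f) \<subseteq> Ann_hom n f"
    unfolding hom_ideal_def by (intro R.genideal_minimal ideal_Ann_hom)
  have "?G \<subseteq> carrier (poly_ring {..n})"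
    using G ideal_poly_ringD(1)[OF ideal_Ann_hom] by (auto simp: poly_ring_def)
  then have sub: "?G \<subseteq> hom_ideal n (Ann {1..n} f)"
    and id: "ideal (hom_ideal n (Ann {1..n} f)) (poly_ring {..n})"
    unfolding hom_ideal_def using R.genideal_self R.genideal_ideal by blast+
  show "Ann_hom n f \<subseteq> hom_ideal n (Ann {1..n} f)"
  proof
    fix p assume p: "p \<in> Ann_hom n f"
    have pp: "p \<in> polys {..n}" using p by (simp add: Ann_hom_def)
    have "homog_comp e p \<in> hom_ideal n (Ann {1..n} f)" for e
    proof -
      let ?G = "homog_comp e p" and ?g = "deh (homog_comp e p)"
      have G: "?G \<in> homog {..n} e" by (rule homog_comp_in_homog[OF pp])
      have g: "?g \<in> polys {1..n}" using G homog_subset_polys by (intro deh_in_polys) blast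
      have "?g \<in> Ann {1..n} f"
        using Ann_hom_homog_iff[OF f G] Ann_hom_homog_comp[OF f p] g by (simp add: Ann_def act_def)
      then have "hz (tdeg ?g) ?g \<in> hom_ideal n (Ann {1..n} f)"
        using sub by (auto simp flip: homogenize_eq_hz)
      \<comment> \<open>Dehomogenizing may lower the degree; the lost power of the homogenizing
        variable is restored here.\<close>
      moreover have "?G = single (single 0 (e - tdeg ?g)) 1 * hz (tdeg ?g) ?g"
        using hz_mult[OF g order.refl, of "e - tdeg ?g"] tdeg_deh_le[OF G] hz_deh[OF G] by simp
      ultimately show ?thesis
        using ideal_poly_ringD(4)[OF id single_0_power_in_polys] by metis
    qed
    then have "(\<Sum>e\<in>mdeg ` keys p. homog_comp e p) \<in> hom_ideal n (Ann {1..n} f)"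
      by (intro ideal_sum[OF id])
    then show "p \<in> hom_ideal n (Ann {1..n} f)" by (simp add: sum_homog_comp)
  qed
qed

lemma irrelevant_power_subset:
  "irrelevant_power n N \<subseteq> {q \<in> polys {..n} :: (nat, 'k::comm_ring_1) mpoly set. \<forall>u. lookup q u \<noteq> 0 \<longrightarrow> N \<le> mdeg u}"
    (is "_ \<subseteq> ?B")
proof -
  interpret R: cring "poly_ring {..n} :: (nat, 'k::comm_ring_1) mpoly ring" by (rule cring_poly_ring)
  have "ideal ?B (poly_ring {..n})"
  proof (rule ideal_poly_ringI)
    fix p q :: "(nat, 'k) mpoly" assume pq: "p \<in> ?B" "q \<in> ?B"
    have "p + q \<in> polys {..n}"
      using pq Poly_Mapping.keys_add[of p q] by (fastforce simp: polys_def)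
    moreover have "N \<le> mdeg u" if "lookup (p + q) u \<noteq> 0" for u
      using pq that by (cases "lookup p u = 0") (auto simp: lookup_add)
    ultimately show "p + q \<in> ?B" by blast
  next
    fix p q :: "(nat, 'k) mpoly" assume q: "q \<in> polys {..n}" and p: "p \<in> ?B"
    have "N \<le> mdeg u" if "lookup (q * p) u \<noteq> 0" for u
    proof -
      have "u \<in> keys (q * p)" using that by (simp add: in_keys_iff)
      then obtain a b where "u = a + b" "b \<in> keys p" using Poly_Mapping.keys_mult[of q p] by blast
      then show ?thesis using p by (auto simp: in_keys_iff intro: trans_le_add2)
    qed
    then show "q * p \<in> ?B" using q p by (auto intro: polys_mult)
  qed (auto simp: polys_def)
  then show ?thesis unfolding irrelevant_power_def
    by (rule R.genideal_minimal) (auto simp: polys_def exps_def lookup_single when_def split: if_splits)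
qed

lemma homogeneous_idealD:
  assumes "homogeneous_ideal X J"
  shows "ideal J (poly_ring X)" "p \<in> J \<Longrightarrow> homog_comp e p \<in> J"
  using assms by (auto simp: homogeneous_ideal_def)

text \<open>Saturation sees only high degrees. An element of the saturation is moved into degrees at
  least \<open>m\<close> by a power of the homogenizing variable, which can be cancelled in
  \<open>Ann_hom n f\<close>; conversely the exponent \<open>m\<close> serves as witness for every
  element of \<open>Ann_hom n f\<close>.\<close>

lemma saturation_eq_Ann_hom:
  fixes f :: "(nat, 'k::field) mpoly"
  assumes f: "f \<in> polys {1..n}" and J: "homogeneous_ideal {..n} J"
    and eq: "\<And>e p. e \<ge> m \<Longrightarrow> p \<in> homog {..n} e \<Longrightarrow> p \<in> J \<longleftrightarrow> p \<in> Ann_hom n f"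
  shows "saturation n J = Ann_hom n f"
proof -
  note idJ = homogeneous_idealD(1)[OF J]
  have high: "p \<in> J \<longleftrightarrow> p \<in> Ann_hom n f"
    if p: "p \<in> polys {..n}" "\<And>u. lookup p u \<noteq> 0 \<Longrightarrow> m \<le> mdeg u" for p
  proof -
    have "homog_comp e p \<in> J \<longleftrightarrow> homog_comp e p \<in> Ann_hom n f" if "e \<in> mdeg ` keys p" for e
      using that p(2) eq[OF _ homog_comp_in_homog[OF p(1)], of e] by (auto simp: in_keys_iff)
    moreover have "p \<in> J \<longleftrightarrow> (\<forall>e\<in>mdeg ` keys p. homog_comp e p \<in> J)"
      using homogeneous_idealD(2)[OF J] ideal_sum[OF idJ, of "mdeg ` keys p" "\<lambda>e. homog_comp e p"]
      by (auto simp: sum_homog_comp)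
    moreover have "p \<in> Ann_hom n f \<longleftrightarrow> (\<forall>e\<in>mdeg ` keys p. homog_comp e p \<in> Ann_hom n f)"
      using Ann_hom_homog_comp[OF f]
        ideal_sum[OF ideal_Ann_hom, of "mdeg ` keys p" "\<lambda>e. homog_comp e p" n f]
      by (auto simp: sum_homog_comp)
    ultimately show ?thesis by simp
  qed
  interpret R: cring "poly_ring {..n} :: (nat, 'k::field) mpoly ring" by (rule cring_poly_ring)
  show ?thesis
  proof (intro equalityI subsetI)
    fix p assume "p \<in> saturation n J"
    then obtain N where p: "p \<in> polys {..n}" and N: "\<And>q. q \<in> irrelevant_power n N \<Longrightarrow> q * p \<in> J"
      by (auto simp: saturation_def)
    let ?a = "\<lambda>k. single (single (0::nat) k) (1::'k)"
    have gen: "(\<lambda>u. single u 1) ` exps {..n} N \<subseteq> carrier (poly_ring {..n} :: (nat, 'k) mpoly ring)"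
      by (auto simp: poly_ring_def polys_def exps_def)
    have "?a N \<in> irrelevant_power n N"
      unfolding irrelevant_power_def using R.genideal_self[OF gen] by (auto intro!: single_in_exps)
    then have "?a m * (?a N * p) \<in> J"
      by (rule ideal_poly_ringD(4)[OF idJ single_0_power_in_polys N])
    moreover have "?a m * (?a N * p) = ?a (m + N) * p"
      by (simp add: mult_single single_add flip: mult.assoc)
    ultimately have inJ: "?a (m + N) * p \<in> J" by simp
    have ap: "?a (m + N) * p \<in> polys {..n}" by (intro polys_mult p single_0_power_in_polys)
    have "m \<le> mdeg u" if "lookup (?a (m + N) * p) u \<noteq> 0" for u
    proof -
      have "\<exists>w. u = single 0 (m + N) + w"
        using that lookup_single_mult_0[of u "single 0 (m + N)" 1 p] by blast
      then obtain w where "u = single 0 (m + N) + w" ..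
      then show ?thesis by simp
    qed
    then have "?a (m + N) * p \<in> Ann_hom n f" using high[OF ap] inJ by blast
    then show "p \<in> Ann_hom n f" by (rule Ann_hom_cancel[OF f p])
  next
    fix p assume p: "p \<in> Ann_hom n f"
    have pp: "p \<in> polys {..n}" using p by (simp add: Ann_hom_def)
    have "q * p \<in> J" if "q \<in> irrelevant_power n m" for q
    proof -
      have q: "q \<in> polys {..n}" "\<And>u. lookup q u \<noteq> 0 \<Longrightarrow> m \<le> mdeg u"
        using that irrelevant_power_subset by auto
      have "m \<le> mdeg u" if "lookup (q * p) u \<noteq> 0" for u
      proof -
        have "u \<in> keys (q * p)" using that by (simp add: in_keys_iff)
        then obtain a b where "u = a + b" "a \<in> keys q" using Poly_Mapping.keys_mult[of q p] by blast
        then show ?thesis using q(2)[of a] by (auto simp: in_keys_iff intro: trans_le_add1)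
      qed
      then show ?thesis using high[OF polys_mult[OF q(1) pp]] ideal_poly_ringD(4)[OF ideal_Ann_hom q(1) p] by blast
    qed
    then show "p \<in> saturation n J" using pp by (auto simp: saturation_def)
  qed
qed

subsection \<open>Dimensions of graded pieces\<close>

lemma quot_dim_kernel:
  fixes s1 :: "'k::field \<Rightarrow> 'a::ab_group_add \<Rightarrow> 'a" and s2 :: "'k \<Rightarrow> 'b::ab_group_add \<Rightarrow> 'b"
  assumes lin: "Vector_Spaces.linear s1 s2 \<phi>" and V: "module.subspace s1 V"
    and fd: "vspace.fin_dim s2 (\<phi> ` V)"
  shows "quot_dim s1 V {x \<in> V. \<phi> x = 0} = enat (vector_space.dim s2 (\<phi> ` V))"
proof -
  interpret v1: vspace s1 using lin by (simp add: Vector_Spaces.linear_def vspace_def)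
  interpret v2: vspace s2 using lin by (simp add: Vector_Spaces.linear_def vspace_def)
  interpret l: Vector_Spaces.linear s1 s2 \<phi> by fact
  have "quot_dim s1 V {x \<in> V. \<phi> x = 0} = quot_dim s2 (\<phi> ` V) {0}"
    by (intro antisym quot_dim_le_of_linear[OF lin V] quot_dim_lift[OF lin]) auto
  also have "\<dots> = enat (v2.dim (\<phi> ` V) - v2.dim {0})"
    using fd l.subspace_image[OF V] by (intro v2.quot_dim_dim) (auto simp: v2.subspace_0)
  also have "v2.dim {0} = 0" using v2.dim_le_card[of "{0}" "{}"] by simp
  finally show ?thesis by simp
qed

lemma subspace_act_image: "mp.subspace V \<Longrightarrow> mp.subspace (act f ` V)"
  using module_hom.subspace_image linear_act[of f] by (auto simp: Vector_Spaces.linear_def)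

text \<open>Operators of order above \<open>tdeg f\<close> kill \<open>f\<close>, and those of order
  at most \<open>e\<close> homogenize into degree \<open>e\<close>. Hence \<open>r\<close> is the
  rank of \<open>act f\<close> on forms of every degree from \<open>tdeg f\<close> on.\<close>

lemma contract_image_eq:
  assumes f: "f \<in> polys {1..n}" and e: "tdeg f \<le> e"
  shows "(\<lambda>p. contract p f) ` polys {1..n} = act f ` homog {..n} e"
proof (intro equalityI subsetI)
  fix x assume "x \<in> (\<lambda>p. contract p f) ` polys {1..n}"
  then obtain p where p: "p \<in> polys {1..n}" "x = contract p f" by auto
  have sub: "mp.subspace (act f ` homog {..n} e)" by (rule subspace_act_image[OF subspace_homog])
  have "keys p \<subseteq> {u. keys u \<subseteq> {1..n}}" using p(1) by (auto simp: polys_def)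
  then have "contract p f \<in> act f ` homog {..n} e"
  proof (induction p rule: poly_mapping_single_induct)
    case (single u c)
    have u: "single u c \<in> polys {1..n}" using single by (auto simp: polys_def)
    show ?case
    proof (cases "mdeg u \<le> e")
      case True
      then have "tdeg (single u c) \<le> e" by (auto simp: tdeg_le_iff lookup_single when_def)
      then show ?thesis using hz_in_homog[OF u] deh_hz[OF u] by (intro image_eqI[of _ _ "hz e (single u c)"]) (auto simp: act_def)
    next
      case False
      have "contract (single u c) f = 0"
      proof (rule poly_mapping_eqI)
        fix w have "mdeg (w + u) > tdeg f" using False e by simp
        then show "lookup (contract (single u c) f) w = lookup 0 w"
          using mdeg_le_tdeg[of f "w + u"] by fastforce
      qed
      then show ?thesis using mp.subspace_0[OF sub] by simp
    qed
  next
    case zero show ?case using mp.subspace_0[OF sub] by simp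
  next
    case (add p q) then show ?case using mp.subspace_add[OF sub] by (simp add: contract_add_left)
  qed
  then show "x \<in> act f ` homog {..n} e" by (simp add: p)
next
  fix x assume "x \<in> act f ` homog {..n} e"
  then show "x \<in> (\<lambda>p. contract p f) ` polys {1..n}"
    using deh_in_polys homog_subset_polys by (fastforce simp: act_def)
qed

lemma fin_dim_T: "V \<subseteq> homog {..n::nat} e \<Longrightarrow> mp.fin_dim (V :: (nat, 'k::field) mpoly set)"
  using mp.fin_dim_subset fin_dim_homog finite_atMost by blast

lemma dim_T_mono: "V \<subseteq> W \<Longrightarrow> W \<subseteq> homog {..n::nat} e \<Longrightarrow> mp.dim V \<le> mp.dim (W :: (nat, 'k::field) mpoly set)"
  using mp.dim_mono_fin fin_dim_T by blast

lemma dim_act: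
  assumes "mp.subspace V" "V \<subseteq> homog {..n} e"
  shows "mp.dim V = mp.dim (act f ` V) + mp.dim {x \<in> V. act f x = 0}" "mp.fin_dim (act f ` V)"
  using dim_kernel_image[OF linear_act assms(1) fin_dim_T[OF assms(2)]] by auto

lemma quot_dim_Ann:
  assumes f: "f \<in> polys {1..n}" and e: "tdeg f \<le> e"
  shows "quot_dim pscale (polys {1..n}) (Ann {1..n} f) = enat (mp.dim (act f ` homog {..n} e))"
  using quot_dim_kernel[OF linear_contract[of f] subspace_polys[of "{1..n}"]]
    contract_image_eq[OF f e] dim_act(2)[OF subspace_homog order.refl, of f n e]
  by (simp add: Ann_def)

lemma hilbert_function_eq:
  fixes J :: "(nat, 'k::field) mpoly set"
  assumes "ideal J (poly_ring {..n})"
  shows "hilbert_function n J e = mp.dim (homog {..n} e :: (nat, 'k) mpoly set) - mp.dim (J \<inter> homog {..n} e)"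
  unfolding hilbert_function_def
  by (subst mp.quot_dim_dim)
    (auto intro: subspace_homog fin_dim_T mp.subspace_inter subspace_ideal[OF assms])

subsection \<open>Powers of linear forms\<close>

definition mon :: "('i \<Rightarrow> 'k::comm_semiring_1) \<Rightarrow> ('i \<Rightarrow>\<^sub>0 nat) \<Rightarrow> 'k" where
  "mon a u = (\<Prod>i\<in>keys u. a i ^ lookup u i)"

lemma mon_superset:
  assumes "finite A" "keys u \<subseteq> A"
  shows "mon a u = (\<Prod>i\<in>A. a i ^ lookup u i)"
  unfolding mon_def using assms by (intro prod.mono_neutral_left) (auto simp: in_keys_iff)

lemma mon_add: "mon a (u + v) = mon a u * mon a v"
proof -
  let ?A = "keys u \<union> keys v"
  have "keys (u + v) \<subseteq> ?A" by (rule Poly_Mapping.keys_add)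
  then show ?thesis
    using mon_superset[of ?A "u + v" a] mon_superset[of ?A u a] mon_superset[of ?A v a]
    by (simp add: lookup_add power_add prod.distrib)
qed

lemma mon_0 [simp]: "mon a 0 = 1"
  by (simp add: mon_def)

lemma mon_single [simp]: "mon a (single i k) = a i ^ k"
  by (simp add: mon_def)

lemma mon_scale: "mon (\<lambda>i. c * a i) u = c ^ mdeg u * mon a u"
  by (simp add: mon_def mdeg_def power_mult_distrib prod.distrib power_sum)

lemma mon_cong: "(\<And>i. i \<in> keys u \<Longrightarrow> a i = b i) \<Longrightarrow> mon a u = mon b u"
  by (simp add: mon_def)

lemma lookup_dp_power:
  assumes "finite X"
  shows "lookup (dp_power X L d) u = (if u \<in> exps X d then mon (lin_coord L) u else 0)"
  using assms by (simp add: dp_power_def lookup_sum lookup_single when_def mon_def)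

lemma homog_lookup_0: "p \<in> homog X d \<Longrightarrow> mdeg u \<noteq> d \<Longrightarrow> lookup p u = 0"
  by (auto simp: homog_iff exps_def)

abbreviation var :: "'i \<Rightarrow> ('i, 'k::comm_semiring_1) mpoly" where
  "var i \<equiv> single (single i 1) 1"

lemma linear_functional_separating:
  fixes p :: "('i, 'k::field) mpoly"
  assumes "p \<notin> mp.span W"
  obtains g where "Vector_Spaces.linear pscale (*) g" "\<And>x. x \<in> mp.span W \<Longrightarrow> g x = 0" "g p = (1::'k)"
proof -
  obtain B where B: "B \<subseteq> W" "mp.independent B" "W \<subseteq> mp.span B"
    using mp.maximal_independent_subset by blast
  have pB: "p \<notin> mp.span B" using assms mp.span_mono[OF B(1)] by blast
  then have ind: "mp.independent (insert p B)" by (rule mp.independent_insertI) (rule B(2))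
  obtain g where g: "Vector_Spaces.linear pscale (*) g" "\<forall>x\<in>insert p B. g x = (if x = p then 1 else 0)"
    using mpk.linear_independent_extend[OF ind, of "\<lambda>x. if x = p then 1 else 0"] by blast
  interpret g: Vector_Spaces.linear pscale "(*)" g by (rule g(1))
  have "mp.subspace {x. g x = 0}" by (auto simp: mp.subspace_def g.add g.scale)
  moreover have "B \<subseteq> {x. g x = 0}" using g(2) pB mp.span_superset[of B] by auto
  ultimately have "mp.span B \<subseteq> {x. g x = 0}" by (intro mp.span_minimal)
  moreover have "mp.span W \<subseteq> mp.span B" using B(3) by (intro mp.span_minimal) auto
  ultimately show thesis using that[OF g(1)] g(2) by auto
qed

text \<open>If the variables times the forms apolar to \<open>G\<close> do not fill the next degree, a functional
  vanishing on them shows that all first partial derivatives of some form of degree \<open>d + 1\<close> are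
  multiples of \<open>G\<close>, and \<open>G\<close> is a power of a linear form.\<close>
lemma apolar_generate_next_degree:
  fixes G :: "('i, 'k::alg_closed_field) mpoly"
  assumes X: "finite X" and G: "G \<in> homog X d" "G \<noteq> 0" and d: "d \<ge> 1"
    and np: "\<not> (\<exists>L\<in>homog X 1. G = dp_power X L d)"
  shows "homog X (Suc d) \<subseteq> mp.span {var i * x | i x. i \<in> X \<and> x \<in> homog X d \<and> contract x G = 0}"
    (is "_ \<subseteq> mp.span ?W")
proof (rule subsetI, rule ccontr)
  fix p assume p: "p \<in> homog X (Suc d)" and pW: "p \<notin> mp.span ?W"
  obtain g where lin: "Vector_Spaces.linear pscale (*) g" and gW: "\<And>x. x \<in> mp.span ?W \<Longrightarrow> g x = 0"
    and gp: "g p = 1" using linear_functional_separating[OF pW] by blast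
  interpret g: Vector_Spaces.linear pscale "(*)" g by (rule lin)
  let ?G = "lookup G"
  define \<gamma> where "\<gamma> = (\<lambda>w. g (single w 1))"
  have gs: "g (single w c) = c * \<gamma> w" for w c
    using g.scale[of c "single w 1"] by (simp add: \<gamma>_def)
  let ?e = "\<lambda>i. single i (1::nat)"
  have rel: "?G v * \<gamma> (?e i + u) = ?G u * \<gamma> (?e i + v)"
    if i: "i \<in> X" and u: "u \<in> exps X d" and v: "v \<in> exps X d" for i u v
  proof -
    \<comment> \<open>Contracting \<open>G\<close> with a form of its own degree gives a single
      number, and for this binomial the number cancels.\<close>
    let ?x = "single u (?G v) + single v (- ?G u)"
    have "contract ?x G = 0"
    proof (rule poly_mapping_eqI)
      fix w
      have "?G v * ?G (w + u) = ?G u * ?G (w + v)"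
      proof (cases "w = 0")
        case False
        then have "mdeg w \<noteq> 0" by simp
        then have "mdeg (w + u) \<noteq> d" "mdeg (w + v) \<noteq> d" using u v by (auto simp: exps_def)
        then have "?G (w + u) = 0" "?G (w + v) = 0" by (auto intro: homog_lookup_0[OF G(1)])
        then show ?thesis by simp
      qed (simp add: mult.commute)
      then show "lookup (contract ?x G) w = lookup 0 w"
        by (simp add: contract_add_left lookup_add)
    qed
    moreover have "?x \<in> homog X d"
      using subspace_homog[of X d] u v by (intro mp.subspace_add) (auto intro: single_in_homog)
    ultimately have "g (var i * ?x) = 0" using i by (intro gW mp.span_base) blast
    then show ?thesis by (simp add: distrib_left mult_single g.add gs)
  qed
  obtain v where "?G v \<noteq> 0" using tdeg_attained[OF G(2)] by metis
  then have v: "?G v \<noteq> 0" "v \<in> exps X d" using homogD[OF G(1)] by auto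
  \<comment> \<open>By \<open>rel\<close> this ratio is the same for all \<open>v\<close> with
    nonzero coefficient. It is the factor by which the derivative of \<open>\<gamma>\<close> with
    respect to the variable \<open>i\<close> is a multiple of \<open>G\<close>.\<close>
  define c where "c = (\<lambda>i. \<gamma> (?e i + v) / ?G v)"
  have \<gamma>: "\<gamma> (?e i + u) = c i * ?G u" if "i \<in> X" "u \<in> exps X d" for i u
    using rel[OF that v(2)] v(1) by (simp add: c_def field_simps)
  have "p = (\<Sum>u\<in>keys p. single u (lookup p u))"
    by (simp add: poly_mapping_sum_single)
  then have "(\<Sum>u\<in>keys p. lookup p u * \<gamma> u) = 1"
    using gp by (metis (no_types, lifting) g.sum gs sum.cong)
  then have "(\<Sum>u\<in>keys p. lookup p u * \<gamma> u) \<noteq> 0" by simp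
  then obtain w where "w \<in> keys p" "lookup p w * \<gamma> w \<noteq> 0"
    by (meson sum.not_neutral_contains_not_neutral)
  then have w: "w \<in> exps X (Suc d)" "\<gamma> w \<noteq> 0" using p by (auto simp: homog_def)
  obtain i where i: "i \<in> X" "c i \<noteq> 0"
    using exps_Suc_cases[OF w(1)] w(2) \<gamma> by (metis mult_zero_left)
  \<comment> \<open>Mixed second derivatives of \<open>\<gamma>\<close> agree.\<close>
  have sym: "c i * ?G (?e j + t) = c j * ?G (?e i + t)" if "j \<in> X" "t \<in> exps X e" "Suc e = d" for j t e
  proof -
    have "?e j + t \<in> exps X d" "?e i + t \<in> exps X d"
      using exps_add[OF single_in_exps[of _ X 1] that(2)] that i(1) by auto
    then show ?thesis using \<gamma>[OF i(1), of "?e j + t"] \<gamma>[OF that(1), of "?e i + t"]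
      by (metis add.left_commute)
  qed
  \<comment> \<open>By \<open>sym\<close>, moving one unit of the exponent from \<open>i\<close> to
    \<open>j\<close> multiplies the coefficient of \<open>G\<close> by \<open>\<rho> j\<close>. So
    all coefficients follow from the one at the pure power of the variable \<open>i\<close>.\<close>
  define \<rho> where "\<rho> = (\<lambda>j. c j / c i)"
  define \<kappa> where "\<kappa> = ?G (single i d)"
  have mono: "?G (t + single i (d - e)) = mon \<rho> t * \<kappa>" if "t \<in> exps X e" "e \<le> d" for t e
    using that
  proof (induction e arbitrary: t)
    case 0
    then have "t = 0" by (simp add: exps_def)
    then show ?case by (simp add: \<kappa>_def)
  next
    case (Suc e)
    obtain j t' where jt: "j \<in> X" "t' \<in> exps X e" "t = ?e j + t'" using exps_Suc_cases[OF Suc.prems(1)] .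
    let ?s = "t' + single i (d - Suc e)"
    have s: "?s \<in> exps X (e + (d - Suc e))" using jt(2) i(1) by (intro exps_add single_in_exps)
    have "Suc (e + (d - Suc e)) = d" using Suc.prems(2) by simp
    from sym[OF jt(1) s this] have "?G (?e j + ?s) = \<rho> j * ?G (?e i + ?s)"
      using i(2) by (simp add: \<rho>_def field_simps)
    also have "?e i + ?s = t' + single i (d - e)"
      using Suc.prems(2) by (intro poly_mapping_eqI) (auto simp: lookup_add lookup_single when_def)
    also have "?G \<dots> = mon \<rho> t' * \<kappa>" using Suc by (intro Suc.IH jt(2)) simp
    finally show ?case by (simp add: jt(3) mon_add add.assoc)
  qed
  \<comment> \<open>The root absorbs the scalar \<open>\<kappa>\<close> into the linear form; it
    exists because the field is algebraically closed.\<close>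
  obtain \<mu> where \<mu>: "\<mu> ^ d = \<kappa>" using nth_root_exists[of d \<kappa>] d by auto
  define L where "L = (\<Sum>j\<in>X. single (?e j) (\<mu> * \<rho> j))"
  have inj: "single j (Suc 0) = single k (Suc 0) \<longleftrightarrow> j = k" for j k :: 'i
    by (metis lookup_single_eq lookup_single_not_eq nat.distinct(1))
  have coord: "lin_coord L j = \<mu> * \<rho> j" if "j \<in> X" for j
    using that X by (simp add: lin_coord_def L_def lookup_sum lookup_single when_def inj)
  have "L \<in> homog X 1" unfolding L_def
    by (intro mp.subspace_sum subspace_homog single_in_homog single_in_exps)
  moreover have "G = dp_power X L d"
  proof (rule poly_mapping_eqI)
    fix u
    show "?G u = lookup (dp_power X L d) u"
    proof (cases "u \<in> exps X d")
      case True
      have "mon (lin_coord L) u = mon (\<lambda>j. \<mu> * \<rho> j) u"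
        using True coord by (intro mon_cong) (auto simp: exps_def)
      also have "\<dots> = \<kappa> * mon \<rho> u" using True \<mu> by (simp add: mon_scale exps_def)
      also have "\<dots> = ?G u" using mono[OF True] by simp
      finally show ?thesis using True X by (simp add: lookup_dp_power)
    next
      case False
      then show ?thesis using homogD[OF G(1), of u] X by (auto simp: lookup_dp_power)
    qed
  qed
  ultimately show False using np by blast
qed

subsection \<open>Graded pieces of the annihilators\<close>

lemma lookup_contract_top:
  assumes "\<And>u. u \<noteq> 0 \<Longrightarrow> lookup F (w + u) = 0"
  shows "lookup (contract p F) w = lookup p 0 * lookup F w"
proof -
  have "lookup (contract p F) w
      = (\<Sum>u\<in>insert 0 (keys p). lookup p u * lookup F (w + u))"
    by (rule lookup_contract_superset) auto
  also have "\<dots> = (\<Sum>u\<in>{0}. lookup p u * lookup F (w + u))"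
    using assms by (intro sum.mono_neutral_right) auto
  finally show ?thesis by simp
qed

lemma lookup_deh_0:
  assumes "p \<in> homog X e"
  shows "lookup (deh p) 0 = lookup p (single 0 e)"
proof -
  have "keys p \<subseteq> exps X e" using assms by (simp add: homog_def)
  then show ?thesis
  proof (induction p rule: poly_mapping_single_induct)
    case (single u c)
    have "del u = 0 \<longleftrightarrow> u = single 0 e"
    proof
      assume "del u = 0"
      then show "u = single 0 e"
        using single del_split[of u] mdeg_split[of u] by (simp add: exps_def)
    qed simp
    then show ?case by (auto simp: lookup_single when_def)
  qed (simp_all add: deh_add lookup_add)
qed

text \<open>For a space \<open>V\<close> of forms of degree \<open>e\<close> this is
  \<open>T*_1 V\<close>, the part of degree \<open>e + 1\<close> of the ideal generated by
  \<open>V\<close>.\<close>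

definition up :: "nat \<Rightarrow> (nat, 'k::field) mpoly set \<Rightarrow> (nat, 'k) mpoly set" where
  "up n V = mp.span {var i * x | i x. i \<le> n \<and> x \<in> V}"

lemma up_mono: "V \<subseteq> W \<Longrightarrow> up n V \<subseteq> up n W"
  unfolding up_def by (rule mp.span_mono) blast

lemma up_I: "i \<le> n \<Longrightarrow> x \<in> V \<Longrightarrow> var i * x \<in> up n V"
  unfolding up_def by (rule mp.span_base) blast

lemma var_in_homog: "i \<in> X \<Longrightarrow> var i \<in> homog X 1"
  by (intro single_in_homog single_in_exps)

lemma var_mult_in_homog: "i \<in> X \<Longrightarrow> x \<in> homog X e \<Longrightarrow> var i * x \<in> homog X (Suc e)"
  using homog_mult[OF var_in_homog, of i X x e] by simp

lemma up_subset_homog: "V \<subseteq> homog {..n} e \<Longrightarrow> up n V \<subseteq> homog {..n} (Suc e)"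
  unfolding up_def
  by (rule mp.span_minimal[OF _ subspace_homog], clarify, rule var_mult_in_homog) auto

lemma up_minimal:
  assumes "mp.subspace W" "\<And>i x. i \<le> n \<Longrightarrow> x \<in> V \<Longrightarrow> var i * x \<in> W"
  shows "up n V \<subseteq> W"
  unfolding up_def by (rule mp.span_minimal[OF _ assms(1)]) (use assms(2) in auto)

locale hom_ann =
  fixes n d1 d2 r :: nat and f :: "(nat, 'k::alg_closed_field) mpoly"
  assumes f: "f \<in> polys {1..n}" and deg_f: "tdeg f = d1" and d1: "d1 \<ge> 1"
    and r: "enat r = quot_dim pscale (polys {1..n}) (Ann {1..n} f)"
begin

abbreviation "T \<equiv> homog {..n} :: nat \<Rightarrow> (nat, 'k) mpoly set"
abbreviation "S \<equiv> homog {1..n} :: nat \<Rightarrow> (nat, 'k) mpoly set"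

definition "F = hz (d1 + d2) f"
text \<open>The degree \<open>e\<close> part of \<open>Ann(f)^hom\<close>, by
  \<open>Ann_hom_homog_iff\<close>; \<open>A e\<close> below is the degree \<open>e\<close> part of
  the annihilator of the homogenized form.\<close>

definition "I e = {p \<in> T e. act f p = 0}"
definition "A e = {p \<in> T e. contract p F = 0}"
definition "ftop = homog_comp d1 f"

lemma f_nz: "f \<noteq> 0"
  using deg_f d1 by (auto simp: tdeg_def)

lemma ftop_nz: "ftop \<noteq> 0"
proof -
  obtain u where "lookup f u \<noteq> 0" "mdeg u = d1" using tdeg_attained[OF f_nz] deg_f by metis
  then have "lookup ftop u \<noteq> 0" by (simp add: ftop_def lookup_homog_comp)
  then show ?thesis by auto
qed

lemma ftop_S: "ftop \<in> S d1"
  unfolding ftop_def by (rule homog_comp_in_homog[OF f])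

lemma subspace_I: "mp.subspace (I e)"
  using mp.subspace_0[OF subspace_homog] mp.subspace_add[OF subspace_homog] mp.subspace_scale[OF subspace_homog]
  by (auto simp: mp.subspace_def I_def act_add act_pscale act_def[of f 0])

lemma subspace_A: "mp.subspace (A e)"
  using mp.subspace_0[OF subspace_homog] mp.subspace_add[OF subspace_homog] mp.subspace_scale[OF subspace_homog]
  by (auto simp: mp.subspace_def A_def contract_add_left contract_pscale_left)

lemma I_sub: "I e \<subseteq> T e" and A_sub: "A e \<subseteq> T e"
  by (auto simp: I_def A_def)

lemma dim_I: "d1 \<le> e \<Longrightarrow> mp.dim (T e) = r + mp.dim (I e)"
  using quot_dim_Ann[OF f, of e] deg_f r dim_act(1)[OF subspace_homog order.refl, of n e f]
  by (simp add: I_def flip: r)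

lemma deg_f_le: "tdeg f \<le> d1 + d2"
  by (simp add: deg_f)

lemmas contract_F = contract_hz[OF f deg_f_le, folded F_def]

lemma I_sub_A: "I e \<subseteq> A e"
  by (auto simp: I_def A_def intro!: poly_mapping_eqI simp: contract_F)

lemma A_eq_I: "e \<le> d2 \<Longrightarrow> A e = I e"
  using contract_hz_eq_0_iff[OF f, of _ "{..n}" e "d1 + d2"] deg_f by (auto simp: I_def A_def F_def)

lemma act_no_0: "lookup (act f p) w \<noteq> 0 \<Longrightarrow> lookup w 0 = 0"
  by (rule no_0_in_S[OF act_in_polys[OF f]])

lemma act_deg: "lookup (act f p) w \<noteq> 0 \<Longrightarrow> mdeg w \<le> d1"
  using mdeg_le_tdeg[of "act f p" w] tdeg_contract_le[of "deh p" f] deg_f by (simp add: act_def)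

lemma lookup_f_0: "mdeg w > d1 \<Longrightarrow> lookup f w = 0"
  using mdeg_le_tdeg[of f w] deg_f by fastforce

text \<open>In degree \<open>d1\<close> the truncation removes only terms of degree above
  \<open>d2\<close>, so \<open>act f p\<close> has no term of degree below \<open>d1\<close>. In
  degree \<open>d1\<close> itself only the constant term of \<open>deh p\<close> contributes, and
  that is the coefficient of \<open>p\<close> at the power of the homogenizing variable.\<close>

lemma act_A_top:
  assumes p: "p \<in> A d1" and d2: "d2 \<ge> d1 - 1"
  shows "act f p = pscale (lookup p (single 0 d1)) ftop"
proof (rule poly_mapping_eqI)
  fix w
  have pT: "p \<in> T d1" and 0: "contract p F = 0" using p by (auto simp: A_def)
  show "lookup (act f p) w
      = lookup (pscale (lookup p (single 0 d1)) ftop) w"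
  proof (cases "mdeg w = d1")
    case True
    have "lookup f (w + u) = 0" if "u \<noteq> 0" for u
    proof -
      have "mdeg u \<noteq> 0" using that by simp
      then show ?thesis using True by (intro lookup_f_0) (simp del: mdeg_eq_0_iff)
    qed
    from lookup_contract_top[of f w, OF this] show ?thesis
      using True lookup_deh_0[OF pT] by (simp add: act_def ftop_def lookup_homog_comp)
  next
    case False
    have "lookup (act f p) w = 0"
    proof (rule ccontr)
      assume nz: "lookup (act f p) w \<noteq> 0"
      have "mdeg w < d1" using act_deg[OF nz] False by simp
      then have "mdeg (w + single 0 (d2 - mdeg w)) + d1 = d1 + d2" using d2 by simp
      then have "lookup (contract p F) (w + single 0 (d2 - mdeg w))
          = lookup (act f p) w"
        using act_no_0[OF nz] by (simp add: contract_F[OF pT])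
      then show False using nz 0 by simp
    qed
    then show ?thesis using False by (simp add: ftop_def lookup_homog_comp)
  qed
qed

lemma contract_one: "contract p 1 = pscale (lookup p 0) (1 :: ('i, 'k) mpoly)"
proof (rule poly_mapping_eqI)
  fix w :: "'i \<Rightarrow>\<^sub>0 nat"
  have "lookup (contract p 1) w = lookup p 0 * lookup 1 w"
  proof (rule lookup_contract_top)
    fix u :: "'i \<Rightarrow>\<^sub>0 nat" assume "u \<noteq> 0"
    then have "w + u \<noteq> 0" by (metis add_is_0 mdeg_add mdeg_eq_0_iff)
    then show "lookup 1 (w + u) = (0::'k)" by (simp add: lookup_one when_def)
  qed
  then show "lookup (contract p 1) w = lookup (pscale (lookup p 0) 1) w"
    by simp
qed

text \<open>The product \<open>\<phi> * p\<close> is evaluated in two ways. It kills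
  \<open>F\<close>, and its degree \<open>2 d1 - 1\<close> is at most \<open>d1 + d2\<close>, so the
  constant coefficient of its action on \<open>f\<close> is not truncated and must vanish. In the
  other order it is \<open>deh p\<close> applied to 1, which gives the scalar of
  \<open>act_A_top\<close>.\<close>

lemma A_eq_I_of_one:
  assumes d2: "d2 \<ge> d1 - 1" and \<phi>: "\<phi> \<in> T (d1 - 1)" "act f \<phi> = 1" and p: "p \<in> A d1"
  shows "act f p = 0"
proof -
  have pT: "p \<in> T d1" and 0: "contract p F = 0" using p by (auto simp: A_def)
  have "\<phi> * p \<in> T ((d1 - 1) + d1)" by (rule homog_mult[OF \<phi>(1) pT])
  from contract_F[OF this, of "single 0 (d2 - (d1 - 1))"]
  have "lookup (act f (\<phi> * p)) 0 = 0"
    using d1 d2 0 by (simp add: contract_mult)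
  moreover have "act f (\<phi> * p) = contract (deh p) 1"
    using act_mult[of f p \<phi>] \<phi>(2) by (simp add: mult.commute)
  ultimately have "lookup p (single 0 d1) = 0"
    by (simp add: contract_one lookup_deh_0[OF pT])
  then show ?thesis using act_A_top[OF p d2] by simp
qed

lemma var0_decomp:
  assumes p: "p \<in> T (Suc e)"
  obtains p' p'' where "p' \<in> T e" "p'' \<in> S (Suc e)" "p = var 0 * p' + p''"
proof -
  have "keys p \<subseteq> exps {..n} (Suc e)" using p by (simp add: homog_def)
  then have "\<exists>p' p''. p' \<in> T e \<and> p'' \<in> S (Suc e) \<and> p = var 0 * p' + p''"
  proof (induction p rule: poly_mapping_single_induct)
    case zero
    show ?case by (intro exI[of _ 0]) (auto simp: mp.subspace_0[OF subspace_homog])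
  next
    case (single u c)
    show ?case
    proof (cases "lookup u 0 = 0")
      case True
      then have "u \<in> exps {1..n} (Suc e)" using single
        by (auto simp: exps_def in_keys_iff subset_iff) (metis One_nat_def Suc_leI neq0_conv)
      then show ?thesis
        by (intro exI[of _ 0] exI[of _ "single u c"])
          (auto simp: mp.subspace_0[OF subspace_homog] intro: single_in_homog)
    next
      case False
      define v where "v = u - single 0 1"
      have u: "u = single 0 1 + v"
        using False by (intro poly_mapping_eqI) (auto simp: v_def lookup_add lookup_minus lookup_single when_def)
      have "v \<in> exps {..n} e" using single unfolding u by (auto simp: exps_def keys_add_nat)
      then have "single v c \<in> T e" by (rule single_in_homog)
      moreover have "single u c = var 0 * single v c" by (simp add: u mult_single)
      ultimately show ?thesis
        by (intro exI[of _ "single v c"] exI[of _ 0])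
          (auto simp: mp.subspace_0[OF subspace_homog])
    qed
  next
    case (add p q)
    then obtain p' p'' q' q'' where "p' \<in> T e" "p'' \<in> S (Suc e)" "p = var 0 * p' + p''"
      "q' \<in> T e" "q'' \<in> S (Suc e)" "q = var 0 * q' + q''" by blast
    then show ?case
      by (intro exI[of _ "p' + q'"] exI[of _ "p'' + q''"])
        (auto simp: distrib_left add_ac intro: mp.subspace_add[OF subspace_homog])
  qed
  then show thesis using that by blast
qed

lemma act_S: "p \<in> S e \<Longrightarrow> act f p = contract p f"
  using deh_id[of p n] homog_subset_polys[of "{1..n}" e] by (auto simp: act_def)

lemma act_S_high:
  assumes "p \<in> S e" "e > d1"
  shows "act f p = 0"
proof (rule poly_mapping_eqI, rule ccontr)
  fix w assume "lookup (act f p) w \<noteq> lookup 0 w"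
  then obtain u where "u \<in> exps {1..n} e" "lookup f (w + u) \<noteq> 0"
    using act_S[OF assms(1)] contract_degree[OF assms(1), of f w] by auto
  then show False using lookup_f_0[of "w + u"] assms(2) by (auto simp: exps_def)
qed

lemma act_var0: "act f (var 0 * p) = act f p"
  by (simp add: act_mult)

text \<open>An operator from \<open>S d1\<close> takes \<open>f\<close> to a constant, which only
  the leading form can produce.\<close>

lemma act_S_d1_top: "p \<in> S d1 \<Longrightarrow> contract p ftop = 0 \<Longrightarrow> act f p = 0"
proof (rule poly_mapping_eqI, rule ccontr)
  fix w assume p: "p \<in> S d1" "contract p ftop = 0" and "lookup (act f p) w \<noteq> lookup 0 w"
  then have nz: "lookup (contract p f) w \<noteq> 0" using act_S[OF p(1)] by simp
  have "lookup (contract p f) w = lookup (contract p ftop) w"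
    unfolding lookup_contract
  proof (intro sum.cong refl)
    fix u assume "u \<in> keys p"
    then have "mdeg u = d1" using p(1) by (auto simp: homog_def exps_def)
    moreover obtain u' where "u' \<in> exps {1..n} d1" "lookup f (w + u') \<noteq> 0"
      using contract_degree[OF p(1) nz] by metis
    then have "mdeg w = 0" using lookup_f_0[of "w + u'"] by (force simp: exps_def simp del: mdeg_eq_0_iff)
    ultimately show "lookup p u * lookup f (w + u)
        = lookup p u * lookup ftop (w + u)"
      by (simp add: ftop_def lookup_homog_comp del: mdeg_eq_0_iff)
  qed
  then show False using nz p(2) by simp
qed

text \<open>Split off the homogenizing variable, which acts as the identity. The remaining part lies
  in \<open>S (Suc e)\<close> and kills \<open>f\<close> for degree reasons, so the cofactor lies in
  \<open>I e\<close>. That all of \<open>S (Suc e)\<close> is generated by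
  \<open>S e \<inter> I e\<close> is trivial for \<open>e > d1\<close>, where \<open>S e\<close>
  kills \<open>f\<close>; for \<open>e = d1\<close> it is the apolarity lemma for the leading
  form.\<close>

lemma I_Suc_subset_up:
  assumes np: "\<not> (\<exists>L\<in>homog {1..n} 1. homog_comp d1 f = dp_power {1..n} L d1)" and e: "d1 \<le> e"
  shows "I (Suc e) \<subseteq> up n (I e)"
proof
  fix p assume p: "p \<in> I (Suc e)"
  then obtain p' p'' where pp: "p' \<in> T e" "p'' \<in> S (Suc e)" "p = var 0 * p' + p''"
    using var0_decomp[of p e] by (auto simp: I_def)
  have "act f p'' = 0" using e by (intro act_S_high[OF pp(2)]) simp
  then have "act f p' = 0" using p pp(3) act_var0[of p'] by (simp add: I_def act_add)
  then have "var 0 * p' \<in> up n (I e)" using pp(1) by (intro up_I) (auto simp: I_def)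
  moreover have "p'' \<in> up n (I e)"
  proof (cases "e = d1")
    case True
    have "S (Suc d1) \<subseteq> mp.span {var i * x | i x. i \<in> {1..n} \<and> x \<in> S d1 \<and> contract x ftop = 0}"
      using np by (intro apolar_generate_next_degree ftop_S ftop_nz d1) (auto simp: ftop_def)
    also have "\<dots> \<subseteq> up n (I d1)"
      unfolding up_def using act_S_d1_top S_subset_T[of n d1] by (intro mp.span_mono) (fastforce simp: I_def)
    finally show ?thesis using pp(2) True by blast
  next
    case False
    have "S (Suc e) \<subseteq> up n (I e)"
      unfolding homog_eq_span[OF finite_atLeastAtMost]
    proof (intro mp.span_minimal)
      show "(\<lambda>u. single u 1) ` exps {1..n} (Suc e) \<subseteq> up n (I e)"
      proof
        fix x :: "(nat, 'k) mpoly" assume "x \<in> (\<lambda>u. single u 1) ` exps {1..n} (Suc e)"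
        then obtain u where u: "u \<in> exps {1..n} (Suc e)" "x = single u 1" by auto
        obtain i v where v: "i \<in> {1..n}" "v \<in> exps {1..n} e" "u = single i 1 + v"
          using exps_Suc_cases[OF u(1)] .
        have vS: "single v 1 \<in> S e" using v(2) by (rule single_in_homog)
        then have "single v 1 \<in> I e"
          using act_S_high[OF vS] S_subset_T[of n e] e False by (auto simp: I_def)
        then have "var i * single v 1 \<in> up n (I e)" using v(1) by (intro up_I) auto
        then show "x \<in> up n (I e)" by (simp add: u(2) v(3) mult_single)
      qed
    qed (simp add: up_def)
    then show ?thesis using pp(2) by blast
  qed
  ultimately show "p \<in> up n (I e)" using mp.subspace_add[of "up n (I e)"] by (simp add: pp(3) up_def)
qed

end

subsection \<open>Growth of codimension two subspaces\<close>

text \<open>Macaulay's growth bound for the Hilbert function value 2, for monomial ideals.\<close>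
lemma card_exps_closed_le_2:
  fixes C C' :: "('i \<Rightarrow>\<^sub>0 nat) set"
  assumes C: "finite C" "card C \<le> 2" and m: "m \<ge> 2"
    and C': "\<And>u. u \<in> C' \<Longrightarrow> mdeg u = Suc m"
    and step: "\<And>u i. u \<in> C' \<Longrightarrow> i \<in> keys u \<Longrightarrow> u - single i 1 \<in> C"
  shows "card C' \<le> 2"
proof -
  let ?e = "\<lambda>i. single i (1::nat)"
  \<comment> \<open>A squarefree \<open>u\<close> of degree at least 3 would have three distinct
    divisors \<open>u - single i 1\<close>, too many for \<open>C\<close>.\<close>
  have "\<exists>i. lookup u i \<ge> 2" if u: "u \<in> C'" for u
  proof (rule ccontr)
    assume "\<nexists>i. lookup u i \<ge> 2"
    then have le: "lookup u i \<le> 1" for i by (metis not_less_eq_eq numeral_2_eq_2 One_nat_def)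
    have "mdeg u \<le> card (keys u)"
      unfolding mdeg_def using sum_bounded_above[of "keys u" "lookup u" 1] le by simp
    then have 3: "3 \<le> card (keys u)" using C'[OF u] m by simp
    have "inj_on (\<lambda>i. u - ?e i) (keys u)"
    proof (rule inj_onI)
      fix i j assume i: "i \<in> keys u" "u - ?e i = u - ?e j"
      then have "lookup (u - ?e i) i = lookup (u - ?e j) i" by simp
      then show "i = j" using i(1) by (auto simp: lookup_minus lookup_single when_def in_keys_iff split: if_splits)
    qed
    then have "card (keys u) \<le> card C"
      using step[OF u] C(1) by (intro card_inj_on_le[of "\<lambda>i. u - ?e i"]) auto
    then show False using 3 C(2) by simp
  qed
  then have "\<forall>u\<in>C'. \<exists>i. lookup u i \<ge> 2" by blast
  then obtain ix where ix: "\<And>u. u \<in> C' \<Longrightarrow> lookup u (ix u) \<ge> 2" by (metis bchoice)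
  \<comment> \<open>In a collision \<open>w = u - ?e i = v - ?e j\<close> the exponents of
    \<open>i\<close> and \<open>j\<close> in \<open>w\<close> are still positive, as both were at
    least 2 before. So \<open>u - ?e j\<close> and \<open>v - ?e i\<close> lie in \<open>C\<close>
    too, and the exponent of \<open>i\<close> tells these three elements apart.\<close>
  have "inj_on (\<lambda>u. u - ?e (ix u)) C'"
  proof (rule inj_onI, rule ccontr)
    fix u v assume uv: "u \<in> C'" "v \<in> C'" "u - ?e (ix u) = v - ?e (ix v)" "u \<noteq> v"
    define i j w where "i = ix u" and "j = ix v" and "w = u - ?e i"
    have iu: "lookup u i \<ge> 2" and jv: "lookup v j \<ge> 2"
      using ix uv by (auto simp: i_def j_def)
    have u: "u = w + ?e i"
      using iu by (intro poly_mapping_eqI) (auto simp: w_def lookup_add lookup_minus lookup_single when_def)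
    have w: "w = v - ?e j" using uv(3) by (simp add: w_def i_def j_def)
    have v: "v = w + ?e j"
      using jv by (intro poly_mapping_eqI) (auto simp: w lookup_add lookup_minus lookup_single when_def)
    have ij: "i \<noteq> j" using u v uv(4) by auto
    have wi: "lookup w i \<ge> 1" and wj: "lookup w j \<ge> 1"
      using iu jv u v by (auto simp: lookup_add)
    have "w \<in> C" unfolding w_def using step[OF uv(1), of i] iu by (auto simp: in_keys_iff)
    moreover have "u - ?e j \<in> C" using step[OF uv(1), of j] u wj by (auto simp: in_keys_iff lookup_add)
    moreover have "v - ?e i \<in> C" using step[OF uv(2), of i] v wi by (auto simp: in_keys_iff lookup_add)
    moreover have "lookup (u - ?e j) i = Suc (lookup w i)"
      "lookup (v - ?e i) i = lookup w i - 1"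
      using ij by (auto simp: u v lookup_add lookup_minus lookup_single)
    then have "card {w, u - ?e j, v - ?e i} = 3" using wi by (auto simp: card_insert_if)
    ultimately show False using C card_mono[of C "{w, u - ?e j, v - ?e i}"] by simp
  qed
  moreover have "(\<lambda>u. u - ?e (ix u)) ` C' \<subseteq> C"
  proof
    fix w assume "w \<in> (\<lambda>u. u - ?e (ix u)) ` C'"
    then obtain u where u: "u \<in> C'" "w = u - ?e (ix u)" by blast
    have "ix u \<in> keys u" using ix[OF u(1)] by (simp add: in_keys_iff)
    then show "w \<in> C" unfolding u(2) by (rule step[OF u(1)])
  qed
  ultimately have "card C' \<le> card C" using C(1) by (rule card_inj_on_le)
  then show ?thesis using C(2) by simp
qed

section \<open>Leading exponents and dimensions of spaces of forms\<close>

definition lmon :: "(nat, 'k::zero) mpoly \<Rightarrow> (nat \<Rightarrow>\<^sub>0 nat)" where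
  "lmon p = Max (keys p)"

lemma lookup_lmon: "p \<noteq> 0 \<Longrightarrow> lookup p (lmon p) \<noteq> 0"
  unfolding lmon_def using Max_in[of "keys p"] by (simp add: in_keys_iff)

lemma le_lmon: "lookup p u \<noteq> 0 \<Longrightarrow> u \<le> lmon p"
  unfolding lmon_def by (rule Max_ge) (auto simp: in_keys_iff)

lemma lmon_var_mult:
  fixes p :: "(nat, 'k::field) mpoly"
  assumes "p \<noteq> 0"
  shows "lmon (var i * p) = single i 1 + lmon p"
  unfolding lmon_def[of "var i * p"]
proof (rule Max_eqI)
  show "single i 1 + lmon p \<in> keys (var i * p)"
    using lookup_lmon[OF assms] by (simp add: in_keys_iff lookup_single_mult_add)
  fix v assume "v \<in> keys (var i * p)"
  then obtain w where "v = single i 1 + w" "w \<in> keys p"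
    using Poly_Mapping.keys_mult[of "var i" p] by auto
  then show "v \<le> single i 1 + lmon p" by (auto intro!: add_left_mono le_lmon simp: in_keys_iff)
qed simp

text \<open>Projecting to the coefficients at leading exponents is injective on \<open>V\<close>, as
  a nonzero element survives at its own one. Conversely, elements with distinct leading exponents
  are independent: look at the largest exponent that carries a nonzero scalar. Zero is removed
  because its leading exponent is an arbitrary value.\<close>

lemma dim_eq_card_lmon:
  fixes V :: "(nat, 'k::field) mpoly set"
  assumes X: "finite X" and V: "mp.subspace V" "V \<subseteq> homog X e"
  shows "mp.dim V = card (lmon ` (V - {0}))"
proof (rule antisym)
  let ?M = "lmon ` (V - {0})"
  have M: "?M \<subseteq> exps X e"
    using V(2) lookup_lmon by (fastforce dest: homogD)
  then have finM: "finite ?M" using X by (meson finite_exps finite_subset)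
  have fd: "mp.fin_dim V" using fin_dim_homog[OF X] V(2) by (rule mp.fin_dim_subset)
  define \<pi> where "\<pi> = (\<lambda>p :: (nat, 'k) mpoly. \<Sum>u\<in>?M. single u (lookup p u))"
  have lin: "Vector_Spaces.linear pscale pscale \<pi>"
    by (rule linear_mpI)
      (auto simp: \<pi>_def lookup_add single_add sum.distrib mp.scale_sum_right mp.vector_space_axioms)
  have ker: "{x \<in> V. \<pi> x = 0} = {0}"
  proof (intro equalityI subsetI)
    fix x assume x: "x \<in> {x \<in> V. \<pi> x = 0}"
    have "x = 0"
    proof (rule ccontr)
      assume "x \<noteq> 0"
      then have "lmon x \<in> ?M" using x by blast
      then have "lookup (\<pi> x) (lmon x) = lookup x (lmon x)"
        using finM by (simp add: \<pi>_def lookup_sum lookup_single when_def)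
      then show False using x lookup_lmon[OF \<open>x \<noteq> 0\<close>] by simp
    qed
    then show "x \<in> {0}" by simp
  qed (use V(1) in \<open>auto simp: \<pi>_def mp.subspace_0\<close>)
  have "\<pi> ` V \<subseteq> mp.span ((\<lambda>u. single u 1) ` ?M)"
  proof
    fix y assume "y \<in> \<pi> ` V"
    then obtain x where y: "y = (\<Sum>u\<in>?M. pscale (lookup x u) (single u 1))"
      by (auto simp: \<pi>_def)
    show "y \<in> mp.span ((\<lambda>u. single u 1) ` ?M)"
      unfolding y by (intro mp.span_sum mp.span_scale mp.span_base imageI)
  qed
  then have "mp.dim (\<pi> ` V) \<le> card ((\<lambda>u. single u (1::'k)) ` ?M)"
    using finM by (intro mp.dim_le_card) auto
  also have "\<dots> \<le> card ?M" using finM by (rule card_image_le)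
  finally show "mp.dim V \<le> card ?M"
    using dim_kernel_image(1)[OF lin V(1) fd] ker mp.dim_le_card[of "{0 :: (nat, 'k) mpoly}" "{}"] by simp
  have "\<forall>u\<in>?M. \<exists>x. x \<in> V \<and> x \<noteq> 0 \<and> lmon x = u" by blast
  then obtain v where v: "\<And>u. u \<in> ?M \<Longrightarrow> v u \<in> V \<and> v u \<noteq> 0 \<and> lmon (v u) = u" by (metis bchoice)
  have inj: "inj_on v ?M"
  proof (rule inj_onI)
    fix a b assume ab: "a \<in> ?M" "b \<in> ?M" "v a = v b"
    have "a = lmon (v a)" using v[OF ab(1)] by simp
    also have "\<dots> = b" using v[OF ab(2)] ab(3) by simp
    finally show "a = b" .
  qed
  have "mp.independent (v ` ?M)"
  proof (rule mp.independent_if_scalars_zero)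
    fix c x assume s: "(\<Sum>x\<in>v ` ?M. pscale (c x) x) = 0" and x: "x \<in> v ` ?M"
    have s': "(\<Sum>u\<in>?M. pscale (c (v u)) (v u)) = 0" using s by (simp add: sum.reindex[OF inj])
    show "c x = 0"
    proof (rule ccontr)
      assume "c x \<noteq> 0"
      let ?B = "{u \<in> ?M. c (v u) \<noteq> 0}"
      have B: "finite ?B" "?B \<noteq> {}" using finM x \<open>c x \<noteq> 0\<close> by auto
      define b where "b = Max ?B"
      have b: "b \<in> ?M" "c (v b) \<noteq> 0" using Max_in[OF B] by (auto simp: b_def)
      have "0 = (\<Sum>u\<in>?M. c (v u) * lookup (v u) b)"
        using arg_cong[OF s', of "\<lambda>p. lookup p b"] by (simp add: lookup_sum)
      also have "\<dots> = (\<Sum>u\<in>{b}. c (v u) * lookup (v u) b)"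
      proof (rule sum.mono_neutral_right[OF finM])
        show "\<forall>u\<in>?M - {b}. c (v u) * lookup (v u) b = 0"
        proof (rule ballI, rule ccontr)
          fix u assume u: "u \<in> ?M - {b}" and nz: "c (v u) * lookup (v u) b \<noteq> 0"
          then have "u \<le> b" unfolding b_def by (intro Max_ge[OF B(1)]) auto
          moreover have "b \<le> u" using le_lmon[of "v u" b] nz v[of u] u by auto
          ultimately show False using u by auto
        qed
      qed (use b in auto)
      also have "\<dots> \<noteq> 0" using b lookup_lmon[of "v b"] v[OF b(1)] by simp
      finally show False by simp
    qed
  qed (use finM in auto)
  then have "card (v ` ?M) \<le> mp.dim V"
    using v by (intro mp.card_independent_le_dim(2)[OF fd]) auto
  then show "card ?M \<le> mp.dim V" by (simp add: card_image[OF inj])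
qed

lemma dim_homog:
  assumes "finite X"
  shows "mp.dim (homog X e :: (nat, 'k::field) mpoly set) = card (exps X e)"
proof -
  have "lmon ` (homog X e - {0 :: (nat, 'k) mpoly}) = exps X e"
  proof (intro equalityI subsetI)
    fix u assume "u \<in> lmon ` (homog X e - {0 :: (nat, 'k) mpoly})"
    then show "u \<in> exps X e" using lookup_lmon by (fastforce dest: homogD)
  next
    fix u assume u: "u \<in> exps X e"
    have "(single u 1 :: (nat, 'k) mpoly) \<in> homog X e" using u by (rule single_in_homog)
    moreover have "(single u 1 :: (nat, 'k) mpoly) \<noteq> 0"
      by (metis lookup_single_eq lookup_zero zero_neq_one)
    moreover have "u = lmon (single u 1 :: (nat, 'k) mpoly)" by (simp add: lmon_def)
    ultimately show "u \<in> lmon ` (homog X e - {0 :: (nat, 'k) mpoly})" by blast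
  qed
  then show ?thesis
    using dim_eq_card_lmon[OF assms subspace_homog order.refl, where ?'k = 'k, of e] by simp
qed

text \<open>The exponents that do not lead in \<open>N'\<close> have all their divisors of degree
  \<open>e\<close> among those that do not lead in \<open>N\<close>, because multiplication by a
  variable shifts leading exponents; then monomials are counted. The bound on \<open>e\<close>
  matters: two variables have three monomials of degree 2.\<close>

lemma codim_2_growth:
  fixes N N' :: "(nat, 'k::field) mpoly set"
  assumes X: "finite X" and e: "e \<ge> 2" and N: "mp.subspace N" "N \<subseteq> homog X e"
    and N': "mp.subspace N'" "N' \<subseteq> homog X (Suc e)"
    and mult: "\<And>i x. i \<in> X \<Longrightarrow> x \<in> N \<Longrightarrow> var i * x \<in> N'"
    and codim: "mp.dim (homog X e :: (nat, 'k) mpoly set) \<le> mp.dim N + 2"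
  shows "mp.dim (homog X (Suc e) :: (nat, 'k) mpoly set) \<le> mp.dim N' + 2"
proof -
  have sub: "lmon ` (V - {0}) \<subseteq> exps X k" if "V \<subseteq> homog X k" for V :: "(nat, 'k) mpoly set" and k
    using that lookup_lmon by (fastforce dest: homogD)
  let ?C = "exps X e - lmon ` (N - {0})" and ?C' = "exps X (Suc e) - lmon ` (N' - {0})"
  have "card ?C = mp.dim (homog X e :: (nat, 'k) mpoly set) - mp.dim N"
    using sub[OF N(2)] X by (simp add: card_Diff_subset finite_subset dim_homog dim_eq_card_lmon[OF X N])
  then have C2: "card ?C \<le> 2" using codim by simp
  have C'2: "card ?C' = mp.dim (homog X (Suc e) :: (nat, 'k) mpoly set) - mp.dim N'"
    using sub[OF N'(2)] X by (simp add: card_Diff_subset finite_subset dim_homog dim_eq_card_lmon[OF X N'])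
  have "card ?C' \<le> 2"
  proof (rule card_exps_closed_le_2[OF _ C2 e])
    fix u i assume u: "u \<in> ?C'" and i: "i \<in> keys u"
    have eq: "u = single i 1 + (u - single i 1)"
      using i by (intro poly_mapping_eqI) (auto simp: lookup_add lookup_minus lookup_single when_def in_keys_iff)
    have ue: "u - single i 1 \<in> exps X e"
    proof -
      have "mdeg u = Suc e" "keys u \<subseteq> X" using u by (auto simp: exps_def)
      moreover have "mdeg u = 1 + mdeg (u - single i 1)" by (subst eq) (simp only: mdeg_add mdeg_single)
      moreover have "keys (u - single i 1) \<subseteq> keys u"
        by (auto simp: in_keys_iff lookup_minus)
      ultimately show ?thesis by (simp add: exps_def)
    qed
    have iX: "i \<in> X" using u i by (auto simp: exps_def)
    show "u - single i 1 \<in> ?C"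
    proof (rule ccontr)
      assume "u - single i 1 \<notin> ?C"
      then obtain x where x: "x \<in> N" "x \<noteq> 0" "u - single i 1 = lmon x" using ue by auto
      have "lmon (var i * x) = u" unfolding lmon_var_mult[OF x(2)] x(3)[symmetric] by (rule eq[symmetric])
      moreover have "var i * x \<noteq> 0" using lookup_single_mult_add[of "single i 1" 1 x "lmon x"] lookup_lmon[OF x(2)] by auto
      ultimately show False using u mult[OF iX x(1)] by blast
    qed
  next
    show "finite ?C" using X by simp
  qed (simp add: exps_def)
  then show ?thesis using C'2 by simp
qed

subsection \<open>Ideals with a standard Hilbert function\<close>

lemma standard_functionD:
  assumes "standard_function TYPE('k::field) s N h"
  shows "h e \<le> h (Suc e)" "h e = h (Suc e) \<Longrightarrow> e \<le> e' \<Longrightarrow> h e' = s" "h e \<le> s"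
proof -
  have *: "(\<forall>e. h e \<le> h (e + 1)) \<and> (\<forall>e. h e = h (e + 1) \<longrightarrow> (\<forall>e'\<ge>e. h e' = s))"
    using assms unfolding standard_function_def by blast
  show "h e \<le> h (Suc e)" using * by (metis Suc_eq_plus1)
  show "h e' = s" if "h e = h (Suc e)" "e \<le> e'" using * that unfolding Suc_eq_plus1 by blast
  have "enat (h e) \<le> enat s" using assms unfolding standard_function_def by (metis min.boundedE)
  then show "h e \<le> s" by simp
qed

lemma standard_function_mono:
  assumes "standard_function TYPE('k::field) s N h" "a \<le> b"
  shows "h a \<le> h b"
  using standard_functionD(1)[OF assms(1)] assms(2) by (rule lift_Suc_mono_le)

lemma dim_le_Suc_of_subset_span_insert:
  fixes V W :: "('i, 'k::field) mpoly set"
  assumes "mp.fin_dim W" "V \<subseteq> mp.span (insert x W)"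
  shows "mp.dim V \<le> Suc (mp.dim W)"
proof -
  obtain B where B: "B \<subseteq> W" "W \<subseteq> mp.span B" "card B = mp.dim W" "finite B"
    using mp.fin_dim_basis[OF assms(1)] by metis
  have "insert x W \<subseteq> mp.span (insert x B)"
    using B(2) mp.span_mono[of B "insert x B"] mp.span_base[of x "insert x B"] by auto
  then have "mp.span (insert x W) \<subseteq> mp.span (insert x B)" by (rule mp.span_minimal) simp
  then have "mp.dim V \<le> card (insert x B)"
    using assms(2) B(4) by (intro mp.dim_le_card) auto
  also have "\<dots> \<le> Suc (card B)" using card_insert_le_m1[of "Suc (card B)" B x] by (cases "x \<in> B") (auto simp: B(4) card_insert_if)
  finally show ?thesis using B(3) by simp
qed

lemma dim_le_1:
  fixes V :: "('i, 'k::field) mpoly set"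
  assumes "V \<subseteq> mp.span {x}"
  shows "mp.dim V \<le> 1"
  using mp.dim_le_card[OF assms] by simp

context hom_ann
begin

lemma act_eq_0_of_A: "d1 \<le> d2 \<Longrightarrow> p \<in> A d1 \<Longrightarrow> act f p = 0"
  using A_eq_I by (auto simp: I_def)

text \<open>By \<open>act_A_top\<close> all of \<open>A d1\<close> goes to multiples of the leading
  form, so \<open>\<theta>\<close> accounts for exactly one dimension beyond \<open>I d1\<close>. In
  the next degree \<open>var 0 * \<theta>\<close> again gives a multiple of the leading form and
  some \<open>var j * \<theta>\<close> a multiple of a nonzero derivative of it. These have
  different degrees, whence two dimensions beyond \<open>I (Suc d1)\<close>.\<close>

lemma dim_A_gap:
  assumes d2: "d2 \<ge> d1 - 1"
    and np: "\<not> (\<exists>L\<in>homog {1..n} 1. homog_comp d1 f = dp_power {1..n} L d1)"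
    and \<theta>: "\<theta> \<in> A d1" "act f \<theta> \<noteq> 0"
  shows "mp.dim (T d1) + 1 = r + mp.dim (A d1)"
    and "mp.dim (T (Suc d1)) + 2 \<le> r + mp.dim (up n (A d1))"
proof -
  define c where "c = lookup \<theta> (single 0 d1)"
  have act\<theta>: "act f \<theta> = pscale c ftop" unfolding c_def by (rule act_A_top[OF \<theta>(1) d2])
  have c: "c \<noteq> 0" using \<theta>(2) unfolding act\<theta> by auto
  have "act f ` A d1 \<subseteq> mp.span {ftop}"
    using act_A_top[OF _ d2] by (auto intro: mp.span_scale mp.span_base)
  then have le: "mp.dim (act f ` A d1) \<le> 1" by (rule dim_le_1)
  have "{act f \<theta>} \<subseteq> act f ` A d1" using \<theta>(1) by auto
  moreover have "mp.independent {act f \<theta>}" using \<theta>(2) by simp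
  ultimately have "1 \<le> mp.dim (act f ` A d1)"
    using mp.card_independent_le_dim(2)[OF dim_act(2)[OF subspace_A A_sub, of f d1]] by fastforce
  with le have 1: "mp.dim (act f ` A d1) = 1" by simp
  have "{x \<in> A d1. act f x = 0} = I d1" using I_sub_A by (auto simp: I_def A_def)
  then show "mp.dim (T d1) + 1 = r + mp.dim (A d1)"
    using dim_act(1)[OF subspace_A A_sub, of d1 f] dim_I[of d1] 1 by simp
  let ?M = "up n (A d1)"
  have M: "mp.subspace ?M" "?M \<subseteq> T (Suc d1)"
    by (simp add: up_def) (rule up_subset_homog[OF A_sub])
  have "I (Suc d1) \<subseteq> ?M"
    using I_Suc_subset_up[OF np order.refl] up_mono[OF I_sub_A, of n d1] by blast
  then have ker: "{x \<in> ?M. act f x = 0} = I (Suc d1)" using M(2) by (auto simp: I_def)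
  obtain u where u: "lookup ftop u \<noteq> 0" using tdeg_attained[OF ftop_nz] by metis
  then have ud: "u \<in> exps {1..n} d1" using ftop_S by (rule homogD[rotated])
  obtain d where d: "d1 = Suc d" using d1 by (cases d1) auto
  \<comment> \<open>A variable occurring in an exponent of the leading form; contracting with it
    leaves a nonzero coefficient at \<open>v\<close>.\<close>
  obtain j v where j: "j \<in> {1..n}" "v \<in> exps {1..n} d" "u = single j 1 + v"
    using ud unfolding d by (rule exps_Suc_cases)
  define x y where "x = act f (var 0 * \<theta>)" and "y = act f (var j * \<theta>)"
  have xM: "x \<in> act f ` ?M" "y \<in> act f ` ?M"
    unfolding x_def y_def using j(1) by (intro imageI up_I \<theta>(1); simp)+
  have x: "x = pscale c ftop" unfolding x_def act_var0 by (rule act\<theta>)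
  have y: "y = pscale c (contract (var j) ftop)"
  proof -
    have "deh (var j) = (var j :: (nat, 'k) mpoly)" using j(1) by (simp add: lookup_single)
    then show ?thesis unfolding y_def act_mult act\<theta> contract_pscale_right by simp
  qed
  have yv: "lookup y v \<noteq> 0" using u c by (simp add: y j(3) add.commute del: One_nat_def)
  have yu: "lookup y u = 0"
  proof -
    have "mdeg (u + single j 1) \<noteq> d1" using ud by (simp add: exps_def)
    then have "lookup ftop (u + single j 1) = 0" by (rule homog_lookup_0[OF ftop_S])
    then show ?thesis by (simp add: y del: One_nat_def)
  qed
  have xu: "lookup x u \<noteq> 0" using u c by (simp add: x)
  have "x \<notin> mp.span {y}"
  proof
    assume "x \<in> mp.span {y}"
    then obtain k where "x = pscale k y" using mp.span_singleton[of y] by auto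
    then show False using xu yu by simp
  qed
  moreover have "mp.independent {y}" using yv by auto
  ultimately have ind: "mp.independent {x, y}" by (rule mp.independent_insertI)
  have "x \<noteq> y" using xu yu by auto
  then have "2 \<le> mp.dim (act f ` ?M)"
    using mp.card_independent_le_dim(2)[OF dim_act(2)[OF M] ind, of f] xM by (simp add: numeral_2_eq_2)
  then show "mp.dim (T (Suc d1)) + 2 \<le> r + mp.dim ?M"
    using dim_act(1)[OF M, of f] dim_I[of "Suc d1"] ker by simp
qed

lemma r_pos: "r \<ge> 1"
proof -
  have "single (single 0 d1) 1 \<in> T d1"
    by (intro single_in_homog single_in_exps) simp
  moreover have "act f (single (single 0 d1) 1) = f" by (simp add: act_def)
  ultimately have "single (single 0 d1) 1 \<in> T d1 - I d1" using f_nz by (simp add: I_def)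
  then have "I d1 \<subset> T d1" using I_sub by blast
  then have "mp.dim (I d1) < mp.dim (T d1)"
    by (intro mp.dim_psubset_fin[OF fin_dim_T[OF order.refl] subspace_I])
  then show ?thesis using dim_I[of d1] by simp
qed

section \<open>Homogeneous ideals inside the annihilator of the homogenized form\<close>

context
  fixes J :: "(nat, 'k) mpoly set"
  assumes J: "homogeneous_ideal {..n} J" and JF: "J \<subseteq> Ann {..n} F"
begin

lemma subspace_J: "mp.subspace (J \<inter> T e)"
  by (intro mp.subspace_inter subspace_homog subspace_ideal[OF homogeneous_idealD(1)[OF J]])

lemma J_sub_A: "J \<inter> T e \<subseteq> A e"
  using JF by (auto simp: A_def Ann_def)

lemma mult_J: "q \<in> polys {..n} \<Longrightarrow> p \<in> J \<Longrightarrow> q * p \<in> J"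
  by (rule ideal_poly_ringD(4)[OF homogeneous_idealD(1)[OF J]])

lemma var_polys: "i \<le> n \<Longrightarrow> var i \<in> polys {..n}"
  by (auto simp: polys_def)

lemma hilbert_J: "mp.dim (T e) = hilbert_function n J e + mp.dim (J \<inter> T e)"
  using hilbert_function_eq[OF homogeneous_idealD(1)[OF J], of e] dim_T_mono[of "J \<inter> T e" "T e" n e] by auto

lemma up_sub_J: "V \<subseteq> J \<inter> T e \<Longrightarrow> up n V \<subseteq> J \<inter> T (Suc e)"
proof (rule up_minimal[OF subspace_J])
  fix i x assume "V \<subseteq> J \<inter> T e" "i \<le> n" "x \<in> V"
  then show "var i * x \<in> J \<inter> T (Suc e)"
    using mult_J[OF var_polys] var_mult_in_homog[of i "{..n}" x e] by auto
qed

lemma r_le_hilbert_J: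
  assumes "\<And>p. p \<in> J \<inter> T d1 \<Longrightarrow> act f p = 0"
  shows "r \<le> hilbert_function n J d1"
proof -
  have "mp.dim (J \<inter> T d1) \<le> mp.dim (I d1)"
    using assms by (intro dim_T_mono[OF _ I_sub]) (auto simp: I_def)
  then show ?thesis using hilbert_J[of d1] dim_I[of d1] by simp
qed

text \<open>Codimension below \<open>r\<close> in degree \<open>d1\<close> forces an element of
  \<open>J\<close> that does not kill \<open>f\<close>. Then \<open>A d1\<close> has codimension
  exactly \<open>r - 1\<close>, so \<open>J\<close> fills it, and the products with the variables
  push the codimension below \<open>r - 1\<close> in the next degree. A standard function cannot
  decrease.\<close>

lemma no_standard_ideal:
  assumes "d2 \<ge> d1 \<or> d2 = d1 - 1 \<and> \<not> (\<exists>L\<in>homog {1..n} 1. homog_comp d1 f = dp_power {1..n} L d1)"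
  shows "\<not> standard_function TYPE('k) (r - 1) (n + 1) (hilbert_function n J)"
proof
  assume st: "standard_function TYPE('k) (r - 1) (n + 1) (hilbert_function n J)"
  have "hilbert_function n J d1 \<le> r - 1" by (rule standard_functionD(3)[OF st])
  then obtain \<theta> where \<theta>J: "\<theta> \<in> J \<inter> T d1" "act f \<theta> \<noteq> 0" using r_le_hilbert_J r_pos by force
  then have \<theta>: "\<theta> \<in> A d1" "act f \<theta> \<noteq> 0" using J_sub_A by auto
  then have "\<not> d2 \<ge> d1" using act_eq_0_of_A by blast
  then have d2: "d2 \<ge> d1 - 1" and np: "\<not> (\<exists>L\<in>homog {1..n} 1. homog_comp d1 f = dp_power {1..n} L d1)"
    using assms by auto
  note gap = dim_A_gap[OF d2 np \<theta>]
  have "mp.dim (A d1) \<le> mp.dim (J \<inter> T d1)"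
    using hilbert_J[of d1] gap(1) standard_functionD(3)[OF st, of d1] r_pos by simp
  then have JA: "J \<inter> T d1 = A d1"
    by (intro mp.subspace_eq_if_dim_le[OF fin_dim_T[OF A_sub] subspace_J J_sub_A])
  have "mp.dim (up n (A d1)) \<le> mp.dim (J \<inter> T (Suc d1))"
    using up_sub_J[of "A d1" d1] JA by (intro dim_T_mono) auto
  then have "hilbert_function n J (Suc d1) < hilbert_function n J d1"
    using hilbert_J[of d1] hilbert_J[of "Suc d1"] gap r_pos JA by simp
  then show False using standard_functionD(1)[OF st, of d1] by simp
qed

end

text \<open>The leading form is homogeneous, so each component of \<open>deh \<phi>\<close> kills
  it, while some component of degree \<open>j\<close> does not kill \<open>f\<close>. Its result has
  degree less than \<open>d1 - j\<close>, so reducing that result to the constant 1 takes a total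
  order of at most \<open>d1 - 1\<close>.\<close>

lemma act_one_of_kernel_ftop:
  assumes \<phi>: "\<phi> \<in> T (d1 - 1)" and ker: "contract (deh \<phi>) ftop = 0" and nz: "act f \<phi> \<noteq> 0"
  obtains \<phi>' where "\<phi>' \<in> T (d1 - 1)" "act f \<phi>' = 1"
proof -
  define q where "q = deh \<phi>"
  have q: "q \<in> polys {1..n}" unfolding q_def using \<phi> homog_subset_polys by (intro deh_in_polys) blast
  have tq: "tdeg q \<le> d1 - 1" unfolding q_def by (rule tdeg_deh_le[OF \<phi>])
  have "\<exists>j\<in>mdeg ` keys q. contract (homog_comp j q) f \<noteq> 0"
  proof (rule ccontr)
    assume "\<not> ?thesis"
    then have "contract (\<Sum>j\<in>mdeg ` keys q. homog_comp j q) f = 0"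
      unfolding contract_sum_left by (intro sum.neutral) auto
    then show False using nz by (simp add: sum_homog_comp act_def q_def)
  qed
  then obtain j where j: "j \<in> mdeg ` keys q" and g0: "contract (homog_comp j q) f \<noteq> 0" by blast
  define \<psi> g where "\<psi> = homog_comp j q" and "g = contract \<psi> f"
  have jd: "j \<le> d1 - 1" using j tq by (auto simp: tdeg_le_iff in_keys_iff)
  have \<psi>: "\<psi> \<in> S j" unfolding \<psi>_def by (rule homog_comp_in_homog[OF q])
  have \<psi>top: "lookup (contract \<psi> f) w = 0" if w: "mdeg w + j \<ge> d1" for w
  \<comment> \<open>At the boundary only the leading form of \<open>f\<close> is met, and the
    components of \<open>q\<close> are separated by degree; beyond it the degree of \<open>f\<close>
    is exceeded.\<close>
  proof (cases "mdeg w + j = d1")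
    case True
    have "lookup (contract \<psi> f) w
      = (\<Sum>u\<in>keys q. lookup \<psi> u * lookup f (w + u))"
      by (rule lookup_contract_superset) (auto simp: \<psi>_def in_keys_iff lookup_homog_comp split: if_splits)
    also have "\<dots> = (\<Sum>u\<in>keys q. lookup q u * lookup ftop (w + u))"
      using True by (intro sum.cong) (auto simp: \<psi>_def lookup_homog_comp ftop_def)
    also have "\<dots> = 0" using ker by (simp add: q_def flip: lookup_contract)
    finally show ?thesis .
  next
    case False
    show ?thesis
    proof (rule ccontr)
      assume "lookup (contract \<psi> f) w \<noteq> 0"
      then obtain u where "u \<in> exps {1..n} j" "lookup f (w + u) \<noteq> 0"
        using contract_degree[OF \<psi>] by metis
      then show False using lookup_f_0[of "w + u"] w False by (auto simp: exps_def)
    qed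
  qed
  have g: "g \<noteq> 0" using g0 by (simp add: g_def \<psi>_def)
  obtain w where w: "lookup g w \<noteq> 0" "mdeg w = tdeg g" using tdeg_attained[OF g] by blast
  have gS: "g \<in> polys {1..n}" unfolding g_def by (rule contract_in_polys[OF f])
  have wj: "mdeg w + j \<le> d1 - 1"
  proof (rule ccontr)
    assume "\<not> ?thesis"
    then have "mdeg w + j \<ge> d1" by simp
    then show False using \<psi>top w(1) by (simp add: g_def)
  qed
  define s where "s = single w (1 / lookup g w) * \<psi>"
  have "w \<in> exps {1..n} (mdeg w)" using gS w(1) by (auto simp: polys_iff exps_def)
  then have s: "s \<in> S (mdeg w + j)" unfolding s_def by (intro homog_mult single_in_homog \<psi>)
  have "contract s f = 1"
  proof (rule poly_mapping_eqI)
    fix v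
    have "lookup (contract s f) v = lookup g (v + w) / lookup g w"
      by (simp add: s_def contract_mult g_def)
    also have "\<dots> = lookup 1 v"
    proof (cases "v = 0")
      case False
      then have "mdeg v \<noteq> 0" by simp
      then have "mdeg (v + w) > tdeg g" using w(2) by (simp only: mdeg_add)
      then have "lookup g (v + w) = 0" using mdeg_le_tdeg[of g "v + w"] by fastforce
      then show ?thesis using False by (simp add: lookup_one)
    qed (use w(1) in simp)
    finally show "lookup (contract s f) v = lookup 1 v" .
  qed
  moreover have sp: "s \<in> polys {1..n}" using s homog_subset_polys by blast
  moreover have "tdeg s \<le> d1 - 1" unfolding tdeg_le_iff using homogD[OF s] wj by (auto simp: exps_def)
  ultimately show thesis
    using that[of "hz (d1 - 1) s"] hz_in_homog[OF sp] by (simp add: act_def deh_hz[OF sp])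
qed

lemma act_S_d1_const:
  assumes "p \<in> S d1"
  shows "act f p \<in> mp.span {1}"
proof -
  have "act f p = pscale (lookup (act f p) 0) 1"
  proof (rule poly_mapping_eqI)
    fix w
    show "lookup (act f p) w = lookup (pscale (lookup (act f p) 0) 1) w"
    proof (cases "w = 0")
      case False
      then have "mdeg w \<noteq> 0" by simp
      have "lookup (act f p) w = 0"
      proof (rule ccontr)
        assume "lookup (act f p) w \<noteq> 0"
        then obtain u where "u \<in> exps {1..n} d1" "lookup f (w + u) \<noteq> 0"
          using contract_degree[OF assms, of f w] act_S[OF assms] by metis
        then show False using lookup_f_0[of "w + u"] \<open>mdeg w \<noteq> 0\<close> by (auto simp: exps_def simp del: mdeg_eq_0_iff)
      qed
      then show ?thesis using False by (simp add: lookup_one)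
    qed simp
  qed
  then show ?thesis by (metis mp.span_base mp.span_scale singletonI)
qed

text \<open>Forms of degree \<open>d1\<close> are multiples of the homogenizing variable, which act
  like forms of degree \<open>d1 - 1\<close>, plus elements of \<open>S d1\<close>, which take
  \<open>f\<close> to constants. So at most one dimension is lost.\<close>

lemma dim_T_pred: "r \<le> Suc (mp.dim (act f ` T (d1 - 1)))"
proof -
  obtain d where d: "d1 = Suc d" using d1 by (cases d1) auto
  have "act f ` T d1 \<subseteq> mp.span (insert 1 (act f ` T d))"
  proof
    fix x assume "x \<in> act f ` T d1"
    then obtain p where p: "p \<in> T (Suc d)" "x = act f p" using d by auto
    obtain p' p'' where pp: "p' \<in> T d" "p'' \<in> S (Suc d)" "p = var 0 * p' + p''"
      using var0_decomp[OF p(1)] .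
    have "act f p' \<in> mp.span (insert 1 (act f ` T d))" using pp(1) by (intro mp.span_base) auto
    moreover have "act f p'' \<in> mp.span (insert 1 (act f ` T d))"
      using act_S_d1_const pp(2) d mp.span_mono[of "{1}" "insert 1 (act f ` T d)"] by auto
    ultimately show "x \<in> mp.span (insert 1 (act f ` T d))"
      unfolding p(2) pp(3) act_add act_var0 by (rule mp.span_add)
  qed
  from dim_le_Suc_of_subset_span_insert[OF dim_act(2)[OF subspace_homog order.refl] this]
  have "mp.dim (act f ` T d1) \<le> Suc (mp.dim (act f ` T d))" .
  then show ?thesis
    using dim_act(1)[OF subspace_homog order.refl, of n d1 f] dim_I[of d1] d by (simp add: I_def)
qed


section \<open>Saturation of ideals with an (r, n+1)-standard Hilbert function\<close>

context
  fixes J :: "(nat, 'k) mpoly set"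
  assumes J: "homogeneous_ideal {..n} J" and JF: "J \<subseteq> Ann {..n} F"
    and st: "standard_function TYPE('k) r (n + 1) (hilbert_function n J)"
    and np: "\<not> (\<exists>L\<in>homog {1..n} 1. homog_comp d1 f = dp_power {1..n} L d1)"
begin

lemmas subJ = subspace_J[OF J JF] and JA = J_sub_A[OF J JF] and dimJ = hilbert_J[OF J JF]
  and multJ = mult_J[OF J JF]

text \<open>Here \<open>J\<close> and \<open>Ann(f)\<^sup>h\<^sup>o\<^sup>m\<close> both have codimension \<open>r\<close>. Their intersection has
  codimension at most \<open>r + 1\<close> in degree \<open>d\<^sub>1\<close>, and from then on its codimension grows by at most two
  in each degree. On the other hand, \<open>J\<close> contains an element taking \<open>f\<close> to \<open>F\<^bsub>d1\<^esub>\<close>, whose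
  multiples force codimension at least \<open>2r - 1\<close> in degree \<open>2d\<^sub>1 - 1\<close>.\<close>
lemma act_J_eq_0_aux:
  assumes d2: "d2 = d1 - 1" and r2: "r > 2 * d1" and \<theta>J: "\<theta> \<in> J \<inter> T d1"
  shows "act f \<theta> = 0"
proof (rule ccontr)
  assume nz: "act f \<theta> \<noteq> 0"
  have d2': "d2 \<ge> d1 - 1" using d2 by simp
  have \<theta>A: "\<theta> \<in> A d1" using \<theta>J JA by blast
  define c where "c = lookup \<theta> (single 0 d1)"
  have act\<theta>: "act f \<theta> = pscale c ftop" unfolding c_def by (rule act_A_top[OF \<theta>A d2'])
  have c: "c \<noteq> 0" using nz unfolding act\<theta> by auto
  \<comment> \<open>If 1 were reached in this degree, \<open>\<theta>\<close> would have to kill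
    \<open>f\<close>.\<close>
  have no1: "act f \<phi> \<noteq> 1" if "\<phi> \<in> T (d1 - 1)" for \<phi>
    using A_eq_I_of_one[OF d2' that _ \<theta>A] nz by blast
  let ?h = "hilbert_function n J"
  have Ieq: "mp.dim (T e) = mp.dim (act f ` T e) + mp.dim (I e)" for e
    using dim_act(1)[OF subspace_homog order.refl, of n e f] by (simp add: I_def)
  have "mp.dim (J \<inter> T (d1 - 1)) \<le> mp.dim (I (d1 - 1))"
    using JA[of "d1 - 1"] A_eq_I[of "d1 - 1"] d2 by (intro dim_T_mono[OF _ I_sub]) auto
  then have hlow: "r - 1 \<le> ?h (d1 - 1)"
    using dimJ[of "d1 - 1"] Ieq[of "d1 - 1"] dim_T_pred by linarith
  \<comment> \<open>The function is at least \<open>r - 1\<close> in degree \<open>d1 - 1\<close>.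
    If it stays constant in the next step, standardness makes it \<open>r\<close>; otherwise it
    rises to \<open>r\<close>.\<close>
  have hr: "?h e = r" if "e \<ge> d1" for e
  proof (cases "?h (d1 - 1) = ?h d1")
    case True
    then show ?thesis using standard_functionD(2)[OF st, of "d1 - 1" e] d1 that by simp
  next
    case False
    then have "?h (d1 - 1) < ?h d1" using standard_function_mono[OF st, of "d1 - 1" d1] by simp
    then have "r \<le> ?h d1" using hlow by simp
    also have "\<dots> \<le> ?h e" by (rule standard_function_mono[OF st that])
    finally show ?thesis using standard_functionD(3)[OF st, of e] by simp
  qed
  define L where "L = (\<lambda>e. J \<inter> I e)"
  define N where "N = (\<lambda>e. L e \<inter> S e)"
  have subL: "mp.subspace (L e)" for e
  proof -
    have "L e = (J \<inter> T e) \<inter> I e" using I_sub by (auto simp: L_def)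
    then show ?thesis using subJ subspace_I by (simp add: mp.subspace_inter)
  qed
  have subN: "mp.subspace (N e)" for e unfolding N_def by (intro mp.subspace_inter subL subspace_homog)
  have LT: "L e \<subseteq> T e" for e using I_sub by (auto simp: L_def)
  have varL: "var i * x \<in> L (Suc e)" if "x \<in> L e" "i \<le> n" for i x e
    using that multJ[OF var_polys[OF J JF]] var_mult_in_homog[of i "{..n}" x e]
    by (auto simp: L_def I_def act_mult)
  have kerL: "{x \<in> J \<inter> T e. act f x = 0} = L e" for e by (auto simp: L_def I_def)
  have J_L: "mp.dim (J \<inter> T e) = mp.dim (act f ` (J \<inter> T e)) + mp.dim (L e)" for e
    using dim_act(1)[OF subJ, of e n e f] kerL by simp
  have "act f ` (J \<inter> T d1) \<subseteq> mp.span {ftop}"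
  proof
    fix x assume "x \<in> act f ` (J \<inter> T d1)"
    then obtain p where "p \<in> A d1" "x = act f p" using JA by blast
    then have x: "x = pscale (lookup p (single 0 d1)) ftop"
      using act_A_top[OF _ d2'] by simp
    show "x \<in> mp.span {ftop}" unfolding x by (intro mp.span_scale mp.span_base) simp
  qed
  then have "mp.dim (act f ` (J \<inter> T d1)) \<le> 1" by (rule dim_le_1)
  then have dL: "mp.dim (T d1) \<le> mp.dim (L d1) + r + 1"
    using J_L[of d1] dimJ[of d1] hr[of d1] by simp
  \<comment> \<open>One dimension is lost because \<open>S d1\<close> takes \<open>f\<close> to
    constants, another because \<open>I d1\<close> exceeds \<open>L d1\<close> by at most one
    dimension, which is the content of \<open>dL\<close>.\<close>
  have dN: "mp.dim (S d1) \<le> mp.dim (N d1) + 2"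
  proof -
    have SI: "mp.subspace (S d1 \<inter> I d1)" by (intro mp.subspace_inter subspace_homog subspace_I)
    have "act f ` S d1 \<subseteq> mp.span {1}" using act_S_d1_const by blast
    then have "mp.dim (act f ` S d1) \<le> 1" by (rule dim_le_1)
    moreover have "{x \<in> S d1. act f x = 0} = S d1 \<inter> I d1" using S_subset_T[of n d1] by (auto simp: I_def)
    ultimately have 1: "mp.dim (S d1) \<le> mp.dim (S d1 \<inter> I d1) + 1"
      using dim_act(1)[OF subspace_homog S_subset_T, of n d1 f] by simp
    have idl: "Vector_Spaces.linear pscale pscale (\<lambda>x :: (nat, 'k) mpoly. x)"
      by (rule linear_mpI) (auto simp: mp.vector_space_axioms)
    have "quot_dim pscale (S d1 \<inter> I d1) (N d1) \<le> quot_dim pscale (I d1) (L d1)"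
      by (rule quot_dim_le_of_linear[OF idl SI]) (auto simp: N_def mp.subspace_0[OF subL])
    moreover have "quot_dim pscale (S d1 \<inter> I d1) (N d1) = enat (mp.dim (S d1 \<inter> I d1) - mp.dim (N d1))"
      by (rule mp.quot_dim_dim[OF SI _ subN]) (auto simp: N_def L_def intro: fin_dim_T dest: I_sub[THEN subsetD])
    moreover have "quot_dim pscale (I d1) (L d1) = enat (mp.dim (I d1) - mp.dim (L d1))"
      by (rule mp.quot_dim_dim[OF subspace_I fin_dim_T[OF I_sub] subL]) (auto simp: L_def)
    ultimately have "mp.dim (S d1 \<inter> I d1) - mp.dim (N d1) \<le> 1" using dL dim_I[of d1] by simp
    then show ?thesis using 1 by simp
  qed
  have dNk: "mp.dim (S (d1 + k)) \<le> mp.dim (N (d1 + k)) + 2" if "d1 \<ge> 2" for k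
  proof (induction k)
    case (Suc k)
    have "mp.dim (S (Suc (d1 + k))) \<le> mp.dim (N (Suc (d1 + k))) + 2"
    proof (rule codim_2_growth[OF _ _ subN _ subN _ _ Suc])
      fix i x assume "i \<in> {1..n}" "x \<in> N (d1 + k)"
      then show "var i * x \<in> N (Suc (d1 + k))"
        using varL[of x "d1 + k" i] var_mult_in_homog[of i "{1..n}" x "d1 + k"] by (auto simp: N_def)
    qed (use that in \<open>auto simp: N_def\<close>)
    then show ?case by simp
  qed (use dN in simp)
  \<comment> \<open>Contraction is applied to operators here and serves as division by the
    homogenizing variable; what it kills lies in \<open>S\<close>.\<close>
  let ?\<pi> = "contract (var 0) :: (nat, 'k) mpoly \<Rightarrow> _"
  have lin\<pi>: "Vector_Spaces.linear pscale pscale ?\<pi>"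
    by (rule linear_mpI) (auto simp: contract_add_right contract_pscale_right mp.vector_space_axioms)
  have \<pi>v: "?\<pi> (var 0 * x) = x" for x
    by (rule poly_mapping_eqI) (metis add.commute lookup_contract_single lookup_single_mult_add mult_1)
  have \<pi>S: "?\<pi> x = 0" if "x \<in> S e" for x e
  proof (rule poly_mapping_eqI, rule ccontr)
    fix w assume "lookup (?\<pi> x) w \<noteq> lookup 0 w"
    then have "w + single 0 1 \<in> exps {1..n} e" using homogD[OF that] by (simp del: One_nat_def)
    from exps_no_0[OF this] show False by (simp add: lookup_add)
  qed
  have dT: "mp.dim (T (Suc e)) \<le> mp.dim (T e) + mp.dim (S (Suc e))" for e
  proof -
    have "?\<pi> ` T (Suc e) \<subseteq> T e"
    proof
      fix y assume "y \<in> ?\<pi> ` T (Suc e)"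
      then obtain p where p: "p \<in> T (Suc e)" "y = ?\<pi> p" by auto
      obtain p' p'' where pp: "p' \<in> T e" "p'' \<in> S (Suc e)" "p = var 0 * p' + p''"
        using var0_decomp[OF p(1)] .
      then show "y \<in> T e" using \<pi>S[OF pp(2)] \<pi>v[of p'] by (simp add: p(2) contract_add_right)
    qed
    moreover have "{x \<in> T (Suc e). ?\<pi> x = 0} \<subseteq> S (Suc e)"
    proof
      fix p assume p: "p \<in> {x \<in> T (Suc e). ?\<pi> x = 0}"
      then obtain p' p'' where pp: "p' \<in> T e" "p'' \<in> S (Suc e)" "p = var 0 * p' + p''"
        using var0_decomp[of p e] by blast
      have "p' = 0" using p \<pi>S[OF pp(2)] \<pi>v[of p'] by (simp add: pp(3) contract_add_right)
      then show "p \<in> S (Suc e)" using pp by simp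
    qed
    ultimately have "mp.dim (?\<pi> ` T (Suc e)) \<le> mp.dim (T e)" "mp.dim {x \<in> T (Suc e). ?\<pi> x = 0} \<le> mp.dim (S (Suc e))"
      using S_subset_T by (blast intro: dim_T_mono)+
    then show ?thesis
      using dim_kernel_image(1)[OF lin\<pi> subspace_homog fin_dim_homog, of "{..n}" "Suc e"] by simp
  qed
  \<comment> \<open>Together with \<open>dT\<close> this bounds the growth of the codimension of
    \<open>L\<close> by the codimension of \<open>N (Suc e)\<close> in
    \<open>S (Suc e)\<close>.\<close>
  have dLS: "mp.dim (L e) + mp.dim (N (Suc e)) \<le> mp.dim (L (Suc e))" for e
  proof -
    have fd: "mp.fin_dim (L (Suc e))" by (rule fin_dim_T[OF LT])
    have "L e \<subseteq> ?\<pi> ` L (Suc e)"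
    proof
      fix x assume "x \<in> L e"
      then show "x \<in> ?\<pi> ` L (Suc e)" using varL[of x e 0] \<pi>v[of x] by (metis image_eqI le0)
    qed
    moreover have "N (Suc e) \<subseteq> {x \<in> L (Suc e). ?\<pi> x = 0}" using \<pi>S by (auto simp: N_def)
    ultimately have "mp.dim (L e) \<le> mp.dim (?\<pi> ` L (Suc e))"
      "mp.dim (N (Suc e)) \<le> mp.dim {x \<in> L (Suc e). ?\<pi> x = 0}"
      using dim_kernel_image(2)[OF lin\<pi> subL fd] fd
      by (auto intro!: mp.dim_mono_fin intro: mp.fin_dim_subset)
    then show ?thesis using dim_kernel_image(1)[OF lin\<pi> subL fd] by simp
  qed
  \<comment> \<open>The growth bound starts in degree 2. The alternative \<open>k = 0\<close> covers
    \<open>d1 = 1\<close>, where the target degree \<open>2 d1 - 1\<close> is \<open>d1\<close>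
    itself.\<close>
  have grow: "mp.dim (T (d1 + k)) \<le> mp.dim (L (d1 + k)) + r + 1 + 2 * k" if "d1 \<ge> 2 \<or> k = 0" for k
    using that
  proof (induction k)
    case (Suc k)
    then show ?case using dNk[of "Suc k"] dT[of "d1 + k"] dLS[of "d1 + k"] by simp
  qed (use dL in simp)
  define \<psi> where "\<psi> = (\<lambda>\<phi>. act f (\<theta> * \<phi>))"
  have lin\<psi>: "Vector_Spaces.linear pscale pscale \<psi>"
    by (rule linear_mpI)
      (simp_all add: \<psi>_def act_mult act_add act_pscale contract_add_right contract_pscale_right
        mp.vector_space_axioms)
  have \<psi>: "\<psi> \<phi> = pscale c (contract (deh \<phi>) ftop)" for \<phi>
    unfolding \<psi>_def mult.commute[of \<theta>] act_mult act\<theta> contract_pscale_right ..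
  \<comment> \<open>A form whose product with \<open>\<theta>\<close> kills \<open>f\<close> kills
    the leading form. If it did not kill \<open>f\<close>, the constant 1 could be reached, against
    \<open>no1\<close>. So the multiples of \<open>\<theta>\<close> contribute at least
    \<open>r - 1\<close> dimensions.\<close>
  have ker: "{\<phi> \<in> T (d1 - 1). \<psi> \<phi> = 0} \<subseteq> I (d1 - 1)"
  proof
    fix \<phi> assume \<phi>: "\<phi> \<in> {\<phi> \<in> T (d1 - 1). \<psi> \<phi> = 0}"
    then have "contract (deh \<phi>) ftop = 0" using c by (simp add: \<psi>)
    then have "act f \<phi> = 0" using \<phi> act_one_of_kernel_ftop no1 by blast
    then show "\<phi> \<in> I (d1 - 1)" using \<phi> by (simp add: I_def)
  qed
  have "mp.dim {\<phi> \<in> T (d1 - 1). \<psi> \<phi> = 0} \<le> mp.dim (I (d1 - 1))" by (rule dim_T_mono[OF ker I_sub])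
  then have "r - 1 \<le> mp.dim (\<psi> ` T (d1 - 1))"
    using dim_kernel_image(1)[OF lin\<psi> subspace_homog fin_dim_homog[OF finite_atMost], of n "d1 - 1"]
      Ieq[of "d1 - 1"] dim_T_pred by linarith
  also have "\<dots> \<le> mp.dim (act f ` (J \<inter> T (d1 + (d1 - 1))))"
  proof (rule mp.dim_mono_fin[OF dim_act(2)[OF subJ, of _ n]])
    show "\<psi> ` T (d1 - 1) \<subseteq> act f ` (J \<inter> T (d1 + (d1 - 1)))"
    proof
      fix y assume "y \<in> \<psi> ` T (d1 - 1)"
      then obtain \<phi> where \<phi>: "\<phi> \<in> T (d1 - 1)" "y = act f (\<theta> * \<phi>)" by (auto simp: \<psi>_def)
      have "\<theta> * \<phi> \<in> T (d1 + (d1 - 1))" using \<theta>J \<phi>(1) by (intro homog_mult) auto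
      moreover have "\<theta> * \<phi> \<in> J"
        using multJ[of \<phi> \<theta>] \<phi>(1) \<theta>J homog_subset_polys by (auto simp: mult.commute)
      ultimately show "y \<in> act f ` (J \<inter> T (d1 + (d1 - 1)))" unfolding \<phi>(2) by blast
    qed
  qed auto
  \<comment> \<open>\<open>J\<close> has codimension \<open>r\<close> in degree
    \<open>2 d1 - 1\<close> and exceeds \<open>L\<close> by at least \<open>r - 1\<close>
    dimensions. Against the upper bound from \<open>grow\<close> this leaves
    \<open>r \<le> 2 * d1\<close>.\<close>
  finally have "r + (r - 1) + mp.dim (L (d1 + (d1 - 1))) \<le> mp.dim (T (d1 + (d1 - 1)))"
    using J_L[of "d1 + (d1 - 1)"] dimJ[of "d1 + (d1 - 1)"] hr[of "d1 + (d1 - 1)"] by simp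
  also have "\<dots> \<le> mp.dim (L (d1 + (d1 - 1))) + r + 1 + 2 * (d1 - 1)"
    using d1 by (intro grow) linarith
  finally show False using r2 d1 by simp
qed

text \<open>In degree \<open>d1\<close> the ideal lies in \<open>I d1\<close> and has the same
  codimension. From there on \<open>I\<close> is generated by \<open>I d1\<close>, so
  \<open>J\<close> contains it, and equal codimension gives equality in each degree.\<close>

lemma saturation_J:
  assumes cond: "d2 \<ge> d1 \<or> d2 = d1 - 1 \<and> r > 2 * d1"
  shows "saturation n J = hom_ideal n (Ann {1..n} f)"
proof -
  have zero: "act f p = 0" if "p \<in> J \<inter> T d1" for p
    using cond act_eq_0_of_A[of p] JA[of d1] act_J_eq_0_aux[of p] that by blast
  have hr: "hilbert_function n J e = r" if "e \<ge> d1" for e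
    using r_le_hilbert_J[OF J JF zero] standard_function_mono[OF st that] standard_functionD(3)[OF st, of e] by simp
  have JI: "J \<inter> T (d1 + k) = I (d1 + k)" for k
  proof (induction k)
    case 0
    have sub: "J \<inter> T d1 \<subseteq> I d1" using zero by (auto simp: I_def)
    have "mp.dim (I d1) \<le> mp.dim (J \<inter> T d1)" using dimJ[of d1] dim_I[of d1] hr[of d1] by linarith
    from mp.subspace_eq_if_dim_le[OF fin_dim_T[OF I_sub] subJ sub this] show ?case by simp
  next
    case (Suc k)
    have "I (Suc (d1 + k)) \<subseteq> up n (I (d1 + k))" by (rule I_Suc_subset_up[OF np]) simp
    also have "\<dots> \<subseteq> J \<inter> T (Suc (d1 + k))" using Suc by (intro up_sub_J[OF J JF]) simp
    finally have sub: "I (Suc (d1 + k)) \<subseteq> J \<inter> T (Suc (d1 + k))" .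
    have "mp.dim (J \<inter> T (Suc (d1 + k))) \<le> mp.dim (I (Suc (d1 + k)))"
      using dimJ[of "Suc (d1 + k)"] dim_I[of "Suc (d1 + k)"] hr[of "Suc (d1 + k)"] by linarith
    from mp.subspace_eq_if_dim_le[OF fin_dim_T[OF Int_lower2] subspace_I sub this] show ?case by simp
  qed
  have "saturation n J = Ann_hom n f"
  proof (rule saturation_eq_Ann_hom[OF f J])
    fix e p assume e: "e \<ge> d1" and p: "p \<in> T e"
    have "p \<in> J \<longleftrightarrow> p \<in> I e" using JI[of "e - d1"] e p by auto
    then show "p \<in> J \<longleftrightarrow> p \<in> Ann_hom n f" using Ann_hom_homog_iff[OF f p] p by (simp add: I_def)
  qed
  then show ?thesis using hom_ideal_Ann[OF f] by simp
qed

end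

end

subsection \<open>Evaluation\<close>

lemma evalp_superset:
  assumes "finite A" "keys p \<subseteq> A"
  shows "evalp a p = (\<Sum>u\<in>A. lookup p u * mon a u)"
  unfolding evalp_def mon_def[symmetric] using assms by (intro sum.mono_neutral_left) (auto simp: in_keys_iff)

lemma evalp_add: "evalp a (p + q) = evalp a p + evalp a q"
proof -
  let ?A = "keys p \<union> keys q"
  have "keys (p + q) \<subseteq> ?A" by (rule Poly_Mapping.keys_add)
  then show ?thesis
    using evalp_superset[of ?A "p + q" a] evalp_superset[of ?A p a] evalp_superset[of ?A q a]
    by (simp add: lookup_add sum.distrib distrib_right)
qed

lemma evalp_single [simp]: "evalp a (single u c) = c * mon a u"
  by (subst evalp_superset[of "{u}"]) auto

lemma evalp_0 [simp]: "evalp a 0 = 0"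
  by (simp add: evalp_def)

lemma evalp_1 [simp]: "evalp a 1 = 1"
  using evalp_single[of a 0 1] by simp

lemma evalp_sum: "evalp a (\<Sum>i\<in>A. g i) = (\<Sum>i\<in>A. evalp a (g i))"
  by (induction A rule: infinite_finite_induct) (simp_all add: evalp_add)

lemma evalp_mult: "evalp a (p * q) = evalp a p * evalp a q"
  unfolding mult_sum_single[of p q] evalp_sum
  by (simp add: evalp_superset[of "keys p" p] evalp_superset[of "keys q" q]
      sum_product mon_add mult_ac)

lemma evalp_power: "evalp a (p ^ k) = evalp a p ^ k"
  by (induction k) (simp_all add: evalp_mult)

lemma evalp_homog_scale:
  assumes "p \<in> homog X e"
  shows "evalp (\<lambda>i. c * a i) p = c ^ e * evalp a p"
proof -
  have "lookup p u * mon (\<lambda>i. c * a i) u = c ^ e * (lookup p u * mon a u)" for u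
    using homogD[OF assms, of u] by (cases "lookup p u = 0") (auto simp: mon_scale exps_def mult_ac)
  then show ?thesis
    by (simp add: evalp_superset[of "keys p" p] sum_distrib_left)
qed

text \<open>Over a finite field, 1 plus the product of all \<open>X - x\<close> has no root.\<close>

lemma infinite_alg_closed_field: "infinite (UNIV :: 'k::alg_closed_field set)"
proof
  assume fin: "finite (UNIV :: 'k set)"
  define p :: "'k poly" where "p = (\<Prod>x\<in>UNIV. [:- x, 1:])"
  have deg: "degree p > 0" unfolding p_def
    using fin by (subst degree_prod_eq_sum_degree) (auto simp: card_gt_0_iff)
  then have "degree (p + 1) > 0" by (subst degree_add_eq_left) auto
  then obtain x where "poly (p + 1) x = 0" using alg_closed_imp_poly_has_root by blast
  moreover have "poly p x = 0" using fin by (auto simp: p_def poly_prod prod_zero_iff)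
  ultimately show False by simp
qed

lemma exps_1: "exps X 1 = (\<lambda>i. single i 1) ` X"
proof (intro equalityI subsetI)
  fix u assume "u \<in> exps X 1"
  then have "u \<in> exps X (Suc 0)" by simp
  then obtain i v where "i \<in> X" "v \<in> exps X 0" "u = single i 1 + v" by (rule exps_Suc_cases)
  then show "u \<in> (\<lambda>i. single i 1) ` X" by (auto simp: exps_def)
qed (auto intro: single_in_exps)

lemma proj_space_1E:
  assumes "P \<in> proj_space n 1"
  obtains L i where "P = line L" "L \<in> homog {..n} 1" "L \<noteq> 0" "i \<le> n" "lin_coord L i \<noteq> 0"
proof -
  obtain L where L: "P = line L" "L \<in> homog {..n} 1" "L \<noteq> 0" using assms by (auto simp: proj_space_def)
  obtain u where u: "lookup L u \<noteq> 0" using tdeg_attained[OF L(3)] by metis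
  then have "u \<in> exps {..n} 1" by (rule homogD[OF L(2)])
  then obtain i where "i \<le> n" "u = single i 1" unfolding exps_1 by auto
  then show thesis using that[OF L, of i] u by (simp add: lin_coord_def)
qed

lemma self_in_line: "L \<in> line L"
  unfolding line_def by (intro CollectI exI[of _ 1]) simp

lemma lin_coord_pscale: "lin_coord (pscale c L) = (\<lambda>i. c * lin_coord L i)"
  by (simp add: lin_coord_def fun_eq_iff)

lemma nonvanishing_at_line:
  assumes "H \<in> homog X e" "evalp (lin_coord L) H \<noteq> 0"
  shows "nonvanishing_at H (line L)"
  unfolding nonvanishing_at_def
proof
  fix M assume "M \<in> line L - {0}"
  then obtain c where "M = pscale c L" "c \<noteq> 0" by (auto simp: line_def)
  then show "evalp (lin_coord M) H \<noteq> 0"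
    using assms(2) evalp_homog_scale[OF assms(1)] by (simp add: lin_coord_pscale)
qed

lemma nonvanishing_at_mult:
  "nonvanishing_at G P \<Longrightarrow> nonvanishing_at H P \<Longrightarrow> nonvanishing_at (G * H) P"
  by (simp add: nonvanishing_at_def evalp_mult)

lemma nonvanishing_at_power: "nonvanishing_at G P \<Longrightarrow> nonvanishing_at (G ^ e) P"
  by (simp add: nonvanishing_at_def evalp_power)

lemma nonvanishing_at_1 [simp]: "nonvanishing_at 1 P"
  by (simp add: nonvanishing_at_def)

lemma nonvanishing_at_neq_0:
  assumes "P \<in> proj_space n d" "nonvanishing_at H P"
  shows "H \<noteq> 0"
proof -
  obtain L where "P = line L" "L \<noteq> 0" using assms(1) by (auto simp: proj_space_def)
  then have "L \<in> P - {0}" using self_in_line by auto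
  then show ?thesis using assms(2) by (auto simp: nonvanishing_at_def)
qed

lemma one_in_homog: "1 \<in> homog X 0"
  by (auto simp: homog_def exps_def)

lemma power_in_homog: "p \<in> homog X d \<Longrightarrow> p ^ e \<in> homog X (d * e)"
  by (induction e) (auto simp: one_in_homog intro: homog_mult)

text \<open>Restrict to linear forms with coefficients \<open>1, t, ..., t^n\<close>. Vanishing at a
  given point is then a nonzero polynomial equation for \<open>t\<close>, and an infinite field has
  a value that avoids the roots of finitely many of these.\<close>

lemma exists_nonvanishing_linear_form:
  fixes Z :: "(nat, 'k::alg_closed_field) mpoly set set"
  assumes "finite Z" "Z \<subseteq> proj_space n 1"
  obtains l where "l \<in> homog {..n} 1" "\<And>P. P \<in> Z \<Longrightarrow> nonvanishing_at l P"
proof -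
  have "\<forall>P\<in>Z. \<exists>L. P = line L \<and> (\<exists>i\<le>n. lin_coord L i \<noteq> 0)"
    using assms(2) by (metis proj_space_1E subsetD)
  then obtain L where L: "\<And>P. P \<in> Z \<Longrightarrow> P = line (L P) \<and> (\<exists>i\<le>n. lin_coord (L P) i \<noteq> 0)" by (metis bchoice)
  define q where "q = (\<lambda>P. \<Sum>i\<le>n. monom (lin_coord (L P) i) i)"
  have "finite {x. poly (q P) x = 0}" if P: "P \<in> Z" for P
  proof (rule poly_roots_finite)
    obtain i where i: "i \<le> n" "lin_coord (L P) i \<noteq> 0" using L[OF P] by blast
    then have "coeff (q P) i \<noteq> 0" by (simp add: q_def coeff_sum)
    then show "q P \<noteq> 0" by auto
  qed
  then have "finite (\<Union>P\<in>Z. {x. poly (q P) x = 0})" using assms(1) by blast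
  then obtain t where t: "t \<notin> (\<Union>P\<in>Z. {x. poly (q P) x = 0})"
    using infinite_alg_closed_field ex_new_if_finite by blast
  define l :: "(nat, 'k) mpoly" where "l = (\<Sum>i\<le>n. single (single i 1) (t ^ i))"
  have l: "l \<in> homog {..n} 1" unfolding l_def
    by (intro mp.subspace_sum subspace_homog single_in_homog single_in_exps)
  show thesis
  proof (rule that[OF l])
    fix P assume P: "P \<in> Z"
    have "evalp (lin_coord (L P)) l = poly (q P) t"
      by (simp add: l_def q_def evalp_sum poly_sum poly_monom mult.commute)
    then have "evalp (lin_coord (L P)) l \<noteq> 0" using t P by simp
    then show "nonvanishing_at l P" using nonvanishing_at_line[OF l, of "L P"] L[OF P] by simp
  qed
qed

subsection \<open>Forms vanishing on a subscheme\<close>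

interpretation fr: vspace "fscale :: 'k::field \<Rightarrow> (nat, 'k) mpoly fract \<Rightarrow> _"
proof
  fix a b :: 'k and x y :: "(nat, 'k) mpoly fract"
  show "fscale a (x + y) = fscale a x + fscale a y" by (simp add: fscale_def distrib_left)
  show "fscale (a + b) x = fscale a x + fscale b x"
  proof -
    have "Fract (single 0 (a + b)) 1
        = Fract (single 0 a) 1 + Fract (single 0 b) (1 :: (nat, 'k) mpoly)"
      by (simp add: single_add)
    then show ?thesis unfolding fscale_def by (metis distrib_right)
  qed
  show "fscale a (fscale b x) = fscale (a * b) x"
    by (simp add: fscale_def mult_single flip: mult.assoc)
  show "fscale 1 x = x" by (simp add: fscale_def flip: One_fract_def)
qed

lemma linear_Fract:
  fixes H :: "(nat, 'k::field) mpoly"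
  assumes "H \<noteq> 0"
  shows "Vector_Spaces.linear pscale fscale (\<lambda>Q. Fract Q H)"
proof (rule linear_mpI)
  show "Fract (p + q) H = Fract p H + Fract q H" for p q
    using assms by (simp add: eq_fract algebra_simps)
  show "Fract (pscale c p) H = fscale c (Fract p H)" for c p
    by (simp add: fscale_def pscale_conv_mult)
qed (rule fr.vector_space_axioms)

lemma ideal_stalk_iff: "x \<in> ideal_stalk n I P \<longleftrightarrow> (\<exists>G H e. x = Fract G H \<and> G \<in> I \<and> G \<in> homog {..n} e
    \<and> H \<in> homog {..n} e \<and> nonvanishing_at H P)"
  unfolding ideal_stalk_def by blast

lemma local_ring_iff: "x \<in> local_ring n P \<longleftrightarrow> (\<exists>G H e. x = Fract G H \<and> G \<in> homog {..n} e
    \<and> H \<in> homog {..n} e \<and> nonvanishing_at H P)"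
  unfolding local_ring_def by blast

lemma ideal_stalk_mult:
  assumes id: "ideal I (poly_ring {..n})" and y: "y \<in> local_ring n P" and x: "x \<in> ideal_stalk n I P"
  shows "y * x \<in> ideal_stalk n I P"
proof -
  obtain A B a where y: "y = Fract A B" "A \<in> homog {..n} a" "B \<in> homog {..n} a" "nonvanishing_at B P"
    using y by (auto simp: local_ring_iff)
  obtain G H e where x: "x = Fract G H" "G \<in> I" "G \<in> homog {..n} e" "H \<in> homog {..n} e" "nonvanishing_at H P"
    using x by (auto simp: ideal_stalk_iff)
  have "A * G \<in> I" using ideal_poly_ringD(4)[OF id] y(2) homog_subset_polys x(2) by blast
  then show ?thesis
    unfolding ideal_stalk_iff using x y
    by (intro exI[of _ "A * G"] exI[of _ "B * H"] exI[of _ "a + e"]) (auto intro: homog_mult nonvanishing_at_mult)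
qed

lemma subspace_ideal_stalk:
  fixes I :: "(nat, 'k::field) mpoly set"
  assumes id: "ideal I (poly_ring {..n})" and P: "P \<in> proj_space n 1"
  shows "fr.subspace (ideal_stalk n I P)"
proof (rule fr.subspaceI)
  show "0 \<in> ideal_stalk n I P"
    unfolding ideal_stalk_iff
    by (intro exI[of _ 0] exI[of _ 1])
      (auto simp: Zero_fract_def ideal_poly_ringD(2)[OF id] one_in_homog mp.subspace_0[OF subspace_homog])
  fix x y :: "(nat, 'k) mpoly fract" and c :: 'k
  assume x: "x \<in> ideal_stalk n I P"
  then obtain G H e where x': "x = Fract G H" "G \<in> I" "G \<in> homog {..n} e" "H \<in> homog {..n} e" "nonvanishing_at H P"
    by (auto simp: ideal_stalk_iff)
  show "x + y \<in> ideal_stalk n I P" if y: "y \<in> ideal_stalk n I P"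
  proof -
    obtain A B a where y': "y = Fract A B" "A \<in> I" "A \<in> homog {..n} a" "B \<in> homog {..n} a" "nonvanishing_at B P"
      using y by (auto simp: ideal_stalk_iff)
    have "x + y = Fract (G * B + A * H) (H * B)"
      using nonvanishing_at_neq_0[OF P] x' y' by (simp add: add_fract)
    moreover have "B * G + H * A \<in> I"
      using x'(2,4) y'(2,4) homog_subset_polys by (blast intro: ideal_poly_ringD[OF id])
    moreover have "G * B \<in> homog {..n} (e + a)" "A * H \<in> homog {..n} (a + e)" "H * B \<in> homog {..n} (e + a)"
      using x' y' by (auto intro: homog_mult)
    ultimately show ?thesis unfolding ideal_stalk_iff
      using x' y' by (intro exI[of _ "G * B + A * H"] exI[of _ "H * B"] exI[of _ "e + a"])
        (auto simp: mult.commute add.commute intro: nonvanishing_at_mult mp.subspace_add[OF subspace_homog])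
  qed
  have "Fract (single 0 c) 1 \<in> local_ring n P"
    unfolding local_ring_iff
    by (intro exI[of _ "single 0 c"] exI[of _ 1] exI[of _ 0])
      (auto simp: one_in_homog intro!: single_in_homog simp: exps_def)
  then show "fscale c x \<in> ideal_stalk n I P" unfolding fscale_def by (rule ideal_stalk_mult[OF id _ x])
qed

text \<open>The degree \<open>e\<close> part of the saturated ideal of the scheme.\<close>

definition vanishing_forms :: "nat \<Rightarrow> (nat, 'k::field) mpoly set \<Rightarrow> nat \<Rightarrow> (nat, 'k) mpoly set" where
  "vanishing_forms n I e = {Q \<in> homog {..n} e. vanishes_on_scheme n e I Q}"

lemma scheme_points_subset: "scheme_points n I \<subseteq> proj_space n 1"
  by (auto simp: scheme_points_def)

text \<open>Changing the trivialization from \<open>l\<close> to \<open>H\<close> multiplies the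
  fraction by \<open>l / H\<close>, an element of the local ring, and the stalk absorbs it. So one
  \<open>l\<close> can be used at all points and all forms at once.\<close>

lemma vanishing_forms_alt:
  fixes I :: "(nat, 'k::field) mpoly set"
  assumes id: "ideal I (poly_ring {..n})" and l: "l \<in> homog {..n} e"
    and nv: "\<And>P. P \<in> scheme_points n I \<Longrightarrow> nonvanishing_at l P"
  shows "vanishing_forms n I e = {Q \<in> homog {..n} e. \<forall>P\<in>scheme_points n I. Fract Q l \<in> ideal_stalk n I P}"
proof (intro equalityI subsetI)
  fix Q assume "Q \<in> {Q \<in> homog {..n} e. \<forall>P\<in>scheme_points n I. Fract Q l \<in> ideal_stalk n I P}"
  then have Q: "Q \<in> homog {..n} e" and st: "\<And>P. P \<in> scheme_points n I \<Longrightarrow> Fract Q l \<in> ideal_stalk n I P" by auto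
  have "Fract Q H \<in> ideal_stalk n I P"
    if P: "P \<in> scheme_points n I" and H: "H \<in> homog {..n} e" "nonvanishing_at H P" for P H
  proof -
    have "l \<noteq> 0" "H \<noteq> 0" using nonvanishing_at_neq_0 scheme_points_subset P H nv by blast+
    then have eq: "Fract Q H = Fract l H * Fract Q l" by (simp add: eq_fract mult_ac)
    have "Fract l H \<in> local_ring n P" using l H by (auto simp: local_ring_iff)
    then show ?thesis unfolding eq by (rule ideal_stalk_mult[OF id _ st[OF P]])
  qed
  then show "Q \<in> vanishing_forms n I e" using Q by (auto simp: vanishing_forms_def vanishes_on_scheme_def)
qed (use l nv in \<open>auto simp: vanishing_forms_def vanishes_on_scheme_def\<close>)

context vspace
begin

lemma quot_dim_INT_le:
  assumes V: "subspace V" "fin_dim V" and Z: "finite Z" and W: "\<And>P. P \<in> Z \<Longrightarrow> subspace {x \<in> V. x \<in> W P}"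
  shows "subspace {x \<in> V. \<forall>P\<in>Z. x \<in> W P} \<and>
    quot_dim scale V {x \<in> V. \<forall>P\<in>Z. x \<in> W P} \<le> (\<Sum>P\<in>Z. quot_dim scale V {x \<in> V. x \<in> W P})"
  using Z W
proof (induction Z rule: finite_induct)
  case empty
  have "quot_dim scale V V = 0" using quot_dim_dim[OF V V(1)] by (simp add: zero_enat_def)
  then show ?case using V by simp
next
  case (insert P Z)
  let ?U = "{x \<in> V. \<forall>P\<in>Z. x \<in> W P}" and ?U' = "{x \<in> V. \<forall>P\<in>insert P Z. x \<in> W P}" and ?W = "{x \<in> V. x \<in> W P}"
  have IH: "subspace ?U" "quot_dim scale V ?U \<le> (\<Sum>P\<in>Z. quot_dim scale V {x \<in> V. x \<in> W P})"
    using insert by auto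
  have W: "subspace ?W" using insert.prems by auto
  have eq: "?U' = ?U \<inter> ?W" by auto
  have U': "subspace ?U'" unfolding eq by (rule subspace_inter[OF IH(1) W])
  have idl: "Vector_Spaces.linear scale scale (\<lambda>x. x)" by (rule linear_id[unfolded id_def])
  have fdU: "fin_dim ?U" by (rule fin_dim_subset[OF V(2)]) auto
  have "quot_dim scale ?U ?U' \<le> quot_dim scale V ?W"
    by (rule quot_dim_le_of_linear[OF idl IH(1)]) (use subspace_0[OF W] in auto)
  moreover have "quot_dim scale V ?U' = quot_dim scale V ?U + quot_dim scale ?U ?U'"
  proof -
    have "dim ?U' \<le> dim ?U" by (rule dim_mono_fin[OF fdU]) auto
    moreover have "dim ?U \<le> dim V" by (rule dim_mono_fin[OF V(2)]) auto
    moreover have "quot_dim scale V ?U' = enat (dim V - dim ?U')" by (rule quot_dim_dim[OF V U']) auto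
    moreover have "quot_dim scale V ?U = enat (dim V - dim ?U)" by (rule quot_dim_dim[OF V IH(1)]) auto
    moreover have "quot_dim scale ?U ?U' = enat (dim ?U - dim ?U')" by (rule quot_dim_dim[OF IH(1) fdU U']) auto
    ultimately show ?thesis by simp
  qed
  ultimately have "quot_dim scale V ?U' \<le> (\<Sum>P\<in>Z. quot_dim scale V {x \<in> V. x \<in> W P}) + quot_dim scale V ?W"
    using IH(2) by (simp add: add_mono)
  then show ?case using U' insert.hyps by (simp add: add.commute)
qed

end

locale zero_dim_scheme =
  fixes n s :: nat and I :: "(nat, 'k::alg_closed_field) mpoly set"
  assumes zero_dim: "zero_dim_subscheme n I s"
begin

lemma ideal_I: "ideal I (poly_ring {..n})"
  using zero_dim by (auto simp: zero_dim_subscheme_def homogeneous_ideal_def)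

lemma finite_points: "finite (scheme_points n I)"
  using zero_dim by (auto simp: zero_dim_subscheme_def)

lemma nonvanishing_form:
  obtains l where "l \<in> homog {..n} 1" "\<And>P. P \<in> scheme_points n I \<Longrightarrow> nonvanishing_at l P"
  using exists_nonvanishing_linear_form[OF finite_points scheme_points_subset] by blast

text \<open>Dividing by a power of \<open>l\<close> turns forms into germs at every point. Forms
  modulo vanishing forms thus embed into the product of the local rings of the scheme, whose total
  dimension is \<open>s\<close>.\<close>

lemma vanishing_forms_dim:
  shows "mp.subspace (vanishing_forms n I e)"
    and "mp.dim (homog {..n} e :: (nat, 'k) mpoly set) \<le> s + mp.dim (vanishing_forms n I e)"
proof -
  obtain l where l: "l \<in> homog {..n} 1" "\<And>P. P \<in> scheme_points n I \<Longrightarrow> nonvanishing_at l P"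
    using nonvanishing_form by blast
  let ?l = "l ^ e" and ?Z = "scheme_points n I" and ?T = "homog {..n} e :: (nat, 'k) mpoly set"
  let ?W = "\<lambda>P. {Q. Fract Q ?l \<in> ideal_stalk n I P}"
  have le: "?l \<in> ?T" using power_in_homog[OF l(1), of e] by simp
  have nv: "nonvanishing_at ?l P" if "P \<in> ?Z" for P using l(2)[OF that] by (rule nonvanishing_at_power)
  have V: "vanishing_forms n I e = {Q \<in> ?T. \<forall>P\<in>?Z. Q \<in> ?W P}"
    using vanishing_forms_alt[OF ideal_I le nv] by simp
  have W: "mp.subspace {Q \<in> ?T. Q \<in> ?W P}"
    and qW: "quot_dim pscale ?T {Q \<in> ?T. Q \<in> ?W P} \<le> quot_dim fscale (local_ring n P) (ideal_stalk n I P)"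
    if P: "P \<in> ?Z" for P
  proof -
    have PP: "P \<in> proj_space n 1" using P scheme_points_subset by blast
    have "?l \<noteq> 0" by (rule nonvanishing_at_neq_0[OF PP nv[OF P]])
    then have lin: "Vector_Spaces.linear pscale fscale (\<lambda>Q. Fract Q ?l)" by (rule linear_Fract)
    interpret lin: Vector_Spaces.linear pscale fscale "\<lambda>Q. Fract Q ?l" by (rule lin)
    note st = subspace_ideal_stalk[OF ideal_I PP]
    have "mp.subspace (?W P)" using lin.subspace_vimage[OF st] by (simp add: vimage_def)
    then have "mp.subspace (?T \<inter> ?W P)" by (intro mp.subspace_inter subspace_homog)
    then show "mp.subspace {Q \<in> ?T. Q \<in> ?W P}" by (simp add: Int_def)
    show "quot_dim pscale ?T {Q \<in> ?T. Q \<in> ?W P} \<le> quot_dim fscale (local_ring n P) (ideal_stalk n I P)"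
      by (rule quot_dim_le_of_linear[OF lin subspace_homog])
        (use le nv[OF P] fr.subspace_0[OF st] in \<open>auto simp: local_ring_iff\<close>)
  qed
  have fd: "mp.fin_dim ?T" by (rule fin_dim_T[OF order.refl])
  note main = mp.quot_dim_INT_le[OF subspace_homog fd finite_points, of ?W, OF W]
  show sub: "mp.subspace (vanishing_forms n I e)" unfolding V using main by blast
  have "quot_dim pscale ?T (vanishing_forms n I e) \<le> (\<Sum>P\<in>?Z. quot_dim pscale ?T {Q \<in> ?T. Q \<in> ?W P})"
    unfolding V using main by blast
  also have "\<dots> \<le> (\<Sum>P\<in>?Z. quot_dim fscale (local_ring n P) (ideal_stalk n I P))"
    by (rule sum_mono) (rule qW)
  also have "\<dots> = enat s" using zero_dim by (simp add: zero_dim_subscheme_def)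
  finally have "enat (mp.dim ?T - mp.dim (vanishing_forms n I e)) \<le> enat s"
    using mp.quot_dim_dim[OF subspace_homog fd sub] by (auto simp: vanishing_forms_def)
  then show "mp.dim ?T \<le> s + mp.dim (vanishing_forms n I e)" by simp
qed

lemma vanishing_forms_mult:
  assumes q: "q \<in> homog {..n} k" and Q: "Q \<in> vanishing_forms n I e"
  shows "q * Q \<in> vanishing_forms n I (k + e)"
proof -
  obtain l where l: "l \<in> homog {..n} 1" "\<And>P. P \<in> scheme_points n I \<Longrightarrow> nonvanishing_at l P"
    using nonvanishing_form by blast
  have le: "l ^ e \<in> homog {..n} e" for e using power_in_homog[OF l(1), of e] by simp
  note alt = vanishing_forms_alt[OF ideal_I le nonvanishing_at_power[OF l(2)]]
  have "Fract (q * Q) (l ^ (k + e)) \<in> ideal_stalk n I P" if P: "P \<in> scheme_points n I" for P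
  proof -
    have "Fract q (l ^ k) \<in> local_ring n P"
      using q le[of k] nonvanishing_at_power[OF l(2)[OF P]] by (auto simp: local_ring_iff)
    moreover have "Fract Q (l ^ e) \<in> ideal_stalk n I P" using Q alt P by blast
    ultimately have "Fract q (l ^ k) * Fract Q (l ^ e) \<in> ideal_stalk n I P" by (rule ideal_stalk_mult[OF ideal_I])
    then show ?thesis by (simp add: power_add)
  qed
  then show ?thesis using alt homog_mult[OF q] Q by (auto simp: vanishing_forms_def)
qed

text \<open>Multiplication by a linear form that vanishes at no point of the scheme is injective
  modulo vanishing forms, so the Hilbert function of the scheme does not decrease.\<close>

lemma codim_vanishing_forms_mono:
  "mp.dim (homog {..n} e :: (nat, 'k) mpoly set) + mp.dim (vanishing_forms n I (Suc e))
    \<le> mp.dim (homog {..n} (Suc e) :: (nat, 'k) mpoly set) + mp.dim (vanishing_forms n I e)"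
proof -
  obtain l where l: "l \<in> homog {..n} 1" "\<And>P. P \<in> scheme_points n I \<Longrightarrow> nonvanishing_at l P"
    using nonvanishing_form by blast
  have le: "l ^ e \<in> homog {..n} e" for e using power_in_homog[OF l(1), of e] by simp
  note alt = vanishing_forms_alt[OF ideal_I le nonvanishing_at_power[OF l(2)]]
  have fd: "mp.fin_dim (homog {..n} k :: (nat, 'k) mpoly set)" for k by (rule fin_dim_T[OF order.refl])
  have sub: "vanishing_forms n I k \<subseteq> homog {..n} k" for k by (auto simp: vanishing_forms_def)
  have "quot_dim pscale (homog {..n} e) (vanishing_forms n I e)
      \<le> quot_dim pscale (homog {..n} (Suc e)) (vanishing_forms n I (Suc e))"
  proof (rule quot_dim_le_of_linear[OF linear_mult[of l] subspace_homog])
    fix Q :: "(nat, 'k) mpoly" assume Q: "Q \<in> homog {..n} e"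
    show "l * Q \<in> homog {..n} (Suc e)" using homog_mult[OF l(1) Q] by simp
    assume lQ: "l * Q \<in> vanishing_forms n I (Suc e)"
    have "Fract Q (l ^ e) \<in> ideal_stalk n I P" if P: "P \<in> scheme_points n I" for P
    proof -
      have "l \<noteq> 0" using nonvanishing_at_neq_0 scheme_points_subset P l(2) by blast
      then have "Fract Q (l ^ e) = Fract (l * Q) (l ^ Suc e)" by (simp add: eq_fract mult_ac)
      then show ?thesis using lQ alt[of "Suc e"] P by auto
    qed
    then show "Q \<in> vanishing_forms n I e" using alt[of e] Q by blast
  qed (rule mp.subspace_0[OF vanishing_forms_dim(1)])
  then have diff: "mp.dim (homog {..n} e :: (nat, 'k) mpoly set) - mp.dim (vanishing_forms n I e)
    \<le> mp.dim (homog {..n} (Suc e) :: (nat, 'k) mpoly set) - mp.dim (vanishing_forms n I (Suc e))"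
    using mp.quot_dim_dim[OF subspace_homog fd vanishing_forms_dim(1) sub] by simp
  have "mp.dim (vanishing_forms n I k) \<le> mp.dim (homog {..n} k :: (nat, 'k) mpoly set)" for k
    by (rule dim_T_mono[OF sub order.refl])
  from this[of e] this[of "Suc e"] show ?thesis
    using diff by linarith
qed

text \<open>Apolarity. In degree \<open>d\<close> it is the definition of the span, with the
  coefficients of \<open>Q\<close> as hyperplane. For smaller \<open>e\<close> all multiples of
  \<open>Q\<close> by monomials of degree \<open>d - e\<close> vanish on the scheme too, and they
  read off every coefficient of the contraction.\<close>

lemma contract_vanishing_forms:
  assumes F: "F \<in> veronese_span n d I" and Q: "Q \<in> vanishing_forms n I e" and e: "e \<le> d"
  shows "contract Q F = 0"
proof -
  have FT: "F \<in> homog {..n} d" using F by (simp add: veronese_span_def)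
  have pair: "lookup (contract Q F) 0 = 0" if Q: "Q \<in> vanishing_forms n I d" for Q
  proof -
    let ?E = "exps {..n} d"
    define l :: "(nat \<Rightarrow>\<^sub>0 nat, 'k) mpoly" where "l = (\<Sum>v\<in>?E. single (single v 1) (lookup Q v))"
    have l: "l \<in> homog ?E 1" unfolding l_def
      by (intro mp.subspace_sum subspace_homog single_in_homog single_in_exps)
    have ev: "evalp a l = (\<Sum>v\<in>?E. lookup Q v * a v)" for a by (simp add: l_def evalp_sum)
    have QT: "Q \<in> homog {..n} d" using Q by (simp add: vanishing_forms_def)
    then have kQ: "keys Q \<subseteq> ?E" by (simp add: homog_def)
    have "veronese_pullback n d l Q"
      unfolding veronese_pullback_def
      using QT kQ by (simp add: ev evalp_superset[of ?E] lookup_dp_power)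
    then have "evalp (lookup F) l = 0"
      using F l Q unfolding veronese_span_def vanishing_forms_def by blast
    then show ?thesis by (simp add: ev lookup_contract_superset[OF _ kQ])
  qed
  show ?thesis
  proof (rule poly_mapping_eqI, rule ccontr)
    fix w assume nz: "lookup (contract Q F) w \<noteq> lookup 0 w"
    have QT: "Q \<in> homog {..n} e" using Q by (simp add: vanishing_forms_def)
    obtain u where u: "u \<in> exps {..n} e" "lookup F (w + u) \<noteq> 0"
      using contract_degree[OF QT] nz by (metis lookup_zero)
    from u(2) have "w + u \<in> exps {..n} d" by (rule homogD[OF FT])
    then have w: "w \<in> exps {..n} (d - e)" using u(1) by (auto simp: exps_def keys_add_nat)
    have "single w 1 * Q \<in> vanishing_forms n I ((d - e) + e)"
      by (rule vanishing_forms_mult[OF single_in_homog[OF w] Q])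
    then have "lookup (contract (single w 1 * Q) F) 0 = 0" using e by (intro pair) simp
    then show False using nz by (simp add: contract_mult)
  qed
qed

end

subsection \<open>The scheme of the homogenized annihilator\<close>

lemma lin_coord_sum:
  "finite X \<Longrightarrow> i \<in> X \<Longrightarrow> lin_coord (\<Sum>j\<in>X. single (single j 1) (a j)) i = a i"
proof -
  have inj: "single j (Suc 0) = single k (Suc 0) \<longleftrightarrow> j = k" for j k :: 'a
    by (metis lookup_single_eq lookup_single_not_eq nat.distinct(1))
  assume "finite X" "i \<in> X"
  then show ?thesis by (simp add: lin_coord_def lookup_sum lookup_single when_def inj)
qed

text \<open>Evaluation at \<open>a\<^sub>i = t^(w^i)\<close>, where \<open>w\<close> separates the exponent vectors of the form.\<close>
lemma form_eq_0_if_evalp_eq_0: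
  fixes D :: "(nat, 'k::alg_closed_field) mpoly"
  assumes D: "D \<in> homog {..n} d" and 0: "\<And>L. L \<in> homog {..n} 1 \<Longrightarrow> evalp (lin_coord L) D = 0"
  shows "D = 0"
proof (rule ccontr)
  assume "D \<noteq> 0"
  then obtain u0 where u0: "lookup D u0 \<noteq> 0" using tdeg_attained by metis
  let ?K = "keys D"
  \<comment> \<open>Two exponent vectors collide under the substitution only if \<open>w\<close> is
    a root of their difference polynomial. Only finitely many \<open>w\<close> are excluded, so
    distinct monomials become distinct powers of \<open>t\<close>.\<close>
  define p :: "(nat \<Rightarrow>\<^sub>0 nat) \<times> (nat \<Rightarrow>\<^sub>0 nat) \<Rightarrow> int poly" where
    "p = (\<lambda>(u, v). \<Sum>i\<le>n. monom (int (lookup u i) - int (lookup v i)) i)"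
  let ?Pairs = "{(u, v) \<in> ?K \<times> ?K. u \<noteq> v}"
  have kX: "keys u \<subseteq> {..n}" if "u \<in> ?K" for u using D that by (auto simp: homog_def exps_def)
  have "finite {x. poly (p uv) x = 0}" if uv: "uv \<in> ?Pairs" for uv
  proof (rule poly_roots_finite)
    obtain u v where uv': "uv = (u, v)" "u \<in> ?K" "v \<in> ?K" "u \<noteq> v" using uv by auto
    then obtain i where i: "lookup u i \<noteq> lookup v i" by (metis poly_mapping_eqI)
    have "i \<le> n" using i kX[OF uv'(2)] kX[OF uv'(3)] by (metis atMost_iff in_keys_iff subsetD)
    then have "coeff (p uv) i \<noteq> 0" using i by (simp add: p_def uv'(1) coeff_sum)
    then show "p uv \<noteq> 0" by auto
  qed
  moreover have "finite ?Pairs" by (rule finite_subset[of _ "?K \<times> ?K"]) auto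
  ultimately have "finite (\<Union>uv\<in>?Pairs. {x. poly (p uv) x = 0})" by blast
  then have "finite (int -` (\<Union>uv\<in>?Pairs. {x. poly (p uv) x = 0}))" by (rule finite_vimageI) simp
  then obtain w :: nat where w: "w \<notin> int -` (\<Union>uv\<in>?Pairs. {x. poly (p uv) x = 0})"
    using ex_new_if_finite infinite_UNIV_nat by blast
  define W where "W = (\<lambda>u. \<Sum>i\<le>n. w ^ i * lookup u i)"
  have W: "W u \<noteq> W v" if "u \<in> ?K" "v \<in> ?K" "u \<noteq> v" for u v
  proof
    assume "W u = W v"
    then have "int (W u) - int (W v) = 0" by simp
    then have "poly (p (u, v)) (int w) = 0"
      by (simp add: W_def p_def poly_sum poly_monom algebra_simps sum_subtractf)
    then show False using w that by blast
  qed
  define q where "q = (\<Sum>u\<in>?K. monom (lookup D u) (W u))"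
  have "coeff q (W u0) = (\<Sum>u\<in>?K. if u = u0 then lookup D u else 0)"
    unfolding q_def coeff_sum using u0 W by (intro sum.cong) (auto simp: in_keys_iff)
  then have "q \<noteq> 0" using u0 by (auto simp: in_keys_iff)
  then have "finite {x. poly q x = 0}" by (rule poly_roots_finite)
  then obtain t where t: "poly q t \<noteq> 0" using infinite_alg_closed_field ex_new_if_finite by blast
  define L where "L = (\<Sum>i\<le>n. single (single i (1::nat)) (t ^ (w ^ i)))"
  have L: "L \<in> homog {..n} 1" unfolding L_def
    by (intro mp.subspace_sum subspace_homog single_in_homog single_in_exps)
  have "mon (lin_coord L) u = t ^ W u" if "u \<in> ?K" for u
  proof -
    have "mon (lin_coord L) u = (\<Prod>i\<le>n. (t ^ (w ^ i)) ^ lookup u i)"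
      unfolding mon_superset[OF finite_atMost kX[OF that]] L_def
      by (intro prod.cong) (simp_all add: lin_coord_sum del: One_nat_def single_one)
    then show ?thesis by (simp add: W_def power_sum power_mult)
  qed
  then have "evalp (lin_coord L) D = poly q t"
    by (simp add: evalp_superset[of ?K] q_def poly_sum poly_monom)
  then show False using 0[OF L] t by simp
qed

lemma local_ring_common_denominator:
  assumes "finite B" "B \<subseteq> local_ring n P" "P \<in> proj_space n 1"
  shows "\<exists>H e. H \<in> homog {..n} e \<and> nonvanishing_at H P \<and> B \<subseteq> (\<lambda>Q. Fract Q H) ` homog {..n} e"
  using assms(1,2)
proof (induction B rule: finite_induct)
  case empty
  show ?case by (intro exI[of _ 1] exI[of _ 0]) (simp add: one_in_homog)
next
  case (insert b B)
  then obtain H e where H: "H \<in> homog {..n} e" "nonvanishing_at H P" "B \<subseteq> (\<lambda>Q. Fract Q H) ` homog {..n} e"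
    by auto
  obtain G H' e' where b: "b = Fract G H'" "G \<in> homog {..n} e'" "H' \<in> homog {..n} e'" "nonvanishing_at H' P"
    using insert.prems by (auto simp: local_ring_iff)
  have nz: "H \<noteq> 0" "H' \<noteq> 0" using nonvanishing_at_neq_0[OF assms(3)] H b by auto
  have "insert b B \<subseteq> (\<lambda>Q. Fract Q (H * H')) ` homog {..n} (e + e')"
  proof
    fix x assume "x \<in> insert b B"
    then consider "x = b" | Q where "Q \<in> homog {..n} e" "x = Fract Q H" using H(3) by auto
    then show "x \<in> (\<lambda>Q. Fract Q (H * H')) ` homog {..n} (e + e')"
    proof cases
      case 1
      then show ?thesis using b nz homog_mult[OF H(1) b(2)]
        by (intro image_eqI[of _ _ "H * G"]) (auto simp: eq_fract mult_ac)
    next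
      case 2
      then show ?thesis using nz homog_mult[OF 2(1) b(3)]
        by (intro image_eqI[of _ _ "Q * H'"]) (auto simp: eq_fract mult_ac)
    qed
  qed
  then show ?case using homog_mult[OF H(1) b(3)] nonvanishing_at_mult[OF H(2) b(4)] by blast
qed

lemma line_pscale: "c \<noteq> 0 \<Longrightarrow> line (pscale c L) = line (L :: ('i, 'k::field) mpoly)"
proof (intro equalityI subsetI)
  fix x assume c: "c \<noteq> 0"
  show "x \<in> line L" if "x \<in> line (pscale c L)" using that by (auto simp: line_def)
  assume "x \<in> line L"
  then obtain k where "x = pscale k L" by (auto simp: line_def)
  then have "x = pscale (k / c) (pscale c L)" using c by simp
  then show "x \<in> line (pscale c L)" unfolding line_def by blast
qed

lemma lin_coord_var0: "lin_coord (var 0 :: (nat, 'k::field) mpoly) i = (if i = 0 then 1 else 0)"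
proof -
  have "single 0 (Suc 0) = single i (Suc 0) \<longleftrightarrow> i = 0"
    by (metis lookup_single_eq lookup_single_not_eq nat.distinct(1))
  then show ?thesis by (auto simp: lin_coord_def lookup_single when_def)
qed

lemma mon_axis:
  fixes a :: "nat \<Rightarrow> 'k::field"
  assumes "\<And>i. i \<noteq> 0 \<Longrightarrow> a i = 0"
  shows "mon a u = (if u = single (0::nat) (mdeg u) then a 0 ^ mdeg u else 0)"
proof (cases "u = single 0 (mdeg u)")
  case True
  then show ?thesis by (metis mon_single)
next
  case False
  have "del u \<noteq> 0" using del_split[of u] mdeg_split[of u] False by auto
  then obtain i where "i \<in> keys (del u)" by (metis all_not_in_conv keys_eq_empty)
  then have "i \<in> keys u" "i \<noteq> 0" by (auto simp: keys_del)
  then have "mon a u = 0" unfolding mon_def using assms[of i]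
    by (intro prod_zero) (auto simp: in_keys_iff zero_power intro!: bexI[of _ i])
  then show ?thesis using False by simp
qed

lemma evalp_var0:
  fixes H :: "(nat, 'k::field) mpoly"
  assumes "H \<in> homog {..n} e"
  shows "evalp (lin_coord (var 0)) H = lookup H (single 0 e)"
proof -
  have "lookup H u * mon (lin_coord (var 0)) u
      = (if u = single 0 e then lookup H u else 0)" for u
    using homogD[OF assms, of u] mon_axis[of "lin_coord (var 0)" u]
    by (cases "lookup H u = 0") (auto simp: lin_coord_var0 exps_def simp del: One_nat_def single_one)
  then show ?thesis by (simp add: evalp_superset[of "keys H"] in_keys_iff)
qed

lemma var_nz: "(var i :: ('i, 'k::field) mpoly) \<noteq> 0"
  by (metis lookup_single_eq lookup_zero zero_neq_one)

lemma nonvanishing_at_var0D: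
  fixes H :: "(nat, 'k::field) mpoly"
  assumes "H \<in> homog {..n} e" "nonvanishing_at H (line (var 0))"
  shows "lookup H (single 0 e) \<noteq> 0"
proof -
  have "(var 0 :: (nat, 'k) mpoly) \<in> line (var 0) - {0}"
    by (simp add: self_in_line var_nz del: One_nat_def single_one)
  then show ?thesis using assms evalp_var0[OF assms(1)] unfolding nonvanishing_at_def by metis
qed

context
  fixes n :: nat and g :: "(nat, 'k::alg_closed_field) mpoly"
  assumes g: "g \<in> polys {1..n}" "g \<noteq> 0"
begin

text \<open>A pure power of the homogenizing variable in \<open>G\<close> would give an operator
  with nonzero constant term, which cannot kill \<open>g\<close>.\<close>

lemma Ann_hom_axis_coeff:
  assumes "G \<in> Ann_hom n g"
  shows "lookup G (single 0 k) = 0"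
proof -
  have G: "homog_comp k G \<in> homog {..n} k" using assms by (intro homog_comp_in_homog) (simp add: Ann_hom_def)
  have "act g (homog_comp k G) = 0"
    using Ann_hom_homog_iff[OF g(1) G] Ann_hom_homog_comp[OF g(1) assms] by simp
  then have "lookup (deh (homog_comp k G)) 0 = 0"
    unfolding act_def by (rule contract_eq_0_const[OF _ g(2)])
  then show ?thesis by (simp add: lookup_deh_0[OF G] lookup_homog_comp)
qed

text \<open>The power with exponent \<open>Suc (tdeg g)\<close> of each other variable kills
  \<open>g\<close>, hence lies in the ideal and forces that coordinate to vanish. The remaining
  point is in the scheme by \<open>Ann_hom_axis_coeff\<close>.\<close>

lemma scheme_points_Ann_hom: "scheme_points n (Ann_hom n g) = {line (var 0)}"
proof (intro equalityI subsetI)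
  fix P assume P: "P \<in> scheme_points n (Ann_hom n g)"
  then have "P \<in> proj_space n 1" using scheme_points_subset by blast
  then obtain L i0 where L: "P = line L" "L \<in> homog {..n} 1" "L \<noteq> 0" "lin_coord L i0 \<noteq> 0" by (rule proj_space_1E)
  have LP: "L \<in> P - {0}" using L self_in_line by blast
  have coord: "lin_coord L i = 0" if i: "i \<in> {1..n}" for i
  proof -
    let ?m = "Suc (tdeg g)"
    let ?q = "single (single i ?m) (1::'k)"
    have q: "?q \<in> homog {..n} ?m" using i by (intro single_in_homog single_in_exps) simp
    have "act g ?q = 0"
    proof (rule poly_mapping_eqI)
      fix w
      have "lookup g (w + single i ?m) = 0"
        using mdeg_le_tdeg[of g "w + single i ?m"] by fastforce
      then show "lookup (act g ?q) w = lookup 0 w"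
        using i by (simp add: act_def lookup_single)
    qed
    then have "?q \<in> Ann_hom n g" using Ann_hom_homog_iff[OF g(1) q] by simp
    then have "evalp (lin_coord L) ?q = 0" using P LP unfolding scheme_points_def by blast
    then show ?thesis by auto
  qed
  have "L = pscale (lin_coord L 0) (var 0)"
  proof (rule poly_mapping_eqI)
    fix u
    show "lookup L u = lookup (pscale (lin_coord L 0) (var 0)) u"
    proof (cases "u \<in> exps {..n} 1")
      case True
      then obtain i where i: "i \<le> n" "u = single i 1" unfolding exps_1 by auto
      have "lookup L u = lin_coord L i"
        "lookup (var 0) u = lin_coord (var 0 :: (nat, 'k) mpoly) i"
        by (simp_all add: lin_coord_def i(2))
      then show ?thesis using coord[of i] i(1) by (cases "i = 0") (auto simp: lin_coord_var0 simp del: One_nat_def single_one pscale_single)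
    next
      case False
      then have "u \<noteq> single 0 1" using single_in_exps[of 0 "{..n}" 1] by auto
      then show ?thesis using False homogD[OF L(2), of u] by (auto simp: lookup_single when_def)
    qed
  qed
  moreover from this have "lin_coord L 0 \<noteq> 0" using L(3) by (metis mp.scale_zero_left)
  ultimately have "line L = line (var 0)" using line_pscale by metis
  then show "P \<in> {line (var 0)}" using L(1) by simp
next
  fix P :: "(nat, 'k) mpoly set" assume "P \<in> {line (var 0)}"
  then have P: "P = line (var 0)" by simp
  have "P \<in> proj_space n 1"
    unfolding P proj_space_def by (intro CollectI exI[of _ "var 0"] conjI refl var_in_homog var_nz) simp
  moreover have "evalp (lin_coord L) G = 0" if G: "G \<in> Ann_hom n g" and L: "L \<in> P - {0}" for G L
  proof -
    obtain c where "L = pscale c (var 0)" using L by (auto simp: P line_def)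
    then have "lin_coord L i = 0" if "i \<noteq> 0" for i
      using that by (simp add: lin_coord_pscale lin_coord_var0 del: One_nat_def single_one pscale_single)
    note m = mon_axis[of "lin_coord L", OF this]
    have "lookup G u * mon (lin_coord L) u = 0" for u
      using Ann_hom_axis_coeff[OF G, of "mdeg u"] m[of u] by (metis mult_eq_0_iff)
    then show ?thesis unfolding evalp_superset[OF finite_keys order.refl] by (intro sum.neutral) simp
  qed
  ultimately show "P \<in> scheme_points n (Ann_hom n g)" by (auto simp: scheme_points_def)
qed

text \<open>Clearing denominators gives \<open>H' * Q = H * G\<close> with \<open>G\<close> in the
  ideal, so \<open>deh H'\<close> kills \<open>act g Q\<close>; its constant term is nonzero, as
  \<open>H'\<close> does not vanish at the point.\<close>

lemma act_eq_0_if_in_stalk: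
  assumes Q: "Q \<in> homog {..n} e" and H: "H \<in> homog {..n} e" "nonvanishing_at H (line (var 0))"
    and st: "Fract Q H \<in> ideal_stalk n (Ann_hom n g) (line (var 0))"
  shows "act g Q = 0"
proof (rule ccontr)
  assume nz: "act g Q \<noteq> 0"
  obtain G H' e' where G: "Fract Q H = Fract G H'" "G \<in> Ann_hom n g" "G \<in> homog {..n} e'"
    "H' \<in> homog {..n} e'" "nonvanishing_at H' (line (var 0))"
    using st unfolding ideal_stalk_iff by blast
  note H'0 = nonvanishing_at_var0D[OF G(4,5)]
  have "H \<noteq> 0" "H' \<noteq> 0" using nonvanishing_at_var0D[OF H] H'0 by auto
  then have "H' * Q = H * G" using G(1) by (simp add: eq_fract mult_ac)
  then have "contract (deh H') (act g Q) = contract (deh H) (act g G)" by (metis act_mult)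
  also have "act g G = 0" using Ann_hom_homog_iff[OF g(1) G(3)] G(2) by simp
  finally have "contract (deh H') (act g Q) = 0" by simp
  from contract_eq_0_const[OF this nz] show False using H'0 lookup_deh_0[OF G(4)] by simp
qed

text \<open>Finitely many germs share a denominator, and their numerators embed into
  \<open>S*\<close> modulo the annihilator, which bounds the length; the germ 1 makes it positive,
  as the rank ranges over positive numbers only. Forms vanishing on the scheme kill
  \<open>g\<close>, which puts \<open>hz t g\<close> into the span. Kept general in \<open>g\<close>
  and \<open>t\<close> because it also provides every nonzero form with some scheme.\<close>

lemma cactus_scheme_Ann_hom:
  assumes t: "tdeg g \<le> t"
  shows "\<exists>r'>0. enat r' \<le> quot_dim pscale (polys {1..n}) (Ann {1..n} g) \<and>
    zero_dim_subscheme n (Ann_hom n g) r' \<and> hz t g \<in> veronese_span n t (Ann_hom n g)"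
proof -
  let ?P = "line (var 0) :: (nat, 'k) mpoly set" and ?I = "Ann_hom n g"
  let ?q = "quot_dim pscale (polys {1..n}) (Ann {1..n} g)"
  let ?len = "quot_dim fscale (local_ring n ?P) (ideal_stalk n ?I ?P)"
  have PP: "?P \<in> proj_space n 1" using scheme_points_Ann_hom scheme_points_subset by blast
  have "?len \<le> ?q"
  proof (rule fr.quot_dim_leI)
    fix B assume B: "finite B" "B \<subseteq> local_ring n ?P" "fr.indep_mod (ideal_stalk n ?I ?P) B"
    obtain H e where H: "H \<in> homog {..n} e" "nonvanishing_at H ?P" "B \<subseteq> (\<lambda>Q. Fract Q H) ` homog {..n} e"
      using local_ring_common_denominator[OF B(1,2) PP] by blast
    have H0: "H \<noteq> 0" by (rule nonvanishing_at_neq_0[OF PP H(2)])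
    let ?W = "{x \<in> homog {..n} e. act g x = 0}"
    have "enat (card B) \<le> quot_dim pscale (homog {..n} e) ?W"
    proof (rule card_le_quot_dim_of_linear[OF linear_Fract[OF H0] B(1) H(3)])
      show "\<forall>b\<in>B. c b = 0" if "(\<Sum>b\<in>B. fscale (c b) b) \<in> ideal_stalk n ?I ?P" for c
        using B(3)[unfolded fr.indep_mod_def, THEN spec, THEN mp, OF that] .
      show "Fract x H \<in> ideal_stalk n ?I ?P" if "x \<in> ?W" for x
        using that H Ann_hom_homog_iff[OF g(1), of x e] by (auto simp: ideal_stalk_iff)
    qed
    also have "\<dots> \<le> ?q"
      using deh_in_polys homog_subset_polys
      by (intro quot_dim_le_of_linear[OF linear_deh subspace_homog]) (fastforce simp: Ann_def act_def polys_def)+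
    finally show "enat (card B) \<le> ?q" .
  qed
  moreover have "enat 1 \<le> ?len"
  proof -
    have "(1 :: (nat, 'k) mpoly fract) \<in> local_ring n ?P"
      unfolding local_ring_iff by (intro exI[of _ 1] exI[of _ 0]) (simp add: One_fract_def one_in_homog)
    moreover have "fr.indep_mod (ideal_stalk n ?I ?P) {1}"
      unfolding fr.indep_mod_def
    proof (intro allI impI)
      fix c :: "(nat, 'k) mpoly fract \<Rightarrow> 'k"
      assume "(\<Sum>b\<in>{1}. fscale (c b) b) \<in> ideal_stalk n ?I ?P"
      then have "Fract (single 0 (c 1)) 1 \<in> ideal_stalk n ?I ?P" by (simp add: fscale_def)
      moreover have "single 0 (c 1) \<in> homog {..n} 0" by (intro single_in_homog) (simp add: exps_def)
      ultimately have "act g (single 0 (c 1)) = 0"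
        by (intro act_eq_0_if_in_stalk[OF _ one_in_homog]) auto
      moreover have "act g (single 0 (c 1)) = pscale (c 1) g"
        by (rule poly_mapping_eqI) (simp add: act_def)
      ultimately show "\<forall>b\<in>{1}. c b = 0" using g(2) by simp
    qed
    ultimately have "enat (card {1 :: (nat, 'k) mpoly fract}) \<le> ?len" by (intro fr.quot_dim_ge) auto
    then show ?thesis by simp
  qed
  moreover have "?q = enat (mp.dim (act g ` homog {..n} (tdeg g)))" by (rule quot_dim_Ann[OF g(1) order.refl])
  ultimately obtain r' where r': "?len = enat r'" "0 < r'" "enat r' \<le> ?q"
    by (cases ?len) auto
  have "zero_dim_subscheme n ?I r'"
    by (simp add: zero_dim_subscheme_def homogeneous_Ann_hom[OF g(1)] scheme_points_Ann_hom r'(1) del: One_nat_def single_one)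
  moreover have "hz t g \<in> veronese_span n t ?I"
    unfolding veronese_span_def
  proof (intro CollectI conjI ballI allI impI)
    show "hz t g \<in> homog {..n} t" by (rule hz_in_homog[OF g(1) t])
    let ?E = "exps {..n} t"
    fix l Q assume l: "l \<in> homog ?E 1" and "veronese_pullback n t l Q \<and> vanishes_on_scheme n t ?I Q"
    then have pb: "veronese_pullback n t l Q" and van: "vanishes_on_scheme n t ?I Q" by auto
    have Q: "Q \<in> homog {..n} t" using pb by (simp add: veronese_pullback_def)
    let ?H = "single (single 0 t) (1::'k)"
    have H: "?H \<in> homog {..n} t" by (intro single_in_homog single_in_exps) simp
    have nvH: "nonvanishing_at ?H ?P"
      by (rule nonvanishing_at_line[OF H]) (simp add: lin_coord_var0 del: One_nat_def single_one)
    have "Fract Q ?H \<in> ideal_stalk n ?I ?P"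
      using van H nvH scheme_points_Ann_hom unfolding vanishes_on_scheme_def by blast
    from act_eq_0_if_in_stalk[OF Q H nvH this] have "lookup (contract Q (hz t g)) 0 = 0"
      using contract_hz[OF g(1) t Q, of 0] by simp
    define c where "c = (\<lambda>v. lookup l (single v 1))"
    have finE: "finite ?E" by simp
    have injE: "inj_on (\<lambda>v. single v (1::nat)) ?E"
      by (rule inj_onI) (metis lookup_single_eq lookup_single_not_eq zero_neq_one)
    have ev: "evalp a l = (\<Sum>v\<in>?E. c v * a v)" for a
    proof -
      have "keys l \<subseteq> (\<lambda>v. single v 1) ` ?E"
        using l unfolding homog_def exps_1 by blast
      then have "evalp a l = (\<Sum>u\<in>(\<lambda>v. single v 1) ` ?E. lookup l u * mon a u)"
        by (intro evalp_superset finite_imageI finE)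
      then show ?thesis by (simp add: sum.reindex[OF injE] c_def del: One_nat_def single_one)
    qed
    \<comment> \<open>The pullback condition prescribes only the values of \<open>Q\<close>. Over an
      infinite field they determine it, so its coefficients are those of \<open>l\<close>.\<close>
    define Q' where "Q' = (\<Sum>v\<in>?E. single v (c v))"
    have Q': "Q' \<in> homog {..n} t" unfolding Q'_def by (intro mp.subspace_sum subspace_homog single_in_homog)
    have lookQ': "lookup Q' v = c v" if "v \<in> ?E" for v
      using that by (simp add: Q'_def lookup_sum lookup_single when_def)
    have "Q - Q' = 0"
    proof (rule form_eq_0_if_evalp_eq_0)
      show "Q - Q' \<in> homog {..n} t" by (rule mp.subspace_diff[OF subspace_homog Q Q'])
      fix L :: "(nat, 'k) mpoly" assume "L \<in> homog {..n} 1"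
      then have "evalp (lin_coord L) Q = (\<Sum>v\<in>?E. c v * mon (lin_coord L) v)"
        using pb by (simp add: veronese_pullback_def ev lookup_dp_power)
      moreover have "evalp (lin_coord L) Q' = (\<Sum>v\<in>?E. c v * mon (lin_coord L) v)"
        by (simp add: Q'_def evalp_sum)
      moreover have "evalp (lin_coord L) Q = evalp (lin_coord L) (Q - Q') + evalp (lin_coord L) Q'"
        by (simp flip: evalp_add)
      ultimately show "evalp (lin_coord L) (Q - Q') = 0" by simp
    qed
    then have "Q = Q'" by simp
    have "evalp (lookup (hz t g)) l = (\<Sum>v\<in>?E. lookup Q v * lookup (hz t g) v)"
      unfolding ev \<open>Q = Q'\<close> using lookQ' by (intro sum.cong) auto
    also have "\<dots> = lookup (contract Q (hz t g)) 0"
      using Q by (subst lookup_contract_superset[OF finE]) (auto simp: homog_def)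
    finally show "evalp (lookup (hz t g)) l = 0"
      using \<open>lookup (contract Q (hz t g)) 0 = 0\<close> by simp
  qed
  ultimately show ?thesis using r' by blast
qed

end

subsection \<open>Polynomial families of forms\<close>

text \<open>Homogeneous, because the projective closure is cut out by homogeneous equations. The
  degree \<open>k\<close> has to be carried along, since sums require equal degrees.\<close>

definition hom_fun :: "nat \<Rightarrow> nat \<Rightarrow> nat \<Rightarrow> ((nat, 'k::field) mpoly \<Rightarrow> 'k) \<Rightarrow> bool" where
  "hom_fun n d k \<phi> \<longleftrightarrow> (\<exists>Q\<in>homog (exps {..n} d) k. \<forall>G. \<phi> G = evalp (lookup G) Q)"

lemma hom_fun_const: "hom_fun n d 0 (\<lambda>G. c)"
  unfolding hom_fun_def
  by (intro bexI[of _ "single 0 c"]) (auto intro!: single_in_homog simp: exps_def)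

lemma hom_fun_zero: "hom_fun n d k (\<lambda>G. 0)"
  unfolding hom_fun_def by (intro bexI[of _ 0]) (auto simp: mp.subspace_0[OF subspace_homog])

lemma hom_fun_coeff: "v \<in> exps {..n} d \<Longrightarrow> hom_fun n d 1 (\<lambda>G. lookup G v)"
  unfolding hom_fun_def by (intro bexI[of _ "var v"] var_in_homog) auto

lemma hom_fun_add: "hom_fun n d k \<phi> \<Longrightarrow> hom_fun n d k \<psi> \<Longrightarrow> hom_fun n d k (\<lambda>G. \<phi> G + \<psi> G)"
  unfolding hom_fun_def by (metis evalp_add mp.subspace_add[OF subspace_homog])

lemma hom_fun_mult: "hom_fun n d k \<phi> \<Longrightarrow> hom_fun n d m \<psi> \<Longrightarrow> hom_fun n d (k + m) (\<lambda>G. \<phi> G * \<psi> G)"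
  unfolding hom_fun_def by (metis evalp_mult homog_mult)

lemma hom_fun_cmult: "hom_fun n d k \<phi> \<Longrightarrow> hom_fun n d k (\<lambda>G. c * \<phi> G)"
  using hom_fun_mult[OF hom_fun_const, of n d k \<phi> c] by simp

lemma hom_fun_diff: "hom_fun n d k \<phi> \<Longrightarrow> hom_fun n d k \<psi> \<Longrightarrow> hom_fun n d k (\<lambda>G. \<phi> G - \<psi> G)"
  using hom_fun_add[OF _ hom_fun_cmult, of n d k \<phi> \<psi> "-1"] by simp

lemma hom_fun_sum: "(\<And>i. i \<in> A \<Longrightarrow> hom_fun n d k (\<phi> i)) \<Longrightarrow> hom_fun n d k (\<lambda>G. \<Sum>i\<in>A. \<phi> i G)"
  by (induction A rule: infinite_finite_induct) (auto intro: hom_fun_zero hom_fun_add)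

lemma hom_fun_scale:
  assumes "hom_fun n d k \<phi>"
  shows "\<phi> (pscale c G) = c ^ k * \<phi> G"
proof -
  obtain Q where Q: "Q \<in> homog (exps {..n} d) k" "\<And>G. \<phi> G = evalp (lookup G) Q"
    using assms by (auto simp: hom_fun_def)
  have "lookup (pscale c G) = (\<lambda>i. c * lookup G i)" by auto
  then show ?thesis using evalp_homog_scale[OF Q(1)] by (simp add: Q(2))
qed

definition hom_family :: "nat \<Rightarrow> nat \<Rightarrow> nat \<Rightarrow> nat \<Rightarrow> ((nat, 'k::field) mpoly \<Rightarrow> (nat, 'k) mpoly) \<Rightarrow> bool" where
  "hom_family n d e k \<xi> \<longleftrightarrow> (\<forall>G. \<xi> G \<in> homog {..n} e) \<and> (\<forall>u. hom_fun n d k (\<lambda>G. lookup (\<xi> G) u))"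

lemma hom_family_const: "x \<in> homog {..n} e \<Longrightarrow> hom_family n d e 0 (\<lambda>G. x)"
  by (simp add: hom_family_def hom_fun_const)

lemma hom_family_diff:
  "hom_family n d e k \<xi> \<Longrightarrow> hom_family n d e k \<eta> \<Longrightarrow> hom_family n d e k (\<lambda>G. \<xi> G - \<eta> G)"
  by (auto simp: hom_family_def lookup_minus intro: hom_fun_diff mp.subspace_diff[OF subspace_homog])

lemma hom_family_pscale:
  "hom_fun n d k \<phi> \<Longrightarrow> hom_family n d e m \<xi> \<Longrightarrow> hom_family n d e (k + m) (\<lambda>G. pscale (\<phi> G) (\<xi> G))"
  by (auto simp: hom_family_def intro: hom_fun_mult mp.subspace_scale[OF subspace_homog])

lemma hom_family_var_mult:
  assumes "hom_family n d e k \<xi>" "i \<le> n"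
  shows "hom_family n d (Suc e) k (\<lambda>G. var i * \<xi> G)"
  unfolding hom_family_def
proof (intro conjI allI)
  show "var i * \<xi> G \<in> homog {..n} (Suc e)" for G
    using assms var_mult_in_homog[of i "{..n}" "\<xi> G" e] by (auto simp: hom_family_def)
  show "hom_fun n d k (\<lambda>G. lookup (var i * \<xi> G) u)" for u
  proof (cases "\<exists>w. u = single i 1 + w")
    case True
    then obtain w where "u = single i 1 + w" by blast
    then show ?thesis using assms(1) by (simp add: lookup_single_mult_add hom_family_def del: One_nat_def)
  next
    case False
    then show ?thesis by (simp add: lookup_single_mult_0 hom_fun_zero del: One_nat_def)
  qed
qed

text \<open>Row \<open>w\<close> of the catalecticant of \<open>G\<close>, applied to
  \<open>x\<close>.\<close>

definition pairing :: "(nat, 'k::field) mpoly \<Rightarrow> (nat, 'k) mpoly \<Rightarrow> (nat \<Rightarrow>\<^sub>0 nat) \<Rightarrow> 'k" where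
  "pairing G x w = lookup (contract x G) w"

lemma pairing_eq:
  assumes "x \<in> homog {..n} e"
  shows "pairing G x w = (\<Sum>u\<in>exps {..n} e. lookup x u * lookup G (w + u))"
  unfolding pairing_def using assms by (intro lookup_contract_superset) (auto simp: homog_def)

lemma hom_fun_pairing:
  assumes \<xi>: "hom_family n d e k \<xi>" and w: "w \<in> exps {..n} m" "m + e = d"
  shows "hom_fun n d (k + 1) (\<lambda>G. pairing G (\<xi> G) w)"
proof -
  have "hom_fun n d (k + 1) (\<lambda>G. \<Sum>u\<in>exps {..n} e. lookup (\<xi> G) u * lookup G (w + u))"
  proof (intro hom_fun_sum hom_fun_mult hom_fun_coeff)
    fix u assume "u \<in> exps {..n} e"
    then show "w + u \<in> exps {..n} d" using exps_add[OF w(1)] w(2) by auto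
  qed (use \<xi> in \<open>simp add: hom_family_def\<close>)
  moreover have "pairing G (\<xi> G) w = (\<Sum>u\<in>exps {..n} e. lookup (\<xi> G) u * lookup G (w + u))" for G
    using \<xi> by (intro pairing_eq) (auto simp: hom_family_def)
  ultimately show ?thesis by simp
qed

lemma pairing_diff: "pairing G (x - y) w = pairing G x w - pairing G y w"
proof -
  have "pairing G x w = pairing G (x - y) w + pairing G y w"
    unfolding pairing_def by (simp flip: lookup_add contract_add_left)
  then show ?thesis by simp
qed

lemma pairing_pscale: "pairing G (pscale c x) w = c * pairing G x w"
  by (simp add: pairing_def contract_pscale_left)

lemma contract_eq_0_iff_pairing:
  assumes G: "G \<in> homog {..n} d" and x: "x \<in> homog {..n} e" and e: "m + e = d"
  shows "contract x G = 0 \<longleftrightarrow> (\<forall>w\<in>exps {..n} m. pairing G x w = 0)"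
proof
  assume 0: "\<forall>w\<in>exps {..n} m. pairing G x w = 0"
  show "contract x G = 0"
  proof (rule poly_mapping_eqI, rule ccontr)
    fix w assume nz: "lookup (contract x G) w \<noteq> lookup 0 w"
    obtain u where u: "u \<in> exps {..n} e" "lookup G (w + u) \<noteq> 0"
      using contract_degree[OF x] nz by (metis lookup_zero)
    from u(2) have "w + u \<in> exps {..n} d" by (rule homogD[OF G])
    then have "w \<in> exps {..n} m" using u(1) e by (auto simp: exps_def keys_add_nat)
    then show False using 0 nz by (simp add: pairing_def)
  qed
qed (simp add: pairing_def)

text \<open>Kernel of the catalecticant rows in \<open>B\<close>. Unlike that of
  \<open>Ann_deg\<close>, its dimension is constant on the open set where these rows are
  independent.\<close>

definition Nker :: "nat \<Rightarrow> nat \<Rightarrow> (nat \<Rightarrow>\<^sub>0 nat) set \<Rightarrow> (nat, 'k::field) mpoly \<Rightarrow> (nat, 'k) mpoly set" where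
  "Nker n e B G = {x \<in> homog {..n} e. \<forall>w\<in>B. pairing G x w = 0}"

definition Ann_deg :: "nat \<Rightarrow> nat \<Rightarrow> (nat, 'k::field) mpoly \<Rightarrow> (nat, 'k) mpoly set" where
  "Ann_deg n e G = {x \<in> homog {..n} e. contract x G = 0}"

lemma subspace_Nker: "mp.subspace (Nker n e B (G :: (nat, 'k::field) mpoly))"
  using mp.subspace_0[OF subspace_homog] mp.subspace_add[OF subspace_homog] mp.subspace_scale[OF subspace_homog]
  by (auto simp: mp.subspace_def Nker_def pairing_def contract_add_left contract_pscale_left lookup_add)

lemma Nker_sub: "Nker n e B G \<subseteq> homog {..n} e" and Ann_deg_sub: "Ann_deg n e G \<subseteq> homog {..n} e"
  by (auto simp: Nker_def Ann_deg_def)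

lemma Ann_deg_sub_Nker: "Ann_deg n e G \<subseteq> Nker n e B G"
  by (auto simp: Nker_def Ann_deg_def pairing_def)

lemma dim_Nker_insert: "mp.dim (Nker n e B G) \<le> Suc (mp.dim (Nker n e (insert w B) (G :: (nat, 'k::field) mpoly)))"
proof -
  let ?\<phi> = "\<lambda>x. pairing G x w"
  have lin: "Vector_Spaces.linear pscale (*) ?\<phi>"
    by (rule linear_mpI) (auto simp: pairing_def contract_add_left contract_pscale_left lookup_add ks.vector_space_axioms)
  have "?\<phi> ` Nker n e B G \<subseteq> ks.span {1}"
  proof
    fix c assume "c \<in> ?\<phi> ` Nker n e B G"
    have "c * 1 \<in> ks.span {1}" by (intro ks.span_scale ks.span_base) simp
    then show "c \<in> ks.span {1}" by simp
  qed
  then have "ks.dim (?\<phi> ` Nker n e B G) \<le> card {1::'k}" by (intro ks.dim_le_card) auto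
  moreover have "{x \<in> Nker n e B G. ?\<phi> x = 0} = Nker n e (insert w B) G" by (auto simp: Nker_def)
  ultimately show ?thesis
    using dim_kernel_image(1)[OF lin subspace_Nker fin_dim_T[OF Nker_sub], of n e B G] by simp
qed

text \<open>Elimination without determinants: \<open>B\<close> collects \<open>m\<close> rows of the catalecticant that are
  independent at \<open>F\<close>, and every element of their common kernel at \<open>F\<close> extends to a polynomial
  family of elements of the kernels.\<close>
lemma kernel_families:
  fixes F :: "(nat, 'k::field) mpoly"
  assumes F: "F \<in> homog {..n} d" and e: "m' + e = d"
    and m: "m + mp.dim (Ann_deg n e F) \<le> mp.dim (homog {..n} e :: (nat, 'k) mpoly set)"
  shows "\<exists>B \<psi> k. finite B \<and> B \<subseteq> exps {..n} m' \<and> hom_fun n d k \<psi> \<and> \<psi> F \<noteq> 0 \<and>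
    (\<forall>G :: (nat, 'k) mpoly. mp.dim (homog {..n} e :: (nat, 'k) mpoly set) \<le> m + mp.dim (Nker n e B G)) \<and>
    (\<forall>G. \<psi> G \<noteq> 0 \<longrightarrow> m + mp.dim (Nker n e B G) \<le> mp.dim (homog {..n} e :: (nat, 'k) mpoly set)) \<and>
    (\<forall>x\<in>Nker n e B F. \<exists>\<xi> k c. hom_family n d e k \<xi> \<and> (\<forall>G. \<xi> G \<in> Nker n e B G) \<and> c \<noteq> 0 \<and> \<xi> F = pscale c x)"
  using m
proof (induction m)
  case 0
  let ?T = "homog {..n} e :: (nat, 'k) mpoly set"
  have N: "Nker n e {} G = ?T" for G :: "(nat, 'k) mpoly" by (simp add: Nker_def)
  have "\<exists>\<xi> k c. hom_family n d e k \<xi> \<and> (\<forall>G. \<xi> G \<in> Nker n e {} G) \<and> c \<noteq> 0 \<and> \<xi> F = pscale c x"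
    if "x \<in> Nker n e {} F" for x
    using that hom_family_const[of x n e d] N by (intro exI[of _ "\<lambda>G. x"] exI[of _ 0] exI[of _ 1]) auto
  then show ?case
    by (intro exI[of _ "{}"] exI[of _ "\<lambda>G. 1"] exI[of _ 0]) (auto simp: hom_fun_const N)
next
  case (Suc m)
  let ?T = "homog {..n} e :: (nat, 'k) mpoly set"
  have "m + mp.dim (Ann_deg n e F) \<le> mp.dim ?T" using Suc.prems by simp
  from Suc.IH[OF this] obtain B \<psi> k where B: "finite B" "B \<subseteq> exps {..n} m'" and \<psi>: "hom_fun n d k \<psi>" "\<psi> F \<noteq> 0"
    and le: "\<forall>G :: (nat, 'k) mpoly. mp.dim ?T \<le> m + mp.dim (Nker n e B G)"
    and ge: "\<forall>G. \<psi> G \<noteq> 0 \<longrightarrow> m + mp.dim (Nker n e B G) \<le> mp.dim ?T"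
    and ext: "\<forall>x\<in>Nker n e B F.
      \<exists>\<xi> k c. hom_family n d e k \<xi> \<and> (\<forall>G. \<xi> G \<in> Nker n e B G) \<and> c \<noteq> 0 \<and> \<xi> F = pscale c x"
    by (elim exE conjE) (rule that)
  note le = le[rule_format] and ge = ge[rule_format] and ext = ext[rule_format]
  \<comment> \<open>The rows chosen so far cut out codimension at most \<open>m\<close>, less than
    that of the annihilator, so some further row \<open>w\<close> is nonzero on their
    kernel.\<close>
  have "Nker n e B F \<noteq> Ann_deg n e F" using le[of F] Suc.prems by auto
  then obtain p where p: "p \<in> Nker n e B F" "p \<notin> Ann_deg n e F" using Ann_deg_sub_Nker by blast
  then have "p \<in> ?T" "contract p F \<noteq> 0" by (auto simp: Ann_deg_def Nker_def)
  then obtain w where w: "w \<in> exps {..n} m'" "pairing F p w \<noteq> 0"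
    using contract_eq_0_iff_pairing[OF F _ e] by blast
  obtain \<eta> k' c' where \<eta>: "hom_family n d e k' \<eta>" "\<And>G. \<eta> G \<in> Nker n e B G" "c' \<noteq> 0" "\<eta> F = pscale c' p"
    using ext[OF p(1)] by blast
  let ?B = "insert w B"
  \<comment> \<open>Value of the new row on a family in the kernel of the old ones. Where it is
    nonzero, the new row is independent of those in \<open>B\<close>.\<close>
  define \<beta> where "\<beta> = (\<lambda>G. pairing G (\<eta> G) w)"
  have \<beta>: "hom_fun n d (k' + 1) \<beta>" unfolding \<beta>_def by (rule hom_fun_pairing[OF \<eta>(1) w(1) e])
  have \<beta>F: "\<beta> F \<noteq> 0" using \<eta>(3,4) w(2) by (simp add: \<beta>_def pairing_pscale)
  have le': "mp.dim ?T \<le> Suc m + mp.dim (Nker n e ?B G)" for G :: "(nat, 'k) mpoly"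
    using le[of G] dim_Nker_insert[of n e B G w] by simp
  have ge': "Suc m + mp.dim (Nker n e ?B G) \<le> mp.dim ?T" if "\<psi> G * \<beta> G \<noteq> 0" for G
  proof -
    have "\<eta> G \<notin> Nker n e ?B G" using that by (auto simp: Nker_def \<beta>_def)
    then have "Nker n e ?B G \<subset> Nker n e B G" using \<eta>(2)[of G] by (auto simp: Nker_def)
    then have "mp.dim (Nker n e ?B G) < mp.dim (Nker n e B G)"
      by (rule mp.dim_psubset_fin[OF fin_dim_T[OF Nker_sub] subspace_Nker])
    then show ?thesis using ge[of G] that by simp
  qed
  have ext': "\<exists>\<xi> k c. hom_family n d e k \<xi> \<and> (\<forall>G. \<xi> G \<in> Nker n e ?B G) \<and> c \<noteq> 0 \<and> \<xi> F = pscale c x"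
    if x: "x \<in> Nker n e ?B F" for x
  proof -
    have "x \<in> Nker n e B F" and xw: "pairing F x w = 0" using x by (auto simp: Nker_def)
    then obtain \<zeta> l c where \<zeta>: "hom_family n d e l \<zeta>" "\<And>G. \<zeta> G \<in> Nker n e B G" "c \<noteq> 0" "\<zeta> F = pscale c x"
      using ext by blast
    \<comment> \<open>\<open>\<zeta>\<close> is corrected by \<open>\<eta>\<close> so that the new
      row vanishes on it. Multiplying by \<open>\<beta>\<close> instead of dividing keeps the family
      polynomial, and at \<open>F\<close> the correction is zero because \<open>x\<close> lies in
      the kernel of the new row.\<close>
    define \<xi> where "\<xi> = (\<lambda>G. pscale (\<beta> G) (\<zeta> G) - pscale (pairing G (\<zeta> G) w) (\<eta> G))"
    have "hom_family n d e (k' + 1 + l) \<xi>"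
      unfolding \<xi>_def
    proof (rule hom_family_diff)
      show "hom_family n d e (k' + 1 + l) (\<lambda>G. pscale (\<beta> G) (\<zeta> G))" by (rule hom_family_pscale[OF \<beta> \<zeta>(1)])
      have "hom_family n d e (l + 1 + k') (\<lambda>G. pscale (pairing G (\<zeta> G) w) (\<eta> G))"
        by (rule hom_family_pscale[OF hom_fun_pairing[OF \<zeta>(1) w(1) e] \<eta>(1)])
      then show "hom_family n d e (k' + 1 + l) (\<lambda>G. pscale (pairing G (\<zeta> G) w) (\<eta> G))"
        by (simp add: add_ac)
    qed
    moreover have "\<xi> G \<in> Nker n e ?B G" for G
    proof -
      have "\<xi> G \<in> Nker n e B G" unfolding \<xi>_def
        by (intro mp.subspace_diff[OF subspace_Nker] mp.subspace_scale[OF subspace_Nker] \<zeta>(2) \<eta>(2))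
      moreover have "pairing G (\<xi> G) w = 0"
        by (simp add: \<xi>_def pairing_diff pairing_pscale \<beta>_def mult.commute)
      ultimately show ?thesis by (simp add: Nker_def)
    qed
    moreover have "\<xi> F = pscale (\<beta> F * c) x"
      using xw by (simp add: \<xi>_def \<zeta>(4) pairing_pscale)
    moreover have "\<beta> F * c \<noteq> 0" using \<beta>F \<zeta>(3) by simp
    ultimately show ?thesis by blast
  qed
  have "hom_fun n d (k + (k' + 1)) (\<lambda>G. \<psi> G * \<beta> G)" by (rule hom_fun_mult[OF \<psi>(1) \<beta>])
  then show ?case
    using B w(1) \<psi>(2) \<beta>F le' ge' ext'
    by (intro exI[of _ ?B] exI[of _ "\<lambda>G. \<psi> G * \<beta> G"] exI[of _ "k + (k' + 1)"]) auto
qed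

text \<open>Elimination without fractions: a coefficient of \<open>v 0\<close> that is nonzero at
  \<open>F\<close> serves as pivot, and the remaining families are reduced by cross-multiplication.
  The pivot times the polynomial of the smaller system is the required function.\<close>

lemma independent_families_open:
  fixes F :: "(nat, 'k::field) mpoly" and m :: nat
  assumes "\<And>j. j < m \<Longrightarrow> \<exists>k. hom_family n d e k (v j)"
    and "\<And>c. (\<Sum>j<m. pscale (c j) (v j F)) = 0 \<Longrightarrow> \<forall>j<m. c j = 0"
  shows "\<exists>\<psi> k. hom_fun n d k \<psi> \<and> \<psi> F \<noteq> 0 \<and>
    (\<forall>G c. \<psi> G \<noteq> 0 \<longrightarrow> (\<Sum>j<m. pscale (c j) (v j G)) = 0 \<longrightarrow> (\<forall>j<m. c j = 0))"
  using assms
proof (induction m arbitrary: v)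
  case 0
  then show ?case by (intro exI[of _ "\<lambda>G. 1"] exI[of _ 0]) (auto simp: hom_fun_const)
next
  case (Suc m)
  have "v 0 F \<noteq> 0"
  proof
    assume "v 0 F = 0"
    then have "(\<Sum>j<Suc m. pscale (if j = 0 then 1 else 0) (v j F)) = 0"
      by (intro sum.neutral) auto
    from Suc.prems(2)[OF this] show False by auto
  qed
  then obtain u where u: "lookup (v 0 F) u \<noteq> 0" using tdeg_attained by metis
  define a where "a = (\<lambda>j G. lookup (v j G) u)"
  define w where "w = (\<lambda>j G. pscale (a 0 G) (v (Suc j) G) - pscale (a (Suc j) G) (v 0 G))"
  obtain k0 where k0: "hom_family n d e k0 (v 0)" using Suc.prems(1)[of 0] by auto
  then have a0: "hom_fun n d k0 (a 0)" by (simp add: hom_family_def a_def)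
  have "\<exists>k. hom_family n d e k (w j)" if j: "j < m" for j
  proof -
    obtain k1 where k1: "hom_family n d e k1 (v (Suc j))" using Suc.prems(1)[of "Suc j"] j by auto
    then have a1: "hom_fun n d k1 (a (Suc j))" by (simp add: hom_family_def a_def)
    have "hom_family n d e (k0 + k1) (w j)" unfolding w_def
      using hom_family_pscale[OF a0 k1] hom_family_pscale[OF a1 k0]
      by (intro hom_family_diff) (simp_all add: add.commute)
    then show ?thesis ..
  qed
  moreover have comb: "(\<Sum>j<m. pscale (c j) (w j G)) =
      (\<Sum>j<Suc m. pscale (case j of 0 \<Rightarrow> - (\<Sum>j<m. c j * a (Suc j) G) | Suc i \<Rightarrow> c i * a 0 G) (v j G))" for c G
  proof -
    have "(\<Sum>j<m. pscale (c j) (w j G)) = (\<Sum>j<m. pscale (c j * a 0 G) (v (Suc j) G))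
        - (\<Sum>j<m. pscale (c j * a (Suc j) G) (v 0 G))"
      by (simp add: w_def mp.scale_right_diff_distrib sum_subtractf)
    also have "(\<Sum>j<m. pscale (c j * a (Suc j) G) (v 0 G)) = pscale (\<Sum>j<m. c j * a (Suc j) G) (v 0 G)"
      by (simp add: mp.scale_sum_left)
    finally show ?thesis by (subst sum.lessThan_Suc_shift) simp
  qed
  have "\<forall>j<m. c j = 0" if "(\<Sum>j<m. pscale (c j) (w j F)) = 0" for c
  proof -
    have "\<forall>j<Suc m. (case j of 0 \<Rightarrow> - (\<Sum>j<m. c j * a (Suc j) F) | Suc i \<Rightarrow> c i * a 0 F) = 0"
      using that unfolding comb by (rule Suc.prems(2))
    then show ?thesis using u by (auto simp: a_def)
  qed
  ultimately obtain \<psi> k where \<psi>: "hom_fun n d k \<psi>" "\<psi> F \<noteq> 0"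
    and ind: "\<And>G c. \<psi> G \<noteq> 0 \<Longrightarrow> (\<Sum>j<m. pscale (c j) (w j G)) = 0 \<Longrightarrow> \<forall>j<m. c j = 0"
    using Suc.IH[of w] by blast
  have "\<forall>j<Suc m. c j = 0"
    if G: "a 0 G * \<psi> G \<noteq> 0" and s: "(\<Sum>j<Suc m. pscale (c j) (v j G)) = 0" for c G
  proof -
    have split: "pscale (c 0) (v 0 G) + (\<Sum>j<m. pscale (c (Suc j)) (v (Suc j) G)) = 0"
      using s by (subst (asm) sum.lessThan_Suc_shift)
    then have au: "c 0 * a 0 G + (\<Sum>j<m. c (Suc j) * a (Suc j) G) = 0"
    proof -
      have "c 0 * a 0 G + (\<Sum>j<m. c (Suc j) * a (Suc j) G) = lookup
          (pscale (c 0) (v 0 G) + (\<Sum>j<m. pscale (c (Suc j)) (v (Suc j) G))) u"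
        by (simp add: lookup_add lookup_sum a_def)
      also have "\<dots> = 0" by (simp only: split lookup_zero)
      finally show ?thesis .
    qed
    have "(\<Sum>j<m. pscale (c (Suc j)) (w j G)) = pscale (a 0 G) (\<Sum>j<m. pscale (c (Suc j)) (v (Suc j) G))
        - pscale (\<Sum>j<m. c (Suc j) * a (Suc j) G) (v 0 G)"
      by (simp add: w_def mp.scale_right_diff_distrib sum_subtractf mp.scale_sum_left mp.scale_sum_right mult.commute)
    also have "(\<Sum>j<m. pscale (c (Suc j)) (v (Suc j) G)) = - pscale (c 0) (v 0 G)"
      using split by (simp add: eq_neg_iff_add_eq_0 add.commute)
    also have "(\<Sum>j<m. c (Suc j) * a (Suc j) G) = - (c 0 * a 0 G)"
      using au by (simp add: eq_neg_iff_add_eq_0 add.commute)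
    finally have "(\<Sum>j<m. pscale (c (Suc j)) (w j G)) = 0" by (simp add: mult.commute)
    then have "\<forall>j<m. c (Suc j) = 0" using G by (intro ind) auto
    moreover from this have "c 0 = 0" using au G by simp
    ultimately show ?thesis by (auto simp: less_Suc_eq_0_disj)
  qed
  moreover have "hom_fun n d (k0 + k) (\<lambda>G. a 0 G * \<psi> G)" by (rule hom_fun_mult[OF a0 \<psi>(1)])
  moreover have "a 0 F * \<psi> F \<noteq> 0" using u \<psi>(2) by (simp add: a_def)
  ultimately show ?case by (intro exI[of _ "\<lambda>G. a 0 G * \<psi> G"] exI[of _ "k0 + k"]) blast
qed

subsection \<open>Equations of the cactus variety\<close>

text \<open>The least number is attained because the scheme of the dehomogenized \<open>G\<close> is
  one candidate.\<close>

lemma cactus_rank_attained: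
  fixes G :: "(nat, 'k::alg_closed_field) mpoly"
  assumes G: "G \<in> homog {..n} d" "G \<noteq> 0" and s: "cactus_rank n d G \<le> s"
  obtains I r' where "r' \<le> s" "zero_dim_subscheme n I r'" "G \<in> veronese_span n d I"
proof -
  have eq: "hz d (deh G) = G" by (rule hz_deh[OF G(1)])
  then have g: "deh G \<noteq> 0" using G(2) by auto
  have gp: "deh G \<in> polys {1..n}" using G(1) homog_subset_polys by (intro deh_in_polys) blast
  have "\<exists>r. r > 0 \<and> (\<exists>I. zero_dim_subscheme n I r \<and> G \<in> veronese_span n d I)"
    using cactus_scheme_Ann_hom[OF gp g tdeg_deh_le[OF G(1)]] eq by auto
  from LeastI_ex[OF this] show thesis using that s unfolding cactus_rank_def by blast
qed

text \<open>By homogeneity, vanishing at \<open>G\<close> passes to its whole line, as the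
  projective closure demands.\<close>

lemma hom_fun_vanishes_on_cactus_variety:
  fixes F :: "(nat, 'k::field) mpoly"
  assumes F: "line F \<in> cactus_variety n d s" and \<phi>: "hom_fun n d k \<phi>"
    and 0: "\<And>G. G \<in> homog {..n} d \<Longrightarrow> G \<noteq> 0 \<Longrightarrow> cactus_rank n d G \<le> s \<Longrightarrow> \<phi> G = 0"
  shows "\<phi> F = 0"
proof -
  obtain Q where Q: "Q \<in> homog (exps {..n} d) k" "\<And>G. \<phi> G = evalp (lookup G) Q"
    using \<phi> by (auto simp: hom_fun_def)
  let ?A = "{line G | G. G \<in> homog {..n} d \<and> G \<noteq> 0 \<and> cactus_rank n d G \<le> s} :: (nat, 'k) mpoly set set"
  have vanish: "evalp (lookup G') Q = 0" if P': "P' \<in> ?A" and G': "G' \<in> P'" for P' G'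
  proof -
    obtain G where G: "G \<in> homog {..n} d" "G \<noteq> 0" "cactus_rank n d G \<le> s" "P' = line G" using P' by blast
    obtain c where "G' = pscale c G" using G' G(4) by (auto simp: line_def)
    then have "\<phi> G' = c ^ k * \<phi> G" using hom_fun_scale[OF \<phi>] by simp
    then show ?thesis using 0[OF G(1-3)] Q(2) by simp
  qed
  have closed: "\<forall>k. \<forall>Q\<in>homog (exps {..n} d) k.
      (\<forall>P'\<in>?A. \<forall>G\<in>P'. evalp (lookup G) Q = 0) \<longrightarrow> (\<forall>G\<in>line F. evalp (lookup G) Q = 0)"
    using F unfolding cactus_variety_def proj_closure_def by blast
  have "evalp (lookup F) Q = 0"
    by (rule closed[rule_format, OF Q(1) _ self_in_line]) (rule vanish)
  then show ?thesis by (simp add: Q(2))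
qed

lemma vanishing_forms_subset_Ann_deg:
  assumes "zero_dim_subscheme n I s" "G \<in> veronese_span n d I" "e \<le> d"
  shows "vanishing_forms n I e \<subseteq> Ann_deg n e (G :: (nat, 'k::alg_closed_field) mpoly)"
proof -
  interpret zero_dim_scheme n s I by unfold_locales (rule assms(1))
  show ?thesis using contract_vanishing_forms[OF assms(2) _ assms(3)]
    by (auto simp: Ann_deg_def vanishing_forms_def)
qed

text \<open>Otherwise \<open>Suc s\<close> catalecticant rows are independent at \<open>F\<close>,
  and the polynomial witnessing this is nonzero there. It vanishes at every \<open>G\<close> of
  cactus rank at most \<open>s\<close>, since the forms vanishing on a scheme for \<open>G\<close>
  lie in the kernel of the rows and have codimension at most \<open>s\<close>.\<close>

lemma codim_Ann_deg_le:
  fixes F :: "(nat, 'k::alg_closed_field) mpoly"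
  assumes F: "F \<in> homog {..n} d" and cv: "line F \<in> cactus_variety n d s" and e: "m' + e = d"
  shows "mp.dim (homog {..n} e :: (nat, 'k) mpoly set) \<le> s + mp.dim (Ann_deg n e F)"
proof (rule ccontr)
  let ?T = "homog {..n} e :: (nat, 'k) mpoly set"
  assume "\<not> ?thesis"
  then have "Suc s + mp.dim (Ann_deg n e F) \<le> mp.dim ?T" by simp
  from kernel_families[OF F e this] obtain B \<psi> k where \<psi>: "hom_fun n d k \<psi>" "\<psi> F \<noteq> 0"
    and ge: "\<forall>G. \<psi> G \<noteq> 0 \<longrightarrow> Suc s + mp.dim (Nker n e B G) \<le> mp.dim ?T"
    by (elim exE conjE) (rule that)
  have "\<psi> F = 0"
  proof (rule hom_fun_vanishes_on_cactus_variety[OF cv \<psi>(1)], rule ccontr)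
    fix G :: "(nat, 'k) mpoly" assume G: "G \<in> homog {..n} d" "G \<noteq> 0" "cactus_rank n d G \<le> s" "\<psi> G \<noteq> 0"
    obtain I r' where I: "r' \<le> s" "zero_dim_subscheme n I r'" "G \<in> veronese_span n d I"
      using cactus_rank_attained[OF G(1-3)] .
    interpret zero_dim_scheme n r' I by unfold_locales (rule I(2))
    have "vanishing_forms n I e \<subseteq> Nker n e B G"
      using vanishing_forms_subset_Ann_deg[OF I(2,3), of e] Ann_deg_sub_Nker e by fastforce
    then have "mp.dim (vanishing_forms n I e) \<le> mp.dim (Nker n e B G)" by (rule dim_T_mono[OF _ Nker_sub])
    then show False using ge G(4) vanishing_forms_dim(2)[of e] I(1) by fastforce
  qed
  then show False using \<psi>(2) by simp
qed

lemma family_card_le_dim: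
  fixes V :: "('i, 'k::field) mpoly set" and m :: nat
  assumes fd: "mp.fin_dim V" and V: "\<And>j. j < m \<Longrightarrow> v j \<in> V"
    and ind: "\<And>c. (\<Sum>j<m. pscale (c j) (v j)) = 0 \<Longrightarrow> \<forall>j<m. c j = 0"
  shows "m \<le> mp.dim V"
proof -
  have inj: "inj_on v {..<m}"
  proof (rule inj_onI, rule ccontr)
    fix i j assume ij: "i \<in> {..<m}" "j \<in> {..<m}" "v i = v j" "i \<noteq> j"
    define c :: "nat \<Rightarrow> 'k" where "c = (\<lambda>l. if l = i then 1 else if l = j then - 1 else 0)"
    have "(\<Sum>l<m. pscale (c l) (v l)) = (\<Sum>l\<in>{i, j}. pscale (c l) (v l))"
      using ij by (intro sum.mono_neutral_right) (auto simp: c_def)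
    also have "\<dots> = 0" using ij(3,4) by (simp add: c_def)
    finally have "c i = 0" using ind ij(1) by blast
    then show False by (simp add: c_def)
  qed
  have "mp.independent (v ` {..<m})"
  proof (rule mp.independent_if_scalars_zero)
    fix c x assume s: "(\<Sum>x\<in>v ` {..<m}. pscale (c x) x) = 0" and x: "x \<in> v ` {..<m}"
    have "(\<Sum>j<m. pscale (c (v j)) (v j)) = 0" using s by (simp add: sum.reindex[OF inj])
    from ind[OF this] show "c x = 0" using x by auto
  qed simp
  then have "card (v ` {..<m}) \<le> mp.dim V" using V by (intro mp.card_independent_le_dim(2)[OF fd]) auto
  then show ?thesis by (simp add: card_image[OF inj])
qed

text \<open>If the products were too many, a basis of them at \<open>F\<close> would extend to
  polynomial families that stay independent on an open set. At a form of small cactus rank in that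
  set they would all vanish on a scheme of length at most \<open>s\<close>, whose Hilbert function
  would drop below \<open>s\<close> after having reached it in degree \<open>e\<close>.\<close>

lemma codim_up_Ann_deg_ge:
  fixes F :: "(nat, 'k::alg_closed_field) mpoly"
  assumes F: "F \<in> homog {..n} d" and cv: "line F \<in> cactus_variety n d s" and e: "m' + e = d"
    and codim: "mp.dim (homog {..n} e :: (nat, 'k) mpoly set) = s + mp.dim (Ann_deg n e F)"
  shows "s + mp.dim (up n (Ann_deg n e F)) \<le> mp.dim (homog {..n} (Suc e) :: (nat, 'k) mpoly set)"
proof (rule ccontr)
  let ?T = "homog {..n} e :: (nat, 'k) mpoly set" and ?T' = "homog {..n} (Suc e) :: (nat, 'k) mpoly set"
  let ?U = "up n (Ann_deg n e F)"
  assume contra: "\<not> ?thesis"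
  have "s + mp.dim (Ann_deg n e F) \<le> mp.dim ?T" using codim by simp
  from kernel_families[OF F e this] obtain B \<psi> k where \<psi>: "hom_fun n d k \<psi>" "\<psi> F \<noteq> 0"
    and ge: "\<forall>G. \<psi> G \<noteq> 0 \<longrightarrow> s + mp.dim (Nker n e B G) \<le> mp.dim ?T"
    and ext: "\<forall>x\<in>Nker n e B F. \<exists>\<xi> k c. hom_family n d e k \<xi> \<and> (\<forall>G. \<xi> G \<in> Nker n e B G) \<and> c \<noteq> 0 \<and> \<xi> F = pscale c x"
    by (elim exE conjE) (rule that)
  let ?W = "{var i * x | i x. i \<le> n \<and> x \<in> Ann_deg n e F}"
  \<comment> \<open>The basis is chosen among the products themselves, because each of them extends
    to a family \<open>var i * \<xi> G\<close>.\<close>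
  obtain B0 where B0: "B0 \<subseteq> ?W" "mp.independent B0" "?W \<subseteq> mp.span B0"
    using mp.maximal_independent_subset by blast
  have B0U: "B0 \<subseteq> ?U" using B0(1) mp.span_superset[of ?W] unfolding up_def by blast
  have UB0: "?U \<subseteq> mp.span B0" unfolding up_def using B0(3) by (intro mp.span_minimal) auto
  have fdU: "mp.fin_dim ?U" by (rule fin_dim_T[OF up_subset_homog[OF Ann_deg_sub]])
  have finB0: "finite B0" by (rule mp.card_independent_le_dim(1)[OF fdU B0(2) B0U])
  have cardB0: "card B0 = mp.dim ?U" by (rule mp.basis_card_eq_dim[OF B0U UB0 B0(2)])
  obtain h where h: "bij_betw h {..<mp.dim ?U} B0"
    using ex_bij_betw_nat_finite[OF finB0] cardB0 by (auto simp: atLeast0LessThan)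
  define m where "m = mp.dim ?U"
  have "\<exists>v c. (\<exists>k. hom_family n d (Suc e) k v) \<and> c \<noteq> 0 \<and> v F = pscale c (h j)
      \<and> (\<forall>G. \<exists>i x. i \<le> n \<and> x \<in> Nker n e B G \<and> v G = var i * x)" if j: "j < m" for j
  proof -
    have "h j \<in> ?W" using h j B0(1) by (auto simp: m_def bij_betw_def)
    then obtain i x where ix: "i \<le> n" "x \<in> Ann_deg n e F" "h j = var i * x" by blast
    then have "x \<in> Nker n e B F" using Ann_deg_sub_Nker by blast
    then obtain \<xi> k c where \<xi>: "hom_family n d e k \<xi>" "\<forall>G. \<xi> G \<in> Nker n e B G" "c \<noteq> 0" "\<xi> F = pscale c x"
      using ext by blast
    have "hom_family n d (Suc e) k (\<lambda>G. var i * \<xi> G)" by (rule hom_family_var_mult[OF \<xi>(1) ix(1)])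
    moreover have "var i * \<xi> F = pscale c (h j)" by (simp add: \<xi>(4) ix(3) pscale_conv_mult mult.left_commute)
    ultimately show ?thesis using \<xi>(2,3) ix(1)
      by (intro exI[of _ "\<lambda>G. var i * \<xi> G"] exI[of _ c]) blast
  qed
  then have "\<forall>j\<in>{..<m}. \<exists>v c. (\<exists>k. hom_family n d (Suc e) k v) \<and> c \<noteq> 0 \<and> v F = pscale c (h j)
      \<and> (\<forall>G. \<exists>i x. i \<le> n \<and> x \<in> Nker n e B G \<and> v G = var i * x)" by simp
  from bchoice[OF this] obtain v where v': "\<forall>j\<in>{..<m}. \<exists>c. (\<exists>k. hom_family n d (Suc e) k (v j)) \<and> c \<noteq> 0
      \<and> v j F = pscale c (h j) \<and> (\<forall>G. \<exists>i x. i \<le> n \<and> x \<in> Nker n e B G \<and> v j G = var i * x)" ..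
  from bchoice[OF this] obtain c where v: "\<forall>j\<in>{..<m}. (\<exists>k. hom_family n d (Suc e) k (v j)) \<and> c j \<noteq> 0
      \<and> v j F = pscale (c j) (h j) \<and> (\<forall>G. \<exists>i x. i \<le> n \<and> x \<in> Nker n e B G \<and> v j G = var i * x)" ..
  have indF: "\<forall>j<m. a j = 0" if "(\<Sum>j<m. pscale (a j) (v j F)) = 0" for a
  proof -
    have "(\<Sum>j<m. pscale (a j * c j) (h j)) = 0" using that v by simp
    moreover have "(\<Sum>j<m. pscale (a j * c j) (h j))
      = (\<Sum>b\<in>B0. pscale (a (inv_into {..<m} h b) * c (inv_into {..<m} h b)) b)"
      using h unfolding m_def by (intro sum.reindex_bij_betw_not_neutral[of "{}" "{}", simplified] sum.reindex_cong[symmetric, where l = h and B = "{..<mp.dim ?U}"])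
        (auto simp: bij_betw_def)
    ultimately have s: "(\<Sum>b\<in>B0. pscale (a (inv_into {..<m} h b) * c (inv_into {..<m} h b)) b) = 0" by simp
    show ?thesis
    proof (intro allI impI)
      fix j assume j: "j < m"
      have "h j \<in> B0" using h j by (auto simp: m_def bij_betw_def)
      from mp.independent_sum_zero[OF B0(2) finB0 s this] have "a j * c j = 0"
        using h j by (simp add: m_def bij_betw_def)
      then show "a j = 0" using v j by auto
    qed
  qed
  have "\<exists>\<chi> l. hom_fun n d l \<chi> \<and> \<chi> F \<noteq> 0 \<and>
      (\<forall>G a. \<chi> G \<noteq> 0 \<longrightarrow> (\<Sum>j<m. pscale (a j) (v j G)) = 0 \<longrightarrow> (\<forall>j<m. a j = 0))"
  proof (rule independent_families_open)
    show "\<exists>k. hom_family n d (Suc e) k (v j)" if "j < m" for j using v that by auto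
    show "\<forall>j<m. a j = 0" if "(\<Sum>j<m. pscale (a j) (v j F)) = 0" for a by (rule indF[OF that])
  qed
  then obtain \<chi> l where \<chi>: "hom_fun n d l \<chi>" "\<chi> F \<noteq> 0"
    and ind: "\<forall>G a. \<chi> G \<noteq> 0 \<longrightarrow> (\<Sum>j<m. pscale (a j) (v j G)) = 0 \<longrightarrow> (\<forall>j<m. a j = 0)"
    by (elim exE conjE) (rule that)
  have "\<psi> F * \<chi> F = 0"
  proof (rule hom_fun_vanishes_on_cactus_variety[OF cv hom_fun_mult[OF \<psi>(1) \<chi>(1)]], rule ccontr)
    fix G :: "(nat, 'k) mpoly"
    assume G: "G \<in> homog {..n} d" "G \<noteq> 0" "cactus_rank n d G \<le> s" "\<psi> G * \<chi> G \<noteq> 0"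
    obtain I r' where I: "r' \<le> s" "zero_dim_subscheme n I r'" "G \<in> veronese_span n d I"
      using cactus_rank_attained[OF G(1-3)] .
    interpret zero_dim_scheme n r' I by unfold_locales (rule I(2))
    have sub: "vanishing_forms n I e \<subseteq> Nker n e B G"
      using vanishing_forms_subset_Ann_deg[OF I(2,3), of e] Ann_deg_sub_Nker e by fastforce
    have geG: "s + mp.dim (Nker n e B G) \<le> mp.dim ?T" using ge G(4) by simp
    \<comment> \<open>The kernel has codimension at least \<open>s\<close> and the vanishing forms
      inside it at most \<open>s\<close>. So they coincide, and products of kernel elements with
      variables vanish on the scheme as well.\<close>
    have "mp.dim (Nker n e B G) \<le> mp.dim (vanishing_forms n I e)"
      using geG vanishing_forms_dim(2)[of e] I(1) by linarith
    from mp.subspace_eq_if_dim_le[OF fin_dim_T[OF Nker_sub] vanishing_forms_dim(1) sub this]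
    have eq: "vanishing_forms n I e = Nker n e B G" .
    have "m \<le> mp.dim (vanishing_forms n I (Suc e))"
    proof (rule family_card_le_dim)
      show "mp.fin_dim (vanishing_forms n I (Suc e))"
        by (rule fin_dim_T[of _ n "Suc e"]) (auto simp: vanishing_forms_def)
      show "v j G \<in> vanishing_forms n I (Suc e)" if j: "j < m" for j
      proof -
        obtain i x where "i \<le> n" "x \<in> Nker n e B G" "v j G = var i * x" using v j by blast
        then show ?thesis
          using vanishing_forms_mult[OF var_in_homog[of i "{..n}"], of x e] eq by (simp add: plus_1_eq_Suc del: One_nat_def)
      qed
      show "\<forall>j<m. a j = 0" if "(\<Sum>j<m. pscale (a j) (v j G)) = 0" for a
      proof -
        have "\<chi> G \<noteq> 0" using G(4) by simp
        then show ?thesis using ind that by blast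
      qed
    qed
    moreover have "mp.dim ?T + mp.dim (vanishing_forms n I (Suc e)) \<le> mp.dim ?T' + mp.dim (vanishing_forms n I e)"
      by (rule codim_vanishing_forms_mono)
    moreover have "mp.dim (vanishing_forms n I e) = mp.dim (Nker n e B G)" by (simp only: eq)
    ultimately have "s + m \<le> mp.dim ?T'" using geG by linarith
    then show False using contra by (simp add: m_def)
  qed
  then show False using \<psi>(2) \<chi>(2) by simp
qed

lemma cactus_variety_mono: "s \<le> s' \<Longrightarrow> cactus_variety n d s \<subseteq> cactus_variety n d s'"
  unfolding cactus_variety_def proj_closure_def by (fastforce intro: order.trans)

section \<open>Cactus rank and border cactus rank of the homogenized form\<close>

context hom_ann
begin

lemma F_T: "F \<in> T (d1 + d2)"
  unfolding F_def by (rule hz_in_homog[OF f deg_f_le])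

lemma F_nz: "F \<noteq> 0"
  using deh_hz[OF f, of "d1 + d2"] f_nz by (auto simp: F_def)

lemma cactus_rank_le: "cactus_rank n (d1 + d2) F \<le> r"
proof -
  obtain r' where r': "r' > 0" "enat r' \<le> enat r" "zero_dim_subscheme n (Ann_hom n f) r'"
    "F \<in> veronese_span n (d1 + d2) (Ann_hom n f)"
    using cactus_scheme_Ann_hom[OF f f_nz deg_f_le] by (auto simp: F_def r)
  then have "cactus_rank n (d1 + d2) F \<le> r'" unfolding cactus_rank_def by (intro Least_le) blast
  then show ?thesis using r'(2) by simp
qed

lemma F_in_cactus_variety: "line F \<in> cactus_variety n (d1 + d2) r"
proof -
  have "line F \<in> proj_space n (d1 + d2)" using F_T F_nz by (auto simp: proj_space_def)
  moreover have "line F \<in> {line G | G. G \<in> T (d1 + d2) \<and> G \<noteq> 0 \<and> cactus_rank n (d1 + d2) G \<le> r}"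
    using F_T F_nz cactus_rank_le by blast
  ultimately show ?thesis unfolding cactus_variety_def proj_closure_def by blast
qed

text \<open>Both conditions are tested with \<open>s = r - 1\<close> in degree \<open>d1\<close>. If
  \<open>A d1 = I d1\<close>, the codimension is \<open>r\<close> and the first one fails. Otherwise
  it is exactly \<open>r - 1\<close>, which makes the second one applicable, and
  \<open>dim_A_gap\<close> violates it.\<close>

lemma border_cactus_rank_eq:
  assumes cond: "d2 \<ge> d1 \<or> d2 = d1 - 1 \<and> \<not> (\<exists>L\<in>homog {1..n} 1. homog_comp d1 f = dp_power {1..n} L d1)"
  shows "border_cactus_rank n (d1 + d2) F = r"
  unfolding border_cactus_rank_def
proof (rule Least_equality)
  show "0 < r \<and> line F \<in> cactus_variety n (d1 + d2) r" using r_pos F_in_cactus_variety by simp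
  fix y assume y: "0 < y \<and> line F \<in> cactus_variety n (d1 + d2) y"
  show "r \<le> y"
  proof (rule ccontr)
    assume "\<not> r \<le> y"
    then have "y \<le> r - 1" by simp
    then have cv: "line F \<in> cactus_variety n (d1 + d2) (r - 1)"
      using y cactus_variety_mono[of y "r - 1" n "d1 + d2"] by blast
    have AA: "Ann_deg n e F = A e" for e by (simp add: Ann_deg_def A_def)
    have d: "d2 + d1 = d1 + d2" by simp
    have le: "mp.dim (T d1) \<le> (r - 1) + mp.dim (A d1)"
      using codim_Ann_deg_le[OF F_T cv d] by (simp add: AA)
    show False
    proof (cases "\<forall>p\<in>A d1. act f p = 0")
      case True
      then have "A d1 = I d1" using I_sub_A[of d1] by (auto simp: I_def A_def)
      then show False using le dim_I[of d1] r_pos by simp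
    next
      case False
      then obtain \<theta> where \<theta>: "\<theta> \<in> A d1" "act f \<theta> \<noteq> 0" by blast
      then have "\<not> d2 \<ge> d1" using act_eq_0_of_A by blast
      then have d2: "d2 \<ge> d1 - 1" and np: "\<not> (\<exists>L\<in>homog {1..n} 1. homog_comp d1 f = dp_power {1..n} L d1)"
        using cond by auto
      note gap = dim_A_gap[OF d2 np \<theta>]
      have "mp.dim (T d1) = (r - 1) + mp.dim (A d1)" using gap(1) r_pos by simp
      then have "(r - 1) + mp.dim (up n (A d1)) \<le> mp.dim (T (Suc d1))"
        using codim_up_Ann_deg_ge[OF F_T cv d] by (simp add: AA)
      then show False using gap(2) r_pos by simp
    qed
  qed
qed

end

theorem theorem4p3:
  fixes n d1 d2 r :: nat
    and f :: "(nat, 'k::alg_closed_field) mpoly"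
  assumes "n \<ge> 1"
    and "f \<in> polys {1..n}"
    and "tdeg f = d1"
    and "d1 \<ge> 1"
    and "enat r = quot_dim pscale (polys {1..n}) (Ann {1..n} f)"
  shows "cactus_rank n (d1 + d2) (dp_hom f d2) \<le> r
    \<and> (d2 \<ge> d1 \<or>
         (d2 = d1 - 1 \<and> \<not> (\<exists>L\<in>homog {1..n} 1. homog_comp d1 f = dp_power {1..n} L d1)) \<longrightarrow>
       \<not> (\<exists>J. homogeneous_ideal {..n} J \<and> J \<subseteq> Ann {..n} (dp_hom f d2) \<and>
              standard_function TYPE('k) (r - 1) (n + 1) (hilbert_function n J))
       \<and> border_cactus_rank n (d1 + d2) (dp_hom f d2) = r)
    \<and> (\<not> (\<exists>L\<in>homog {1..n} 1. homog_comp d1 f = dp_power {1..n} L d1) \<and>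
         (d2 \<ge> d1 \<or> (d2 = d1 - 1 \<and> r > 2 * d1)) \<longrightarrow>
       (\<forall>J. homogeneous_ideal {..n} J \<and> J \<subseteq> Ann {..n} (dp_hom f d2) \<and>
            standard_function TYPE('k) r (n + 1) (hilbert_function n J) \<longrightarrow>
            saturation n J = hom_ideal n (Ann {1..n} f)))"
proof -
  interpret hom_ann n d1 d2 r f by unfold_locales (use assms in auto)
  have F: "dp_hom f d2 = F" using dp_hom_eq_hz[OF f, of d2] by (simp add: F_def deg_f)
  show ?thesis
    unfolding F
  proof (intro conjI impI allI notI; (elim exE conjE)?)
    show "cactus_rank n (d1 + d2) F \<le> r" by (rule cactus_rank_le)
  next
    fix J
    assume "d2 \<ge> d1 \<or> d2 = d1 - 1 \<and> \<not> (\<exists>L\<in>homog {1..n} 1. homog_comp d1 f = dp_power {1..n} L d1)"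
      and "homogeneous_ideal {..n} J" "J \<subseteq> Ann {..n} F"
      and "standard_function TYPE('k) (r - 1) (n + 1) (hilbert_function n J)"
    then show False using no_standard_ideal[of J] by blast
  next
    assume "d2 \<ge> d1 \<or> d2 = d1 - 1 \<and> \<not> (\<exists>L\<in>homog {1..n} 1. homog_comp d1 f = dp_power {1..n} L d1)"
    then show "border_cactus_rank n (d1 + d2) F = r" by (rule border_cactus_rank_eq)
  next
    fix J
    assume "\<not> (\<exists>L\<in>homog {1..n} 1. homog_comp d1 f = dp_power {1..n} L d1)"
      and "d2 \<ge> d1 \<or> d2 = d1 - 1 \<and> r > 2 * d1"
      and "homogeneous_ideal {..n} J" "J \<subseteq> Ann {..n} F"
      and "standard_function TYPE('k) r (n + 1) (hilbert_function n J)"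
    then show "saturation n J = hom_ideal n (Ann {1..n} f)" by (intro saturation_J)
  qed
qed

end
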